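(* Let $\Gamma$ be a compact metric graph. Let $\gamma: C(\Gamma)\cap\bigoplus_{e\in\mathcal E}C^2(e)\to\mathbb R^{\sum_{v\in\mathcal V}d_v}$ be the trace operator $\gamma u=\{u|_e(0),u|_e(l_e)\}_{e\in\mathcal E}$, which collects the values of $u$ at the vertices of each edge. Then, for every $\frac12<s\le2$, $\gamma$ has a unique extension to a bounded linear operator $$\gamma:H^s(\Gamma)\to\mathbb R^{\sum_{v\in\mathcal V}d_v}.$$ Similarly, for every $\frac12<s\le2$, $\gamma$ also has a unique extension to a bounded linear operator $$\gamma:\widetilde H^s(\Gamma)\to\mathbb R^{\sum_{v\in\mathcal V}d_v}.$$
   Context: A compact metric graph $\Gamma$ consists of a finite vertex set $\mathcal V$ and a finite edge set $\mathcal E$ (loops and multiple edges allowed); each edge $e$ is identified with $[0,l_e]$, $0<l_e<\infty$; $d_v$ is the degree of $v$ (loops counted twice), so $\sum_vd_v=2|\mathcal E|$. $C(\Gamma)$ is the space of continuous functions on $\Gamma$; $C^2(e)$ is the space of twice continuously differentiable functions on $[0,l_e]$; $L_2(\Gamma)=\bigoplus_eL_2(e)$; for $r\in\mathbb N$, $\widetilde H^r(\Gamma)=\bigoplus_eH^r(e)$ with $\|u\|^2=\sum_e\|u_e\|^2_{H^r(e)}$, $H^1(\Gamma)=\widetilde H^1(\Gamma)\cap C(\Gamma)$, $\widetilde H^2_C(\Gamma)=\widetilde H^2(\Gamma)\cap C(\Gamma)$, and $H^2(\Gamma)=\widetilde H^2_C(\Gamma)$. With $(\cdot,\cdot)_\theta$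 real interpolation of Hilbert spaces ($K$-method, exponent 2): for $0<s<1$, $H^s(\Gamma)=(L_2(\Gamma),H^1(\Gamma))_s$ and $\widetilde H^s(\Gamma)=(L_2(\Gamma),\widetilde H^1(\Gamma))_s$; for $1<s<2$, $H^s(\Gamma)=(H^1(\Gamma),\widetilde H^2_C(\Gamma))_{s-1}$ and $\widetilde H^s(\Gamma)=(\widetilde H^1(\Gamma),\widetilde H^2(\Gamma))_{s-1}$.
   Formalization: For H̃^s the trace γ is taken on all of ⊕C²(e), without continuity at the vertices, since uniqueness from C(Γ)∩⊕C²(e) fails as soon as a vertex has degree at least 2 (that set is not dense in H̃^s). *)

theory Defs
  imports "HOL-Analysis.Analysis" "HOL-Library.Function_Algebras"
begin

section \<open>Compact metric graphs\<close>

text \<open>Edge \<open>e\<close> is the interval \<open>[0, len G e]\<close>, attached at \<open>0\<close> to \<open>src G e\<close> and at \<open>len G e\<close> to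
  \<open>tgt G e\<close>. Loops and multiple edges are possible, and connectedness is not required.\<close>

record ('v, 'e) metric_graph =
  verts :: "'v set"
  edges :: "'e set"
  src :: "'e \<Rightarrow> 'v"
  tgt :: "'e \<Rightarrow> 'v"
  len :: "'e \<Rightarrow> real"

definition compact_metric_graph :: "('v, 'e) metric_graph \<Rightarrow> bool" where
  "compact_metric_graph G \<longleftrightarrow> finite (verts G) \<and> finite (edges G) \<and>
     (\<forall>e\<in>edges G. src G e \<in> verts G \<and> tgt G e \<in> verts G \<and> 0 < len G e)"

definition degree :: "('v, 'e) metric_graph \<Rightarrow> 'v \<Rightarrow> nat" where
  "degree G v = card {e \<in> edges G. src G e = v} + card {e \<in> edges G. tgt G e = v}"

datatype edge_end = Initial | Terminal

definition edge_ends :: "('v, 'e) metric_graph \<Rightarrow> ('e \<times> edge_end) set" where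
  "edge_ends G = edges G \<times> {Initial, Terminal}"

lemma sum_degree_eq_card_edge_ends:
  assumes "compact_metric_graph G"
  shows "(\<Sum>v\<in>verts G. degree G v) = card (edge_ends G)"
proof -
  have fin: "finite (edges G)" "finite (verts G)"
    using assms by (auto simp: compact_metric_graph_def)
  have count: "(\<Sum>v\<in>verts G. card {e \<in> edges G. f e = v}) = card (edges G)"
    if "f ` edges G \<subseteq> verts G" for f
  proof -
    have "card (edges G) = (\<Sum>v\<in>verts G. \<Sum>e\<in>{e \<in> edges G. f e = v}. 1)"
      using sum.group[OF fin that, of "\<lambda>_. 1::nat"] by simp
    then show ?thesis by simp
  qed
  have "src G ` edges G \<subseteq> verts G" "tgt G ` edges G \<subseteq> verts G"
    using assms by (auto simp: compact_metric_graph_def)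
  then show ?thesis
    by (simp add: degree_def sum.distrib count edge_ends_def card_cartesian_product)
qed

text \<open>The point set of \<open>\<Gamma>\<close> is the union of the vertices and the open edges, with the quotient topology
  of the disjoint union of the vertices and the closed edges, glued along \<open>edge_pt\<close>.\<close>

datatype ('v, 'e) point = Vertex 'v | Inner 'e real

definition points :: "('v, 'e) metric_graph \<Rightarrow> ('v, 'e) point set" where
  "points G = Vertex ` verts G \<union> {Inner e x |e x. e \<in> edges G \<and> 0 < x \<and> x < len G e}"

definition edge_pt :: "('v, 'e) metric_graph \<Rightarrow> 'e \<Rightarrow> real \<Rightarrow> ('v, 'e) point" where
  "edge_pt G e x =
     (if x = 0 then Vertex (src G e) else if x = len G e then Vertex (tgt G e) else Inner e x)"

definition graph_open :: "('v, 'e) metric_graph \<Rightarrow> ('v, 'e) point set \<Rightarrow> bool" where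
  "graph_open G U \<longleftrightarrow> U \<subseteq> points G \<and>
     (\<forall>e\<in>edges G. openin (top_of_set {0..len G e}) {x \<in> {0..len G e}. edge_pt G e x \<in> U})"

lemma istopology_graph_open: "istopology (graph_open G)"
  unfolding istopology_def
proof (intro conjI allI impI)
  fix S T assume ST: "graph_open G S" "graph_open G T"
  have "{x \<in> {0..len G e}. edge_pt G e x \<in> S \<inter> T} =
      {x \<in> {0..len G e}. edge_pt G e x \<in> S} \<inter> {x \<in> {0..len G e}. edge_pt G e x \<in> T}" for e
    by auto
  then show "graph_open G (S \<inter> T)"
    using ST unfolding graph_open_def by (auto intro!: openin_Int)
next
  fix K assume K: "\<forall>S\<in>K. graph_open G S"
  have "{x \<in> {0..len G e}. edge_pt G e x \<in> \<Union>K} =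
      (\<Union>S\<in>K. {x \<in> {0..len G e}. edge_pt G e x \<in> S})" for e
    by auto
  then show "graph_open G (\<Union>K)"
    using K unfolding graph_open_def by (auto intro!: openin_Union)
qed

definition graph_topology :: "('v, 'e) metric_graph \<Rightarrow> ('v, 'e) point topology" where
  "graph_topology G = topology (graph_open G)"


section \<open>Functions on a graph\<close>

text \<open>A function on \<open>\<Gamma>\<close> is a family \<open>u\<close> of functions \<open>u e\<close> on the edges; only the values \<open>u e x\<close> with
  \<open>e \<in> edges G\<close> and \<open>x \<in> {0..len G e}\<close> matter. The spaces below consist of representatives rather
  than of a.e. classes, and are accordingly equipped with seminorms, whose null elements are the
  families vanishing a.e. on every edge.\<close>

type_synonym 'e gfun = "'e \<Rightarrow> real \<Rightarrow> real"

type_synonym 'a seminormed = "'a set \<times> ('a \<Rightarrow> real)"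

abbreviation carrier :: "'a seminormed \<Rightarrow> 'a set" where "carrier X \<equiv> fst X"
abbreviation seminorm :: "'a seminormed \<Rightarrow> 'a \<Rightarrow> real" where "seminorm X \<equiv> snd X"

definition C_graph :: "('v, 'e) metric_graph \<Rightarrow> 'e gfun set" where
  "C_graph G = {u. \<exists>f. continuous_map (graph_topology G) euclideanreal f \<and>
     (\<forall>e\<in>edges G. \<forall>x\<in>{0..len G e}. u e x = f (edge_pt G e x))}"

text \<open>Derivatives at the endpoints are one-sided.\<close>

definition C2_interval :: "real \<Rightarrow> (real \<Rightarrow> real) set" where
  "C2_interval l = {f. \<exists>f' f''. continuous_on {0..l} f'' \<and>
     (\<forall>x\<in>{0..l}. (f has_real_derivative f' x) (at x within {0..l}) \<and>
                 (f' has_real_derivative f'' x) (at x within {0..l}))}"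

definition C2_edges :: "('v, 'e) metric_graph \<Rightarrow> 'e gfun set" where
  "C2_edges G = {u. \<forall>e\<in>edges G. u e \<in> C2_interval (len G e)}"


subsection \<open>Sobolev spaces on an interval\<close>

definition L2_interval :: "real \<Rightarrow> (real \<Rightarrow> real) set" where
  "L2_interval l = {f \<in> borel_measurable (lebesgue_on {0..l}).
     integrable (lebesgue_on {0..l}) (\<lambda>x. (f x)\<^sup>2)}"

definition L2_norm_interval :: "real \<Rightarrow> (real \<Rightarrow> real) \<Rightarrow> real" where
  "L2_norm_interval l f = sqrt (integral\<^sup>L (lebesgue_on {0..l}) (\<lambda>x. (f x)\<^sup>2))"

text \<open>The smooth functions with compact support in the open interval \<open>(0,l)\<close>, extended by zero.\<close>

definition test_fun :: "real \<Rightarrow> (real \<Rightarrow> real) set" where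
  "test_fun l = {\<phi>. (\<forall>k x. (deriv ^^ k) \<phi> differentiable at x) \<and>
     (\<exists>a b. 0 < a \<and> b < l \<and> (\<forall>x. x \<notin> {a..b} \<longrightarrow> \<phi> x = 0))}"

definition has_weak_deriv :: "real \<Rightarrow> nat \<Rightarrow> (real \<Rightarrow> real) \<Rightarrow> (real \<Rightarrow> real) \<Rightarrow> bool" where
  "has_weak_deriv l k f g \<longleftrightarrow> (\<forall>\<phi>\<in>test_fun l.
     integral\<^sup>L (lebesgue_on {0..l}) (\<lambda>x. f x * (deriv ^^ k) \<phi> x) =
     (-1) ^ k * integral\<^sup>L (lebesgue_on {0..l}) (\<lambda>x. g x * \<phi> x))"

definition H_interval :: "nat \<Rightarrow> real \<Rightarrow> (real \<Rightarrow> real) set" where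
  "H_interval r l = {f \<in> L2_interval l. \<forall>k\<le>r. \<exists>g\<in>L2_interval l. has_weak_deriv l k f g}"

text \<open>Weak derivatives are unique up to null sets, so the choice does not affect the norm below.\<close>

definition weak_deriv :: "real \<Rightarrow> nat \<Rightarrow> (real \<Rightarrow> real) \<Rightarrow> real \<Rightarrow> real" where
  "weak_deriv l k f = (SOME g. g \<in> L2_interval l \<and> has_weak_deriv l k f g)"

definition H_norm_interval :: "nat \<Rightarrow> real \<Rightarrow> (real \<Rightarrow> real) \<Rightarrow> real" where
  "H_norm_interval r l f = sqrt (\<Sum>k\<le>r. (L2_norm_interval l (weak_deriv l k f))\<^sup>2)"


subsection \<open>Sobolev spaces of integer order on a graph\<close>

definition L2_graph :: "('v, 'e) metric_graph \<Rightarrow> 'e gfun seminormed" where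
  "L2_graph G = ({u. \<forall>e\<in>edges G. u e \<in> L2_interval (len G e)},
     \<lambda>u. sqrt (\<Sum>e\<in>edges G. (L2_norm_interval (len G e) (u e))\<^sup>2))"

definition Ht_int :: "('v, 'e) metric_graph \<Rightarrow> nat \<Rightarrow> 'e gfun seminormed" where
  "Ht_int G r = ({u. \<forall>e\<in>edges G. u e \<in> H_interval r (len G e)},
     \<lambda>u. sqrt (\<Sum>e\<in>edges G. (H_norm_interval r (len G e) (u e))\<^sup>2))"

text \<open>The space \<open>Ht_int G r\<close> intersected with \<open>C(\<Gamma>)\<close>: a class of functions lies in \<open>C(\<Gamma>)\<close> if
  it has a continuous representative.\<close>

definition HtC_int :: "('v, 'e) metric_graph \<Rightarrow> nat \<Rightarrow> 'e gfun seminormed" where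
  "HtC_int G r = ({u \<in> carrier (Ht_int G r). \<exists>w\<in>C_graph G. \<forall>e\<in>edges G.
       AE x in lebesgue_on {0..len G e}. u e x = w e x},
     seminorm (Ht_int G r))"


subsection \<open>Real interpolation and fractional Sobolev spaces\<close>

text \<open>The K-method with exponent 2, using the quadratic K-functional customary for Hilbert spaces; it
  agrees with the infimum of \<open>\<parallel>a\<parallel> + t \<parallel>b\<parallel>\<close> up to a factor between 1 and \<open>sqrt 2\<close>.\<close>

definition K_fun :: "'a::plus seminormed \<Rightarrow> 'a seminormed \<Rightarrow> real \<Rightarrow> 'a \<Rightarrow> real" where
  "K_fun X Y t u = Inf {sqrt ((seminorm X a)\<^sup>2 + t\<^sup>2 * (seminorm Y b)\<^sup>2) |a b.
     a \<in> carrier X \<and> b \<in> carrier Y \<and> u = a + b}"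

definition interp_nn :: "'a::plus seminormed \<Rightarrow> 'a seminormed \<Rightarrow> real \<Rightarrow> 'a \<Rightarrow> ennreal" where
  "interp_nn X Y \<theta> u =
     (\<integral>\<^sup>+t\<in>{0<..}. ennreal ((t powr (-\<theta>) * K_fun X Y t u)\<^sup>2 / t) \<partial>lborel)"

definition interp :: "'a::plus seminormed \<Rightarrow> 'a seminormed \<Rightarrow> real \<Rightarrow> 'a seminormed" where
  "interp X Y \<theta> =
     ({u. (\<exists>a\<in>carrier X. \<exists>b\<in>carrier Y. u = a + b) \<and> interp_nn X Y \<theta> u < \<infinity>},
      \<lambda>u. sqrt (enn2real (interp_nn X Y \<theta> u)))"

text \<open>Both scales are meant for \<open>0 < s \<le> 2\<close>.\<close>

definition H_graph :: "('v, 'e) metric_graph \<Rightarrow> real \<Rightarrow> 'e gfun seminormed" where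
  "H_graph G s =
     (if s < 1 then interp (L2_graph G) (HtC_int G 1) s
      else if s = 1 then HtC_int G 1
      else if s < 2 then interp (HtC_int G 1) (HtC_int G 2) (s - 1)
      else HtC_int G 2)"

definition Ht_graph :: "('v, 'e) metric_graph \<Rightarrow> real \<Rightarrow> 'e gfun seminormed" where
  "Ht_graph G s =
     (if s < 1 then interp (L2_graph G) (Ht_int G 1) s
      else if s = 1 then Ht_int G 1
      else if s < 2 then interp (Ht_int G 1) (Ht_int G 2) (s - 1)
      else Ht_int G 2)"


section \<open>The trace and bounded operators into the trace space\<close>

text \<open>The space of dimension \<open>\<Sum>v. degree G v\<close> is realised as the functions on all edge ends of the
  ambient type which vanish off \<open>edge_ends G\<close>, with the Euclidean norm \<open>L2_set _ (edge_ends G)\<close>.\<close>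

definition trace_space :: "('v, 'e) metric_graph \<Rightarrow> ('e \<times> edge_end \<Rightarrow> real) set" where
  "trace_space G = {y. \<forall>i. i \<notin> edge_ends G \<longrightarrow> y i = 0}"

definition end_trace :: "('v, 'e) metric_graph \<Rightarrow> 'e gfun \<Rightarrow> 'e \<times> edge_end \<Rightarrow> real" where
  "end_trace G u = (\<lambda>(e, b). if e \<in> edges G
     then (case b of Initial \<Rightarrow> u e 0 | Terminal \<Rightarrow> u e (len G e)) else 0)"

text \<open>The operator is a function on representatives; being linear and bounded by the seminorm it takes
  equal values on a.e. equal representatives. The use of \<open>\<rightarrow>\<^sub>E\<close> pins down its junk values off the
  carrier, so that uniqueness can be stated by \<open>\<exists>!\<close>.\<close>

definition bounded_operator ::
    "('v, 'e) metric_graph \<Rightarrow> 'e gfun seminormed \<Rightarrow> ('e gfun \<Rightarrow> 'e \<times> edge_end \<Rightarrow> real) \<Rightarrow> bool" where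
  "bounded_operator G X T \<longleftrightarrow> T \<in> carrier X \<rightarrow>\<^sub>E trace_space G \<and>
     (\<forall>u\<in>carrier X. \<forall>v\<in>carrier X. T (u + v) = T u + T v) \<and>
     (\<forall>c. \<forall>u\<in>carrier X. T (\<lambda>e x. c * u e x) = (\<lambda>i. c * T u i)) \<and>
     (\<exists>B. \<forall>u\<in>carrier X. L2_set (T u) (edge_ends G) \<le> B * seminorm X u)"

text \<open>Uniqueness depends on the domain \<open>D\<close>. In the scale \<open>H_graph\<close> one takes
  \<open>C_graph G \<inter> C2_edges G\<close>. In the scale \<open>Ht_graph\<close>, which carries no continuity condition at the
  vertices, that set is not dense and would admit many bounded extensions once some vertex has degree
  at least 2; there the same formula \<open>end_trace G\<close> has to be given on all of \<open>C2_edges G\<close>.\<close>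

definition has_unique_bounded_extension ::
    "('v, 'e) metric_graph \<Rightarrow> 'e gfun set \<Rightarrow> ('e gfun \<Rightarrow> 'e \<times> edge_end \<Rightarrow> real)
      \<Rightarrow> 'e gfun seminormed \<Rightarrow> bool" where
  "has_unique_bounded_extension G D f X \<longleftrightarrow>
     D \<subseteq> carrier X \<and> (\<exists>!T. bounded_operator G X T \<and> (\<forall>u\<in>D. T u = f u))"

end

theory Submission
  imports Defs "HOL-Computational_Algebra.Polynomial"
begin

text \<open>Fix an end of an edge and average \<open>u\<close> against smooth kernels \<open>\<kappa> j\<close> of mass 1, concentrated at distance
  of order \<open>2^(-j)\<close> from that end. The differences \<open>\<kappa> j - \<kappa> (j + 1)\<close> have mean zero, so they are derivatives
  of test functions; hence consecutive averages differ by at most a multiple of \<open>2^(j/2) \<parallel>u\<parallel>\<close> in terms of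
  the \<open>L2\<close> norm and of \<open>2^(-j/2) \<parallel>u\<parallel>\<close> in terms of the \<open>H^1\<close> norm, and therefore of
  \<open>2^(j/2) K(2^(-j), u) \<le> c 2^(j (1/2 - s)) \<parallel>u\<parallel>\<close> on the interpolation space. For \<open>s > 1/2\<close> the averages
  converge, and their limit is the bounded trace. Uniqueness is density of smooth functions: polynomials are dense
  in \<open>H^1\<close> and \<open>H^2\<close> of an interval by Poincare's inequality, a linear correction restores the boundary
  values, and nearly optimal decompositions for the K-functional show that the smaller space of a couple
  is dense in the interpolation space.\<close>

section \<open>Smooth functions\<close>

text \<open>Elements of the spaces are representatives, so values at the ends carry no meaning by
  themselves and a trace has to be read off from integrals. Compactly supported kernels suit the
  definition of the weak derivative: testing with a primitive of a kernel difference moves the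
  derivative onto \<open>u\<close> without boundary terms, so that neither absolutely continuous
  representatives nor the embedding of H^1 into the continuous functions enter. The dyadic scale
  matches interpolation: the two bounds for an increment differ by the factor 2^j, which singles out
  the K-functional at 2^(-j). Only 1/2 < s < 1 needs interpolated estimates; for s >= 1 the bound is
  inherited from H^1 along an embedding. At s = 1/2 the increments would no longer decay. The
  obstacle to uniqueness in the scale \<open>H_graph\<close> is that approximants must stay
  continuous across the vertices. Approximation edge by edge destroys this unless end values are
  reproduced exactly; hence the trace on H^1 is built before density of smooth functions on the
  graph, and serves in its proof.\<close>

definition smooth :: "(real \<Rightarrow> real) \<Rightarrow> bool" where
  "smooth f \<longleftrightarrow> (\<forall>k x. (deriv ^^ k) f differentiable at x)"

text \<open>Smoothness is a greatest fixed point. The closure properties below come from choosing a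
  class \<open>S\<close> that contains a derivative of each of its members, which avoids Leibniz and
  chain rules for iterates of \<open>deriv\<close>.\<close>

lemma smooth_coinduct:
  assumes "f \<in> S"
    and step: "\<And>g. g \<in> S \<Longrightarrow> \<exists>g'\<in>S. \<forall>x. (g has_real_derivative g' x) (at x)"
  shows "smooth f"
proof -
  have "(deriv ^^ k) f \<in> S" for k
  proof (induction k)
    case (Suc k)
    obtain g' where "g' \<in> S" "\<forall>x. ((deriv ^^ k) f has_real_derivative g' x) (at x)"
      using step[OF Suc] by blast
    moreover from this have "deriv ((deriv ^^ k) f) = g'"
      by (intro ext DERIV_imp_deriv) auto
    ultimately show ?case by simp
  qed (use assms in simp)
  with step show ?thesis
    unfolding smooth_def by (meson real_differentiable_def)
qed

lemma smooth_DERIV: "smooth f \<Longrightarrow> (f has_real_derivative deriv f x) (at x)"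
  unfolding smooth_def
  by (metis DERIV_deriv_iff_real_differentiable funpow_0)

lemma smooth_deriv: "smooth f \<Longrightarrow> smooth (deriv f)"
  unfolding smooth_def by (metis comp_apply funpow_Suc_right)

lemma smooth_isCont: "smooth f \<Longrightarrow> isCont f x"
  using smooth_DERIV DERIV_isCont by blast

lemma smooth_continuous_on: "smooth f \<Longrightarrow> continuous_on A f"
  by (simp add: continuous_at_imp_continuous_on smooth_isCont)

lemma smoothI_antiderivative:
  assumes "\<And>x. (f has_real_derivative g x) (at x)" "smooth g"
  shows "smooth f"
  by (rule smooth_coinduct[of _ "insert f (Collect smooth)"])
    (use assms smooth_DERIV smooth_deriv in blast)+

lemma smooth_poly: "smooth (poly p)"
  by (rule smooth_coinduct[of _ "range poly"]) (auto intro: poly_DERIV)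

lemma smooth_const: "smooth (\<lambda>x. c)"
proof -
  have "poly [:c:] = (\<lambda>x. c)" by (intro ext) simp
  then show ?thesis using smooth_poly[of "[:c:]"] by metis
qed

text \<open>Single products are not closed under differentiation, but their finite sums are, by the
  product rule. This is the class for the coinduction; plain sums arise from it by multiplying with
  the constant 1.\<close>

inductive sum_of_products :: "(real \<Rightarrow> real) \<Rightarrow> bool" where
  mult: "smooth f \<Longrightarrow> smooth g \<Longrightarrow> sum_of_products (\<lambda>x. f x * g x)"
| add: "sum_of_products f \<Longrightarrow> sum_of_products g \<Longrightarrow> sum_of_products (\<lambda>x. f x + g x)"

lemma sum_of_products_DERIV:
  assumes "sum_of_products h"
  shows "\<exists>h'. sum_of_products h' \<and> (\<forall>x. (h has_real_derivative h' x) (at x))"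
  using assms
proof induction
  case (mult f g)
  have "((\<lambda>x. f x * g x) has_real_derivative f x * deriv g x + deriv f x * g x) (at x)" for x
    by (rule DERIV_mult'[OF smooth_DERIV[OF mult(1)] smooth_DERIV[OF mult(2)]])
  moreover have "sum_of_products (\<lambda>x. f x * deriv g x + deriv f x * g x)"
    by (intro sum_of_products.add sum_of_products.mult smooth_deriv mult)
  ultimately show ?case
    by (rule_tac x="\<lambda>x. f x * deriv g x + deriv f x * g x" in exI) simp
next
  case (add f g)
  then obtain f' g' where D: "sum_of_products f'" "\<And>x. (f has_real_derivative f' x) (at x)"
      "sum_of_products g'" "\<And>x. (g has_real_derivative g' x) (at x)"
    by auto
  show ?case
    by (rule_tac x="\<lambda>x. f' x + g' x" in exI) (simp add: D sum_of_products.add DERIV_add)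
qed

lemma sum_of_products_smooth: "sum_of_products h \<Longrightarrow> smooth h"
  by (rule smooth_coinduct[of _ "Collect sum_of_products"]) (auto dest: sum_of_products_DERIV)

lemma smooth_mult: "smooth f \<Longrightarrow> smooth g \<Longrightarrow> smooth (\<lambda>x. f x * g x)"
  by (rule sum_of_products_smooth[OF sum_of_products.mult])

lemma smooth_add:
  assumes "smooth f" "smooth g"
  shows "smooth (\<lambda>x. f x + g x)"
proof -
  have "sum_of_products (\<lambda>x. f x * 1 + g x * 1)"
    by (intro sum_of_products.intros assms smooth_const)
  from sum_of_products_smooth[OF this] show ?thesis by simp
qed

text \<open>Each differentiation produces a factor \<open>c\<close>, so the class for the
  coinduction carries a free scalar \<open>a\<close>.\<close>

lemma smooth_affine:
  assumes "smooth f"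
  shows "smooth (\<lambda>x. f (c * x + d))"
proof (rule smooth_coinduct[of _ "{(\<lambda>x. a * g (c * x + d)) |a g. smooth g}"])
  show "(\<lambda>x. f (c * x + d)) \<in> {(\<lambda>x. a * g (c * x + d)) |a g. smooth g}"
    using assms by (intro CollectI exI[of _ 1] exI[of _ f]) simp
next
  fix h assume "h \<in> {(\<lambda>x. a * g (c * x + d)) |a g. smooth g}"
  then obtain a g where h: "h = (\<lambda>x. a * g (c * x + d))" "smooth g" by auto
  have "(h has_real_derivative (a * c) * deriv g (c * x + d)) (at x)" for x
  proof -
    have "((\<lambda>x. c * x + d) has_real_derivative c) (at x)"
      by (auto intro!: derivative_eq_intros)
    from DERIV_cmult[OF DERIV_chain2[OF smooth_DERIV[OF h(2)] this], of a] show ?thesis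
      unfolding h by (simp add: mult_ac)
  qed
  moreover have "(\<lambda>x. (a * c) * deriv g (c * x + d)) \<in> {(\<lambda>x. a * g (c * x + d)) |a g. smooth g}"
    using smooth_deriv[OF h(2)] by blast
  ultimately show "\<exists>g'\<in>{(\<lambda>x. a * g (c * x + d)) |a g. smooth g}. \<forall>x. (h has_real_derivative g' x) (at x)"
    by (intro bexI[of _ "\<lambda>x. (a * c) * deriv g (c * x + d)"]) simp_all
qed

text \<open>For \<open>p = 1\<close> this is the classical function exp(-1/x), extended by zero to x
  <= 0. The polynomial in 1/x makes the family closed under differentiation.\<close>

definition flat_exp :: "real poly \<Rightarrow> real \<Rightarrow> real" where
  "flat_exp p x = (if x > 0 then poly p (1 / x) * exp (- (1 / x)) else 0)"

lemma poly_times_exp_minus_tendsto_0: "((\<lambda>y::real. poly p y * exp (- y)) \<longlongrightarrow> 0) at_top"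
proof -
  have "((\<lambda>y::real. \<Sum>i\<le>Polynomial.degree p. coeff p i * (y ^ i / exp y)) \<longlongrightarrow> (\<Sum>i\<le>Polynomial.degree p. coeff p i * 0)) at_top"
    by (intro tendsto_intros tendsto_power_div_exp_0)
  then show ?thesis
    by (simp add: poly_altdef sum_divide_distrib exp_minus divide_inverse[symmetric])
qed

text \<open>With y = 1/x the derivative of p(y) exp(-y) with respect to x is y^2 (p(y) - p'(y))
  exp(-y), whence the polynomial on the right. At 0 the difference quotient from the right is y p(y)
  exp(-y) as y tends to infinity, which is why \<open>pCons 0 p\<close> occurs.\<close>

lemma DERIV_flat_exp:
  "(flat_exp p has_real_derivative flat_exp ([:0, 0, 1:] * (p - pderiv p)) x) (at x)"
proof (cases x "0 :: real" rule: linorder_cases)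
  case less
  have "((\<lambda>_. 0) has_real_derivative 0) (at x)" by simp
  then have "(flat_exp p has_real_derivative 0) (at x)"
    by (rule has_field_derivative_transform_within_open[of _ _ _ "{..<0}"])
      (use less in \<open>auto simp: flat_exp_def\<close>)
  with less show ?thesis by (simp add: flat_exp_def)
next
  case greater
  have "((\<lambda>x. poly p (1 / x) * exp (- (1 / x))) has_real_derivative
     flat_exp ([:0, 0, 1:] * (p - pderiv p)) x) (at x)"
    using greater unfolding flat_exp_def
    by (auto intro!: derivative_eq_intros DERIV_chain2[OF poly_DERIV]
        simp: field_simps power2_eq_square)
  then show ?thesis
    by (rule has_field_derivative_transform_within_open[of _ _ _ "{0<..}"])
      (use greater in \<open>auto simp: flat_exp_def\<close>)
next
  case equal
  have "((\<lambda>h. poly (pCons 0 p) (inverse h) * exp (- inverse h)) \<longlongrightarrow> 0) (at_right (0::real))"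
    by (rule filterlim_compose[OF poly_times_exp_minus_tendsto_0 filterlim_inverse_at_top_right])
  then have R: "((\<lambda>h. (flat_exp p (0 + h) - flat_exp p 0) / h) \<longlongrightarrow> 0) (at_right 0)"
    by (rule Lim_transform_eventually)
      (auto simp: flat_exp_def eventually_at_filter divide_inverse)
  have "((\<lambda>h. 0) \<longlongrightarrow> (0::real)) (at_left (0::real))" by simp
  then have L: "((\<lambda>h. (flat_exp p (0 + h) - flat_exp p 0) / h) \<longlongrightarrow> 0) (at_left 0)"
    by (rule Lim_transform_eventually)
      (auto simp: flat_exp_def eventually_at_filter divide_inverse)
  show ?thesis
    using filterlim_split_at[OF L R] equal
    by (simp add: DERIV_def) (simp add: flat_exp_def)
qed

lemma smooth_flat_exp: "smooth (flat_exp p)"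
  by (rule smooth_coinduct[of _ "range flat_exp"]) (auto intro: DERIV_flat_exp)

section \<open>Test functions\<close>

lemma test_fun_iff:
  "\<phi> \<in> test_fun l \<longleftrightarrow> smooth \<phi> \<and> (\<exists>a b. 0 < a \<and> b < l \<and> (\<forall>x. x \<notin> {a..b} \<longrightarrow> \<phi> x = 0))"
  by (simp add: test_fun_def smooth_def)

lemma test_fun_smooth: "\<phi> \<in> test_fun l \<Longrightarrow> smooth \<phi>"
  by (simp add: test_fun_iff)

lemma test_fun_outside: "\<phi> \<in> test_fun l \<Longrightarrow> x \<le> 0 \<or> l \<le> x \<Longrightarrow> \<phi> x = 0"
  unfolding test_fun_iff by (metis atLeastAtMost_iff le_less_trans less_le_trans not_le)

lemma test_fun_deriv:
  assumes "\<phi> \<in> test_fun l"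
  shows "deriv \<phi> \<in> test_fun l"
proof -
  obtain a b where ab: "0 < a" "b < l" "\<And>x. x \<notin> {a..b} \<Longrightarrow> \<phi> x = 0"
    using assms by (auto simp: test_fun_iff)
  have "deriv \<phi> x = 0" if "x \<notin> {a..b}" for x
  proof (rule DERIV_imp_deriv)
    have "((\<lambda>_. 0) has_real_derivative 0) (at x)" by simp
    then show "(\<phi> has_real_derivative 0) (at x)"
      by (rule has_field_derivative_transform_within_open[of _ _ _ "- {a..b}"])
        (use that ab(3) in auto)
  qed
  then show ?thesis
    using assms ab smooth_deriv[of \<phi>] unfolding test_fun_iff by blast
qed

lemma test_fun_higher_deriv: "\<phi> \<in> test_fun l \<Longrightarrow> (deriv ^^ k) \<phi> \<in> test_fun l"
  by (induction k) (auto intro: test_fun_deriv)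

lemma test_fun_add:
  assumes "\<phi> \<in> test_fun l" "\<psi> \<in> test_fun l"
  shows "(\<lambda>x. \<phi> x + \<psi> x) \<in> test_fun l"
proof -
  obtain a b c d where "0 < a" "b < l" "\<And>x. x \<notin> {a..b} \<Longrightarrow> \<phi> x = 0"
     "0 < c" "d < l" "\<And>x. x \<notin> {c..d} \<Longrightarrow> \<psi> x = 0"
    using assms unfolding test_fun_iff by metis
  then have "0 < min a c \<and> max b d < l \<and> (\<forall>x. x \<notin> {min a c..max b d} \<longrightarrow> \<phi> x + \<psi> x = 0)"
    by (simp add: min_le_iff_disj le_max_iff_disj)
  then show ?thesis
    using assms smooth_add[of \<phi> \<psi>] unfolding test_fun_iff by blast
qed

lemma test_fun_smooth_mult:
  assumes "\<phi> \<in> test_fun l" "smooth \<psi>"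
  shows "(\<lambda>x. \<psi> x * \<phi> x) \<in> test_fun l"
  using assms unfolding test_fun_iff by (auto intro: smooth_mult)

lemma test_fun_cmult: "\<phi> \<in> test_fun l \<Longrightarrow> (\<lambda>x. c * \<phi> x) \<in> test_fun l"
  by (rule test_fun_smooth_mult[OF _ smooth_const])

lemma test_fun_diff:
  assumes "\<phi> \<in> test_fun l" "\<psi> \<in> test_fun l"
  shows "(\<lambda>x. \<phi> x - \<psi> x) \<in> test_fun l"
  using test_fun_add[OF assms(1) test_fun_cmult[OF assms(2), of "-1"]] by simp

text \<open>Dilation by \<open>c >= 1\<close> moves a support in [a, b] to [a/c, b/c], which is
  still bounded away from 0 and does not come closer to \<open>l\<close>.\<close>

lemma test_fun_dilate:
  assumes "\<phi> \<in> test_fun l" "1 \<le> c"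
  shows "(\<lambda>x. \<phi> (c * x)) \<in> test_fun l"
proof -
  obtain a b where ab: "0 < a" "b < l" "\<And>x. x \<notin> {a..b} \<Longrightarrow> \<phi> x = 0"
    using assms by (auto simp: test_fun_iff)

  show ?thesis
  \<comment> \<open>The definition admits \<open>a > b\<close> for the zero function; then
    \<open>b\<close> may be negative and \<open>b / c <= b\<close> may fail.\<close>
  proof (cases "a \<le> b")
    case True
    have "b * 1 \<le> b * c"
      using True ab assms(2) by (intro mult_left_mono) auto
    then have "b / c \<le> b"
      using assms(2) by (simp add: divide_simps)
    then have "b / c < l" "0 < a / c"
      using ab assms(2) by auto
    moreover have "\<phi> (c * x) = 0" if "x \<notin> {a / c..b / c}" for x
      using ab(3)[of "c * x"] that assms(2) by (auto simp: field_simps)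
    ultimately show ?thesis
      using smooth_affine[of \<phi> c 0] test_fun_smooth[OF assms(1)] unfolding test_fun_iff by auto
  next
    case False
    then have "\<phi> = (\<lambda>x. 0)" using ab by auto
    then show ?thesis using assms by simp
  qed
qed

lemma test_fun_reflect:
  assumes "\<phi> \<in> test_fun l"
  shows "(\<lambda>x. \<phi> (l - x)) \<in> test_fun l"
proof -
  obtain a b where ab: "0 < a" "b < l" "\<And>x. x \<notin> {a..b} \<Longrightarrow> \<phi> x = 0"
    using assms by (auto simp: test_fun_iff)
  then have "0 < l - b \<and> l - a < l \<and> (\<forall>x. x \<notin> {l - b..l - a} \<longrightarrow> \<phi> (l - x) = 0)" by auto
  moreover have "smooth (\<lambda>x. \<phi> (l - x))"
    using smooth_affine[OF test_fun_smooth[OF assms], of "-1" l] by simp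
  ultimately show ?thesis unfolding test_fun_iff by blast
qed

lemma test_fun_bounded:
  assumes "\<phi> \<in> test_fun l"
  obtains C where "\<And>x. \<bar>\<phi> x\<bar> \<le> C" "0 < C"
proof -
  have "compact (\<phi> ` {0..l})"
    by (intro compact_continuous_image smooth_continuous_on test_fun_smooth[OF assms]) auto
  then obtain C where C: "0 < C" "\<forall>y\<in>\<phi> ` {0..l}. norm y \<le> C"
    using compact_imp_bounded bounded_pos by metis
  have "\<bar>\<phi> x\<bar> \<le> C" for x
  proof (cases "x \<in> {0..l}")
    case False
    then show ?thesis using C test_fun_outside[OF assms, of x] by auto
  qed (use C in force)
  with C that show ?thesis by blast
qed

text \<open>The primitive from 0 vanishes to the left of the support, and to the right of it equals
  the total integral, which is zero. So mean-free test functions are exactly what can be tested in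
  the form of a derivative.\<close>

lemma test_fun_antiderivative:
  assumes "0 < l" and \<psi>: "\<psi> \<in> test_fun l" and 0: "integral {0..l} \<psi> = 0"
  obtains \<phi> where "\<phi> \<in> test_fun l" "\<And>x. (\<phi> has_real_derivative \<psi> x) (at x)"
    "\<And>x. \<phi> x = integral {0..x} \<psi>"
proof -
  obtain a b where ab: "0 < a" "b < l" "\<And>x. x \<notin> {a..b} \<Longrightarrow> \<psi> x = 0"
    using \<psi> by (auto simp: test_fun_iff)
  define \<phi> where "\<phi> x = integral {0..x} \<psi>" for x
  have cont: "continuous_on A \<psi>" for A
    using \<psi> by (simp add: test_fun_smooth smooth_continuous_on)
  have l: "\<phi> x = 0" if "x < a" for x
    unfolding \<phi>_def by (rule integral_unique, rule has_integral_is_0) (use that ab in auto)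
  have r: "\<phi> x = 0" if "b < x" for x
  proof (cases "x < a")
    case False
    \<comment> \<open>As \<open>x\<close> may lie beyond \<open>l\<close>, both integrals are cut at
      \<open>min x l\<close>; this point is still to the right of \<open>b\<close>, so the remaining
      pieces vanish.\<close>
    have "integral {0..l} \<psi> = integral {0..min x l} \<psi> + integral {min x l..l} \<psi>"
      using False ab that \<open>0 < l\<close> by (intro Henstock_Kurzweil_Integration.integral_combine[symmetric] integrable_continuous_interval cont) auto
    moreover have "integral {min x l..l} \<psi> = 0"
      by (rule integral_unique, rule has_integral_is_0)
        (use that ab in \<open>auto simp: min_le_iff_disj intro!: ab(3)\<close>)
    moreover have "integral {0..x} \<psi> = integral {0..min x l} \<psi> + integral {min x l..x} \<psi>"
      using False ab that \<open>0 < l\<close> by (intro Henstock_Kurzweil_Integration.integral_combine[symmetric] integrable_continuous_interval cont) auto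
    moreover have "integral {min x l..x} \<psi> = 0"
      by (rule integral_unique, rule has_integral_is_0)
        (use that ab in \<open>auto simp: min_le_iff_disj intro!: ab(3)\<close>)
    ultimately show ?thesis using 0 by (simp add: \<phi>_def)
  qed (use l in auto)
  have D: "(\<phi> has_real_derivative \<psi> x) (at x)" for x
  proof (cases "x < a")
    case True
    have "((\<lambda>_. 0) has_real_derivative 0) (at x)" by simp
    then have "(\<phi> has_real_derivative 0) (at x)"
      by (rule has_field_derivative_transform_within_open[of _ _ _ "{..<a}"])
        (use True l in auto)
    with True ab(3) show ?thesis by simp
  next
    case False
    then have "x \<in> {0<..<x+1}" using ab by auto
    moreover have "(\<phi> has_real_derivative \<psi> x) (at x within {0..x+1})"
      unfolding \<phi>_def using False ab by (intro integral_has_real_derivative cont) auto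
    ultimately show ?thesis
      by (simp add: at_within_Icc_at)
  qed
  have "smooth \<phi>"
    using D \<psi> smoothI_antiderivative test_fun_smooth by blast
  moreover have "\<phi> x = 0" if "x \<notin> {a..b}" for x
    using that l[of x] r[of x] by (cases "x < a") auto
  ultimately have "\<phi> \<in> test_fun l" unfolding test_fun_iff using ab by blast
  with D show ?thesis using that \<phi>_def by blast
qed

section \<open>Square integrable functions on an interval\<close>

lemma L2_interval_measurable [measurable_dest]:
  "f \<in> L2_interval l \<Longrightarrow> f \<in> borel_measurable (lebesgue_on {0..l})"
  by (simp add: L2_interval_def)

lemma L2_interval_integrable_square:
  "f \<in> L2_interval l \<Longrightarrow> integrable (lebesgue_on {0..l}) (\<lambda>x. (f x)\<^sup>2)"
  by (simp add: L2_interval_def)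

lemma L2_interval_integrable_mult:
  assumes f: "f \<in> L2_interval l" and g: "g \<in> L2_interval l"
  shows "integrable (lebesgue_on {0..l}) (\<lambda>x. f x * g x)"
proof (rule Bochner_Integration.integrable_bound)
  show "integrable (lebesgue_on {0..l}) (\<lambda>x. (f x)\<^sup>2 + (g x)\<^sup>2)"
    using f g by (intro Bochner_Integration.integrable_add L2_interval_integrable_square)
  show "(\<lambda>x. f x * g x) \<in> borel_measurable (lebesgue_on {0..l})"
    by (rule borel_measurable_times[OF L2_interval_measurable[OF f] L2_interval_measurable[OF g]])
  have "\<bar>a * b\<bar> \<le> a\<^sup>2 + b\<^sup>2" for a b :: real
  proof -
    have "2 * (\<bar>a\<bar> * \<bar>b\<bar>) \<le> a\<^sup>2 + b\<^sup>2"
      using sum_squares_bound[of "\<bar>a\<bar>" "\<bar>b\<bar>"] by (simp add: mult.assoc)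
    moreover have "0 \<le> \<bar>a\<bar> * \<bar>b\<bar>" by simp
    ultimately show ?thesis unfolding abs_mult by linarith
  qed
  then show "AE x in lebesgue_on {0..l}. norm (f x * g x) \<le> norm ((f x)\<^sup>2 + (g x)\<^sup>2)"
    by (intro AE_I2) simp
qed

lemma L2_interval_add:
  assumes f: "f \<in> L2_interval l" and g: "g \<in> L2_interval l"
  shows "(\<lambda>x. f x + g x) \<in> L2_interval l"
proof -
  have "integrable (lebesgue_on {0..l}) (\<lambda>x. (f x)\<^sup>2 + 2 * (f x * g x) + (g x)\<^sup>2)"
    using f g by (intro Bochner_Integration.integrable_add integrable_mult_right
        L2_interval_integrable_square L2_interval_integrable_mult)
  then show ?thesis
    using f g unfolding L2_interval_def
    by (auto simp: power2_sum mult.assoc add_ac)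
qed

lemma L2_interval_cmult: "f \<in> L2_interval l \<Longrightarrow> (\<lambda>x. c * f x) \<in> L2_interval l"
  by (auto simp: L2_interval_def power_mult_distrib)

lemma L2_interval_diff:
  assumes "f \<in> L2_interval l" "g \<in> L2_interval l"
  shows "(\<lambda>x. f x - g x) \<in> L2_interval l"
  using L2_interval_add[OF assms(1) L2_interval_cmult[OF assms(2), of "-1"]] by simp

lemma L2_interval_bounded:
  assumes "f \<in> borel_measurable (lebesgue_on {0..l})" "\<And>x. x \<in> {0..l} \<Longrightarrow> \<bar>f x\<bar> \<le> C"
  shows "f \<in> L2_interval l"
proof -
  have "integrable (lebesgue_on {0..l}) (\<lambda>x. (f x)\<^sup>2)"
  proof (rule Bochner_Integration.integrable_bound)
    show "AE x in lebesgue_on {0..l}. norm ((f x)\<^sup>2) \<le> norm (C\<^sup>2)"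
      using assms(2) by (intro AE_I2) (force simp: abs_le_square_iff[symmetric])
  qed (use assms in auto)
  with assms show ?thesis by (simp add: L2_interval_def)
qed

lemma L2_interval_continuous:
  assumes "continuous_on {0..l} f"
  shows "f \<in> L2_interval l"
  unfolding L2_interval_def
  using assms by (auto intro!: continuous_imp_integrable_real continuous_intros
      continuous_imp_measurable_on_sets_lebesgue)

lemma L2_norm_nonneg: "0 \<le> L2_norm_interval l f"
  by (simp add: L2_norm_interval_def)

lemma L2_norm_square: "(L2_norm_interval l f)\<^sup>2 = integral\<^sup>L (lebesgue_on {0..l}) (\<lambda>x. (f x)\<^sup>2)"
  by (simp add: L2_norm_interval_def)

lemma L2_norm_cmult: "L2_norm_interval l (\<lambda>x. c * f x) = \<bar>c\<bar> * L2_norm_interval l f"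
  by (simp add: L2_norm_interval_def power_mult_distrib real_sqrt_mult)

lemma L2_norm_cong_AE:
  assumes "f \<in> L2_interval l" "g \<in> L2_interval l" "AE x in lebesgue_on {0..l}. f x = g x"
  shows "L2_norm_interval l f = L2_norm_interval l g"
  using assms unfolding L2_norm_interval_def
  by (intro arg_cong[where f=sqrt] integral_cong_AE) (auto simp: L2_interval_def)

lemma L2_norm_eq_0_imp_AE:
  assumes "f \<in> L2_interval l" "L2_norm_interval l f = 0"
  shows "AE x in lebesgue_on {0..l}. f x = 0"
proof -
  have "integral\<^sup>L (lebesgue_on {0..l}) (\<lambda>x. (f x)\<^sup>2) = 0"
    using assms(2) L2_norm_square[of l f] by simp
  then show ?thesis
    using integral_nonneg_eq_0_iff_AE[OF L2_interval_integrable_square[OF assms(1)]] by simp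
qed

text \<open>The discriminant of a nonnegative quadratic in \<open>t\<close>. As only a seminorm is
  available, the case of a null function \<open>g\<close> has to be treated apart.\<close>

lemma L2_Cauchy_Schwarz:
  assumes f: "f \<in> L2_interval l" and g: "g \<in> L2_interval l"
  shows "\<bar>integral\<^sup>L (lebesgue_on {0..l}) (\<lambda>x. f x * g x)\<bar> \<le> L2_norm_interval l f * L2_norm_interval l g"
proof -
  let ?a = "(L2_norm_interval l f)\<^sup>2" and ?c = "(L2_norm_interval l g)\<^sup>2"
  let ?b = "integral\<^sup>L (lebesgue_on {0..l}) (\<lambda>x. f x * g x)"
  have quad: "0 \<le> ?a + 2 * t * ?b + t\<^sup>2 * ?c" for t
  proof -
    have "0 \<le> integral\<^sup>L (lebesgue_on {0..l}) (\<lambda>x. (f x + t * g x)\<^sup>2)" by simp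
    also have "\<dots> = integral\<^sup>L (lebesgue_on {0..l}) (\<lambda>x. (f x)\<^sup>2 + 2 * t * (f x * g x) + t\<^sup>2 * (g x)\<^sup>2)"
      by (intro Bochner_Integration.integral_cong) (auto simp: power2_sum power_mult_distrib)
    also have "\<dots> = ?a + 2 * t * ?b + t\<^sup>2 * ?c"
      using f g by (simp add: L2_norm_square L2_interval_integrable_square L2_interval_integrable_mult)
    finally show ?thesis .
  qed
  have "?b\<^sup>2 \<le> ?a * ?c"
  proof (cases "?c = 0")
    case True
    have "?b = 0"
    proof (rule ccontr)
      assume "?b \<noteq> 0"
      \<comment> \<open>With vanishing quadratic term, this parameter gives the quadratic the value
        -1.\<close>
      then have "2 * (- (?a + 1) / (2 * ?b)) * ?b = - (?a + 1)" by (simp add: field_simps)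
      with quad[of "- (?a + 1) / (2 * ?b)"] have "0 \<le> ?a + - (?a + 1) + (- (?a + 1) / (2 * ?b))\<^sup>2 * ?c"
        by (simp only:)
      then show False unfolding True by simp
    qed
    then show ?thesis by simp
  next
    case False
    then have "0 < ?c" by (metis zero_le_power2 less_eq_real_def)
    \<comment> \<open>The parameter \<open>- ?b / ?c\<close> is the minimiser of the
      quadratic.\<close>
    have "?a + 2 * (- ?b / ?c) * ?b + (- ?b / ?c)\<^sup>2 * ?c = ?a - ?b\<^sup>2 / ?c"
      using \<open>0 < ?c\<close> by (simp only: power_divide power2_minus power2_eq_square[of ?c]) (simp add: power2_eq_square)
    with quad[of "- ?b / ?c"] have "?b\<^sup>2 / ?c \<le> ?a" by linarith
    then show ?thesis using \<open>0 < ?c\<close> by (simp only: pos_divide_le_eq)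
  qed
  then have "\<bar>?b\<bar> \<le> sqrt (?a * ?c)"
    by (simp add: real_le_rsqrt)
  then show ?thesis
    by (simp add: real_sqrt_mult L2_norm_nonneg)
qed

lemma L2_norm_triangle:
  assumes f: "f \<in> L2_interval l" and g: "g \<in> L2_interval l"
  shows "L2_norm_interval l (\<lambda>x. f x + g x) \<le> L2_norm_interval l f + L2_norm_interval l g"
proof (rule power2_le_imp_le)
  have "(L2_norm_interval l (\<lambda>x. f x + g x))\<^sup>2 =
     integral\<^sup>L (lebesgue_on {0..l}) (\<lambda>x. (f x)\<^sup>2 + 2 * (f x * g x) + (g x)\<^sup>2)"
    unfolding L2_norm_square
    by (intro Bochner_Integration.integral_cong) (auto simp: power2_sum)
  also have "\<dots> = (L2_norm_interval l f)\<^sup>2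
      + 2 * integral\<^sup>L (lebesgue_on {0..l}) (\<lambda>x. f x * g x) + (L2_norm_interval l g)\<^sup>2"
    using f g by (simp add: L2_norm_square L2_interval_integrable_square L2_interval_integrable_mult)
  also have "\<dots> \<le> (L2_norm_interval l f + L2_norm_interval l g)\<^sup>2"
    using L2_Cauchy_Schwarz[OF f g] by (simp add: power2_sum)
  finally show "(L2_norm_interval l (\<lambda>x. f x + g x))\<^sup>2 \<le> (L2_norm_interval l f + L2_norm_interval l g)\<^sup>2" .
qed (simp add: L2_norm_nonneg)

lemma L2_norm_triangle_diff:
  assumes f: "f \<in> L2_interval l" and g: "g \<in> L2_interval l" and h: "h \<in> L2_interval l"
  shows "L2_norm_interval l (\<lambda>x. f x - h x) \<le>
    L2_norm_interval l (\<lambda>x. f x - g x) + L2_norm_interval l (\<lambda>x. g x - h x)"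
  using L2_norm_triangle[OF L2_interval_diff[OF f g] L2_interval_diff[OF g h]] by simp

lemma L2_norm_bounded:
  assumes "f \<in> borel_measurable (lebesgue_on {0..l})" "\<And>x. x \<in> {0..l} \<Longrightarrow> \<bar>f x\<bar> \<le> C" "0 \<le> C" "0 \<le> l"
  shows "L2_norm_interval l f \<le> C * sqrt l"
proof -
  have "integral\<^sup>L (lebesgue_on {0..l}) (\<lambda>x. (f x)\<^sup>2) \<le> integral\<^sup>L (lebesgue_on {0..l}) (\<lambda>x. C\<^sup>2)"
    using assms L2_interval_integrable_square[OF L2_interval_bounded[OF assms(1,2)]]
    by (intro integral_mono) (auto simp: abs_le_square_iff[symmetric])
  also have "\<dots> = l * C\<^sup>2"
    using assms by (simp add: measure_restrict_space)
  finally show ?thesis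
    unfolding L2_norm_interval_def using assms
    by (intro real_le_lsqrt) (auto simp: power_mult_distrib mult.commute)
qed

section \<open>Density of polynomials and of test functions in L2\<close>

lemma L2_norm_diff_tendsto_0:
  assumes "f \<in> L2_interval l" "\<And>n. s n \<in> L2_interval l"
    and lim: "AE x in lebesgue_on {0..l}. (\<lambda>n. s n x) \<longlonglongrightarrow> f x"
    and dom: "w \<in> L2_interval l" "\<And>n x. x \<in> {0..l} \<Longrightarrow> \<bar>f x - s n x\<bar> \<le> \<bar>w x\<bar>"
  shows "(\<lambda>n. L2_norm_interval l (\<lambda>x. f x - s n x)) \<longlonglongrightarrow> 0"
proof -
  have "(\<lambda>n. integral\<^sup>L (lebesgue_on {0..l}) (\<lambda>x. (f x - s n x)\<^sup>2))
      \<longlonglongrightarrow> integral\<^sup>L (lebesgue_on {0..l}) (\<lambda>x. 0)"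
  proof (rule integral_dominated_convergence)
    show "integrable (lebesgue_on {0..l}) (\<lambda>x. (w x)\<^sup>2)"
      using dom by (intro L2_interval_integrable_square)
    show "AE x in lebesgue_on {0..l}. (\<lambda>n. (f x - s n x)\<^sup>2) \<longlonglongrightarrow> 0"
      using lim
    proof eventually_elim
      case (elim x)
      then have "(\<lambda>n. (f x - s n x)\<^sup>2) \<longlonglongrightarrow> (f x - f x)\<^sup>2" by (intro tendsto_intros)
      then show ?case by simp
    qed
    show "AE x in lebesgue_on {0..l}. norm ((f x - s n x)\<^sup>2) \<le> (w x)\<^sup>2" for n
      using dom(2) by (intro AE_I2) (auto simp: abs_le_square_iff)
  qed (use assms(1,2) in \<open>auto intro!: borel_measurable_power borel_measurable_diff simp: L2_interval_def\<close>)
  then have "(\<lambda>n. sqrt (integral\<^sup>L (lebesgue_on {0..l}) (\<lambda>x. (f x - s n x)\<^sup>2))) \<longlonglongrightarrow> sqrt 0"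
    by (intro tendsto_real_sqrt) simp
  then show ?thesis by (simp add: L2_norm_interval_def)
qed

lemma AE_interior: "AE x in lebesgue_on {0..l}. 0 < x \<and> x < (l::real)"
proof -
  have "AE x in lebesgue. x \<noteq> 0 \<and> x \<noteq> l"
    by (intro AE_completion AE_conjI AE_lborel_singleton)
  then have "AE x in lebesgue. x \<in> {0..l} \<longrightarrow> 0 < x \<and> x < l"
    by (rule eventually_mono) auto
  then show ?thesis
    by (simp add: AE_restrict_space_iff) (auto elim!: eventually_mono)
qed

text \<open>Three errors of size \<epsilon>/3: truncation of the values, replacement by a continuous
  function, and Stone-Weierstrass. Truncation comes first because it supplies the dominating
  function for the second step, where only pointwise convergence almost everywhere is known.\<close>

theorem L2_polynomial_dense:
  assumes f: "f \<in> L2_interval l" and "0 < \<epsilon>" "0 \<le> l"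
  obtains p where "L2_norm_interval l (\<lambda>x. f x - poly p x) < \<epsilon>"
proof -
  define clamp where "clamp n x = max (- real n) (min (real n) x)" for n and x :: real
  have clamp_le: "\<bar>clamp n x\<bar> \<le> real n" for n x by (auto simp: clamp_def)
  have cc: "continuous_on A (clamp n)" for n A
    unfolding clamp_def[abs_def] by (intro continuous_intros)
  have clamp_meas: "(\<lambda>x. clamp n (h x)) \<in> borel_measurable (lebesgue_on {0..l})"
    if "h \<in> borel_measurable (lebesgue_on {0..l})" for n h
    using borel_measurable_continuous_on[OF cc that] .
  have clamp_L2: "(\<lambda>x. clamp n (h x)) \<in> L2_interval l"
    if "h \<in> borel_measurable (lebesgue_on {0..l})" for n h
    using clamp_meas[OF that] by (rule L2_interval_bounded) (rule clamp_le)
  have fm: "f \<in> borel_measurable (lebesgue_on {0..l})" using f by (rule L2_interval_measurable)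

  have "(\<lambda>n. L2_norm_interval l (\<lambda>x. f x - clamp n (f x))) \<longlonglongrightarrow> 0"
  proof (rule L2_norm_diff_tendsto_0[OF f clamp_L2[OF fm] _ f])
    have "(\<lambda>n. clamp n y) \<longlonglongrightarrow> y" for y
    proof (rule tendsto_eventually)
      obtain N where N: "\<bar>y\<bar> \<le> real N" using real_arch_simple by blast
      show "\<forall>\<^sub>F n in sequentially. clamp n y = y"
        using eventually_ge_at_top[of N]
        by eventually_elim (use N in \<open>auto simp: clamp_def\<close>)
    qed
    then show "AE x in lebesgue_on {0..l}. (\<lambda>n. clamp n (f x)) \<longlonglongrightarrow> f x" by simp
    show "\<bar>f x - clamp n (f x)\<bar> \<le> \<bar>f x\<bar>" if "x \<in> {0..l}" for n x by (auto simp: clamp_def)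
  qed
  then obtain n where n: "L2_norm_interval l (\<lambda>x. f x - clamp n (f x)) < \<epsilon> / 3"
    using order_tendstoD(2)[of _ 0 sequentially "\<epsilon> / 3"] \<open>0 < \<epsilon>\<close>
    by (auto simp: eventually_sequentially)

  \<comment> \<open>Measurability in the form of \<open>measurable_on\<close>: a limit of continuous
    functions off a negligible set. Nothing bounds the \<open>g k\<close>, so they are clamped as
    well.\<close>
  obtain N g where N: "negligible N" and g: "\<And>k. continuous_on UNIV (g k)"
    and lim: "\<And>x. x \<notin> N \<Longrightarrow> (\<lambda>k. g k x) \<longlonglongrightarrow> (if x \<in> {0..l} then f x else 0)"
    using fm unfolding measurable_on_iff_borel_measurable[symmetric, of "{0..l}" f, simplified]
      measurable_on_def by blast
  have gm: "g k \<in> borel_measurable (lebesgue_on {0..l})" for k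
    by (rule continuous_imp_measurable_on_sets_lebesgue)
      (auto intro: continuous_on_subset[OF g])
  have "(\<lambda>k. L2_norm_interval l (\<lambda>x. clamp n (f x) - clamp n (g k x))) \<longlonglongrightarrow> 0"
  proof (rule L2_norm_diff_tendsto_0[OF clamp_L2[OF fm] clamp_L2[OF gm],
        where w = "\<lambda>_. 2 * real n"])
    have "AE x in lebesgue. x \<notin> N"
      using N by (simp add: negligible_iff_null_sets AE_not_in)
    moreover have "(\<lambda>k. clamp n (g k x)) \<longlonglongrightarrow> clamp n (f x)" if "x \<notin> N" "x \<in> {0..l}" for x
      using lim[OF that(1)] that(2) by (intro continuous_on_tendsto_compose[OF cc[of UNIV]]) auto
    ultimately have "AE x in lebesgue. x \<in> {0..l} \<longrightarrow> (\<lambda>k. clamp n (g k x)) \<longlonglongrightarrow> clamp n (f x)"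
      by (auto elim!: eventually_mono)
    then show "AE x in lebesgue_on {0..l}. (\<lambda>k. clamp n (g k x)) \<longlonglongrightarrow> clamp n (f x)"
      by (simp add: AE_restrict_space_iff)
    show "\<bar>clamp n (f x) - clamp n (g k x)\<bar> \<le> \<bar>2 * real n\<bar>" if "x \<in> {0..l}" for k x
      using clamp_le[of n "f x"] clamp_le[of n "g k x"] by linarith
    show "(\<lambda>_. 2 * real n) \<in> L2_interval l" by (intro L2_interval_continuous continuous_intros)
  qed
  then obtain k where k: "L2_norm_interval l (\<lambda>x. clamp n (f x) - clamp n (g k x)) < \<epsilon> / 3"
    using order_tendstoD(2)[of _ 0 sequentially "\<epsilon> / 3"] \<open>0 < \<epsilon>\<close>
    by (auto simp: eventually_sequentially)

  \<comment> \<open>Passing from the uniform to the L2 norm costs \<open>sqrt l\<close>; the added 1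
    keeps the denominator positive for \<open>l = 0\<close>.\<close>
  define \<delta> where "\<delta> = \<epsilon> / (3 * (sqrt l + 1))"
  have "0 < \<delta>" unfolding \<delta>_def using \<open>0 < \<epsilon>\<close> \<open>0 \<le> l\<close> by (intro divide_pos_pos) (auto intro: add_nonneg_pos)
  have cg: "continuous_on {0..l} (\<lambda>x. clamp n (g k x))"
    by (rule continuous_on_compose2[OF cc[of UNIV] continuous_on_subset[OF g]]) auto
  then obtain q where q: "real_polynomial_function q"
    and close: "\<And>x. x \<in> {0..l} \<Longrightarrow> \<bar>clamp n (g k x) - q x\<bar> < \<delta>"
    using Stone_Weierstrass_real_polynomial_function[OF _ cg \<open>0 < \<delta>\<close>] by (metis compact_Icc)
  obtain a m where a: "q = (\<lambda>x. \<Sum>i\<le>m. a i * x ^ i)"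
    using q unfolding real_polynomial_function_iff_sum by blast
  define p where "p = (\<Sum>i\<le>m. monom (a i) i)"
  have p: "poly p = q" by (simp add: p_def a fun_eq_iff poly_sum poly_monom)
  have L2p: "poly p \<in> L2_interval l" by (intro L2_interval_continuous continuous_intros)
  have "L2_norm_interval l (\<lambda>x. clamp n (g k x) - poly p x) \<le> \<delta> * sqrt l"
    using close \<open>0 < \<delta>\<close> \<open>0 \<le> l\<close> unfolding p[symmetric]
    by (intro L2_norm_bounded continuous_imp_measurable_on_sets_lebesgue continuous_intros cg)
      (auto intro: less_imp_le)
  also have "\<dots> < \<delta> * (sqrt l + 1)" using \<open>0 < \<delta>\<close> by simp
  also have "\<dots> = \<epsilon> / 3"
    unfolding \<delta>_def using \<open>0 \<le> l\<close> by (simp add: divide_simps) (smt (verit) real_sqrt_ge_0_iff)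
  finally have "L2_norm_interval l (\<lambda>x. clamp n (g k x) - poly p x) < \<epsilon> / 3" .
  with n k L2_norm_triangle_diff[OF f clamp_L2[OF fm] L2p, of n]
    L2_norm_triangle_diff[OF clamp_L2[OF fm] clamp_L2[OF gm] L2p, of n n k]
  have "L2_norm_interval l (\<lambda>x. f x - poly p x) < \<epsilon>" by simp
  then show ?thesis by (rule that)
qed

lemma test_fun_L2: "\<phi> \<in> test_fun l \<Longrightarrow> \<phi> \<in> L2_interval l"
  by (intro L2_interval_continuous smooth_continuous_on test_fun_smooth)

text \<open>It vanishes within distance 1/n of either end. It stays below 1 everywhere, but tends to
  1 at each interior point, which is enough for dominated convergence.\<close>

definition cutoff :: "real \<Rightarrow> nat \<Rightarrow> real \<Rightarrow> real" where
  "cutoff l n x = flat_exp 1 (real n * x - 1) * flat_exp 1 (real n * (l - x) - 1)"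

lemma flat_exp_1_bounds: "0 \<le> flat_exp 1 x \<and> flat_exp 1 x \<le> 1"
  by (simp add: flat_exp_def)

lemma cutoff_bounds: "0 \<le> cutoff l n x \<and> cutoff l n x \<le> 1"
  using flat_exp_1_bounds by (simp add: cutoff_def mult_le_one)

lemma cutoff_test_fun:
  assumes "0 < n"
  shows "cutoff l n \<in> test_fun l"
proof -
  have "smooth (\<lambda>x. flat_exp 1 (real n * x + (-1)) * flat_exp 1 (- real n * x + (real n * l - 1)))"
    by (intro smooth_mult smooth_affine smooth_flat_exp)
  also have "(\<lambda>x. flat_exp 1 (real n * x + (-1)) * flat_exp 1 (- real n * x + (real n * l - 1))) = cutoff l n"
    by (simp add: cutoff_def fun_eq_iff algebra_simps)
  finally have "smooth (cutoff l n)" .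
  moreover have "0 < 1 / real n" "l - 1 / real n < l" using assms by simp_all
  moreover have "cutoff l n x = 0" if "x \<notin> {1 / real n..l - 1 / real n}" for x
    using that assms by (auto simp: cutoff_def flat_exp_def field_simps not_le)
  ultimately show ?thesis unfolding test_fun_iff by blast
qed

lemma cutoff_tendsto_1:
  assumes "0 < x" "x < l"
  shows "(\<lambda>n. cutoff l n x) \<longlonglongrightarrow> 1"
proof -
  have "(\<lambda>n. flat_exp 1 (real n * y - 1)) \<longlonglongrightarrow> 1" if "0 < y" for y
  proof -
    have "filterlim (\<lambda>n. (-1) + real n * y) at_top sequentially"
      using that by (intro filterlim_tendsto_add_at_top[OF tendsto_const]
          filterlim_at_top_mult_tendsto_pos[OF tendsto_const] filterlim_real_sequentially)
    then have top: "filterlim (\<lambda>n. real n * y - 1) at_top sequentially" by simp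
    have "(\<lambda>n. exp (- (1 / (real n * y - 1)))) \<longlonglongrightarrow> exp (- 0)"
      by (intro tendsto_intros tendsto_divide_0[OF tendsto_const]
        filterlim_at_top_imp_at_infinity[OF top])
    then have "(\<lambda>n. exp (- (1 / (real n * y - 1)))) \<longlonglongrightarrow> 1" by simp
    then show ?thesis
      by (rule Lim_transform_eventually)
        (use filterlim_at_top_dense[THEN iffD1, OF top, rule_format, of 0] in
          \<open>auto simp: flat_exp_def elim!: eventually_mono\<close>)
  qed
  from tendsto_mult[OF this[of x] this[of "l - x"]] assms show ?thesis
    unfolding cutoff_def by simp
qed

text \<open>A polynomial times \<open>cutoff\<close> is a test function, and it converges to the
  polynomial almost everywhere while the error stays below the polynomial in absolute value.\<close>

theorem L2_test_fun_dense:
  assumes f: "f \<in> L2_interval l" and "0 < \<epsilon>" "0 \<le> l"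
  obtains \<psi> where "\<psi> \<in> test_fun l" "L2_norm_interval l (\<lambda>x. f x - \<psi> x) < \<epsilon>"
proof -
  obtain p where p: "L2_norm_interval l (\<lambda>x. f x - poly p x) < \<epsilon> / 2"
    using L2_polynomial_dense[OF f, of "\<epsilon> / 2"] assms by auto
  have L2p: "poly p \<in> L2_interval l" by (intro L2_interval_continuous continuous_intros)
  have test: "(\<lambda>x. poly p x * cutoff l (Suc n) x) \<in> test_fun l" for n
    by (intro test_fun_smooth_mult cutoff_test_fun smooth_poly) simp
  have "(\<lambda>n. L2_norm_interval l (\<lambda>x. poly p x - poly p x * cutoff l (Suc n) x)) \<longlonglongrightarrow> 0"
  proof (rule L2_norm_diff_tendsto_0[OF L2p test_fun_L2[OF test] _ L2p])
    show "AE x in lebesgue_on {0..l}. (\<lambda>n. poly p x * cutoff l (Suc n) x) \<longlonglongrightarrow> poly p x"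
      using AE_interior
    proof eventually_elim
      case (elim x)
      then have "(\<lambda>n. poly p x * cutoff l (Suc n) x) \<longlonglongrightarrow> poly p x * 1"
        by (intro tendsto_mult[OF tendsto_const] LIMSEQ_Suc[OF cutoff_tendsto_1]) auto
      then show ?case by simp
    qed
    show "\<bar>poly p x - poly p x * cutoff l (Suc n) x\<bar> \<le> \<bar>poly p x\<bar>" if "x \<in> {0..l}" for n x
    proof -
      have "\<bar>poly p x - poly p x * cutoff l (Suc n) x\<bar> = \<bar>poly p x\<bar> * (1 - cutoff l (Suc n) x)"
      proof -
        have "poly p x - poly p x * cutoff l (Suc n) x = poly p x * (1 - cutoff l (Suc n) x)"
          by (simp add: right_diff_distrib)
        then show ?thesis using cutoff_bounds[of l "Suc n" x] by (simp add: abs_mult)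
      qed
      also have "\<dots> \<le> \<bar>poly p x\<bar> * 1"
        using cutoff_bounds[of l "Suc n" x] by (intro mult_left_mono) auto
      finally show ?thesis by simp
    qed
  qed
  then obtain n where "L2_norm_interval l (\<lambda>x. poly p x - poly p x * cutoff l (Suc n) x) < \<epsilon> / 2"
    using order_tendstoD(2)[of _ 0 sequentially "\<epsilon> / 2"] \<open>0 < \<epsilon>\<close>
    by (auto simp: eventually_sequentially)
  with p L2_norm_triangle_diff[OF f L2p test_fun_L2[OF test], of n]
  have "L2_norm_interval l (\<lambda>x. f x - poly p x * cutoff l (Suc n) x) < \<epsilon>" by simp
  with test show ?thesis by (rule that)
qed

section \<open>Weak derivatives\<close>

abbreviation inner_L2 :: "real \<Rightarrow> (real \<Rightarrow> real) \<Rightarrow> (real \<Rightarrow> real) \<Rightarrow> real" where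
  "inner_L2 l f g \<equiv> integral\<^sup>L (lebesgue_on {0..l}) (\<lambda>x. f x * g x)"

lemma inner_L2_add_left:
  assumes "f \<in> L2_interval l" "g \<in> L2_interval l" "h \<in> L2_interval l"
  shows "inner_L2 l (\<lambda>x. f x + g x) h = inner_L2 l f h + inner_L2 l g h"
  using assms by (simp add: distrib_right L2_interval_integrable_mult)

lemma inner_L2_diff_left:
  assumes "f \<in> L2_interval l" "g \<in> L2_interval l" "h \<in> L2_interval l"
  shows "inner_L2 l (\<lambda>x. f x - g x) h = inner_L2 l f h - inner_L2 l g h"
  using assms by (simp add: left_diff_distrib L2_interval_integrable_mult)

lemma inner_L2_diff_right:
  assumes "f \<in> L2_interval l" "g \<in> L2_interval l" "h \<in> L2_interval l"
  shows "inner_L2 l h (\<lambda>x. f x - g x) = inner_L2 l h f - inner_L2 l h g"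
  using assms by (simp add: right_diff_distrib L2_interval_integrable_mult)

lemma inner_L2_cmult_left: "inner_L2 l (\<lambda>x. c * f x) h = c * inner_L2 l f h"
  by (simp add: mult.assoc)

lemma inner_L2_cmult_right: "inner_L2 l h (\<lambda>x. c * f x) = c * inner_L2 l h f"
  by (simp add: mult.left_commute)

lemma inner_L2_self: "inner_L2 l f f = (L2_norm_interval l f)\<^sup>2"
  unfolding L2_norm_square by (simp add: power2_eq_square)

lemma L2_interval_const: "(\<lambda>x. c) \<in> L2_interval l"
  by (intro L2_interval_continuous continuous_intros)

lemma L2_interval_poly: "poly p \<in> L2_interval l"
  by (intro L2_interval_continuous continuous_intros)

text \<open>The norm is attained by duality at \<open>w\<close> itself, and a test function near
  \<open>w\<close> is almost as good. With \<open>B = 0\<close> this is the fundamental lemma of the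
  calculus of variations.\<close>

lemma L2_norm_le_of_test_fun:
  assumes w: "w \<in> L2_interval l" and "0 \<le> l" "0 \<le> B"
    and bound: "\<And>\<psi>. \<psi> \<in> test_fun l \<Longrightarrow> \<bar>inner_L2 l w \<psi>\<bar> \<le> B * L2_norm_interval l \<psi>"
  shows "L2_norm_interval l w \<le> B"
proof (rule ccontr)
  let ?N = "L2_norm_interval l w"
  assume "\<not> ?N \<le> B"
  then have less: "B < ?N" by simp
  \<comment> \<open>Testing with \<open>\<psi>\<close> will give
    \<open>?N * (?N - B) <= \<epsilon> * (?N + B)\<close>; this choice makes the right side half of
    the left side.\<close>
  define \<epsilon> where "\<epsilon> = ?N * (?N - B) / (2 * (?N + B))"
  have pos: "0 < ?N * (?N - B)" "0 < 2 * (?N + B)" using less \<open>0 \<le> B\<close> by auto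
  have "0 < \<epsilon>" unfolding \<epsilon>_def using pos by (rule divide_pos_pos)
  obtain \<psi> where \<psi>: "\<psi> \<in> test_fun l" "L2_norm_interval l (\<lambda>x. w x - \<psi> x) < \<epsilon>"
    using L2_test_fun_dense[OF w \<open>0 < \<epsilon>\<close> \<open>0 \<le> l\<close>] .
  note L2\<psi> = test_fun_L2[OF \<psi>(1)]
  have "L2_norm_interval l \<psi> \<le> L2_norm_interval l w + L2_norm_interval l (\<lambda>x. (-1) * (w x - \<psi> x))"
    using L2_norm_triangle[OF w L2_interval_cmult[OF L2_interval_diff[OF w L2\<psi>], of "-1"]] by simp
  also have "\<dots> = ?N + L2_norm_interval l (\<lambda>x. w x - \<psi> x)"
    unfolding L2_norm_cmult by simp
  finally have N\<psi>: "L2_norm_interval l \<psi> \<le> ?N + \<epsilon>" using \<psi>(2) by simp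
  have "?N\<^sup>2 = inner_L2 l w (\<lambda>x. w x - \<psi> x) + inner_L2 l w \<psi>"
    by (simp add: inner_L2_diff_right[OF w L2\<psi> w] inner_L2_self)
  also have "\<dots> \<le> ?N * L2_norm_interval l (\<lambda>x. w x - \<psi> x) + B * L2_norm_interval l \<psi>"
    using L2_Cauchy_Schwarz[OF w L2_interval_diff[OF w L2\<psi>]] bound[OF \<psi>(1)] by linarith
  also have "\<dots> \<le> ?N * \<epsilon> + B * (?N + \<epsilon>)"
    using \<psi>(2) N\<psi> \<open>0 \<le> B\<close> by (intro add_mono mult_left_mono) (auto simp: L2_norm_nonneg)
  finally have "?N * (?N - B) \<le> \<epsilon> * (?N + B)"
    by (simp add: power2_eq_square algebra_simps)
  also have "\<dots> = ?N * (?N - B) / 2"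
    unfolding \<epsilon>_def using pos(2) by (simp add: divide_simps)
  finally show False using pos by simp
qed

lemma has_weak_derivD:
  "has_weak_deriv l k f g \<Longrightarrow> \<phi> \<in> test_fun l \<Longrightarrow>
    inner_L2 l f ((deriv ^^ k) \<phi>) = (-1) ^ k * inner_L2 l g \<phi>"
  by (simp add: has_weak_deriv_def)

lemma has_weak_deriv_unique:
  assumes "0 \<le> l" and g: "g \<in> L2_interval l" "has_weak_deriv l k f g"
    and h: "h \<in> L2_interval l" "has_weak_deriv l k f h"
  shows "AE x in lebesgue_on {0..l}. g x = h x"
    and "L2_norm_interval l g = L2_norm_interval l h"
proof -
  have "L2_norm_interval l (\<lambda>x. g x - h x) \<le> 0"
  proof (rule L2_norm_le_of_test_fun[OF L2_interval_diff[OF g(1) h(1)] \<open>0 \<le> l\<close>])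
    fix \<psi> assume \<psi>: "\<psi> \<in> test_fun l"
    have "inner_L2 l g \<psi> = inner_L2 l h \<psi>"
      using has_weak_derivD[OF g(2) \<psi>] has_weak_derivD[OF h(2) \<psi>] by simp
    then show "\<bar>inner_L2 l (\<lambda>x. g x - h x) \<psi>\<bar> \<le> 0 * L2_norm_interval l \<psi>"
      by (simp add: inner_L2_diff_left[OF g(1) h(1) test_fun_L2[OF \<psi>]])
  qed simp
  then have "L2_norm_interval l (\<lambda>x. g x - h x) = 0"
    using L2_norm_nonneg by (meson order_antisym)
  then have "AE x in lebesgue_on {0..l}. g x - h x = 0"
    by (rule L2_norm_eq_0_imp_AE[OF L2_interval_diff[OF g(1) h(1)]])
  then show AE: "AE x in lebesgue_on {0..l}. g x = h x" by simp
  show "L2_norm_interval l g = L2_norm_interval l h"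
    by (rule L2_norm_cong_AE[OF g(1) h(1) AE])
qed

lemma has_weak_deriv_0: "has_weak_deriv l 0 f f"
  by (simp add: has_weak_deriv_def)

lemma has_weak_deriv_add:
  assumes "f \<in> L2_interval l" "f' \<in> L2_interval l" "has_weak_deriv l k f f'"
    and "g \<in> L2_interval l" "g' \<in> L2_interval l" "has_weak_deriv l k g g'"
  shows "has_weak_deriv l k (\<lambda>x. f x + g x) (\<lambda>x. f' x + g' x)"
  unfolding has_weak_deriv_def
proof
  fix \<phi> assume \<phi>: "\<phi> \<in> test_fun l"
  show "inner_L2 l (\<lambda>x. f x + g x) ((deriv ^^ k) \<phi>) = (-1) ^ k * inner_L2 l (\<lambda>x. f' x + g' x) \<phi>"
    unfolding inner_L2_add_left[OF assms(1,4) test_fun_L2[OF test_fun_higher_deriv[OF \<phi>]]]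
      inner_L2_add_left[OF assms(2,5) test_fun_L2[OF \<phi>]]
      has_weak_derivD[OF assms(3) \<phi>] has_weak_derivD[OF assms(6) \<phi>]
    by (simp add: distrib_left)
qed

lemma has_weak_deriv_cmult:
  assumes "has_weak_deriv l k f f'"
  shows "has_weak_deriv l k (\<lambda>x. c * f x) (\<lambda>x. c * f' x)"
  unfolding has_weak_deriv_def
proof
  fix \<phi> assume \<phi>: "\<phi> \<in> test_fun l"
  show "inner_L2 l (\<lambda>x. c * f x) ((deriv ^^ k) \<phi>) = (-1) ^ k * inner_L2 l (\<lambda>x. c * f' x) \<phi>"
    unfolding inner_L2_cmult_left has_weak_derivD[OF assms \<phi>] by simp
qed

lemma has_weak_deriv_diff:
  assumes "f \<in> L2_interval l" "f' \<in> L2_interval l" "has_weak_deriv l k f f'"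
    and "g \<in> L2_interval l" "g' \<in> L2_interval l" "has_weak_deriv l k g g'"
  shows "has_weak_deriv l k (\<lambda>x. f x - g x) (\<lambda>x. f' x - g' x)"
  using has_weak_deriv_add[OF assms(1-3) L2_interval_cmult[OF assms(4)]
      L2_interval_cmult[OF assms(5)] has_weak_deriv_cmult[OF assms(6), of "-1"]] by simp

lemma has_weak_deriv_trans:
  assumes "has_weak_deriv l j f g" "has_weak_deriv l k g h"
  shows "has_weak_deriv l (j + k) f h"
  unfolding has_weak_deriv_def
proof
  fix \<phi> assume \<phi>: "\<phi> \<in> test_fun l"
  show "inner_L2 l f ((deriv ^^ (j + k)) \<phi>) = (-1) ^ (j + k) * inner_L2 l h \<phi>"
    using has_weak_derivD[OF assms(1) test_fun_higher_deriv[OF \<phi>, of k]] has_weak_derivD[OF assms(2) \<phi>]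
    by (simp add: funpow_add power_add)
qed

text \<open>The derivatives of a test function are test functions, so the hypothesis on
  \<open>g\<close> may be applied to them. The lemma is needed since \<open>H_interval\<close> asks
  for each order as a derivative of the function itself, not of the preceding derivative.\<close>

lemma has_weak_deriv_cancel:
  assumes "has_weak_deriv l j f g" "has_weak_deriv l (j + k) f h"
  shows "has_weak_deriv l k g h"
  unfolding has_weak_deriv_def
proof
  fix \<phi> assume \<phi>: "\<phi> \<in> test_fun l"
  have "(-1) ^ j * inner_L2 l g ((deriv ^^ k) \<phi>) = (-1) ^ j * ((-1) ^ k * inner_L2 l h \<phi>)"
    using has_weak_derivD[OF assms(1) test_fun_higher_deriv[OF \<phi>, of k]] has_weak_derivD[OF assms(2) \<phi>]
    by (simp add: funpow_add power_add mult.assoc)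
  then show "inner_L2 l g ((deriv ^^ k) \<phi>) = (-1) ^ k * inner_L2 l h \<phi>"
    by simp
qed

text \<open>Integration by parts, with boundary terms that vanish because test functions do;
  one-sided derivatives at the ends are enough.\<close>

lemma C1_has_weak_deriv:
  assumes "0 < l"
    and D: "\<And>x. x \<in> {0..l} \<Longrightarrow> (f has_real_derivative f' x) (at x within {0..l})"
    and cont: "continuous_on {0..l} f'"
  shows "has_weak_deriv l 1 f f'"
  unfolding has_weak_deriv_def
proof
  fix \<phi> assume \<phi>: "\<phi> \<in> test_fun l"
  have cf: "continuous_on {0..l} f"
    using D by (meson DERIV_continuous_on)
  have c\<phi>: "continuous_on {0..l} \<phi>" "continuous_on {0..l} (deriv \<phi>)"
    using \<phi> by (auto intro: smooth_continuous_on test_fun_smooth test_fun_deriv)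
  have int: "integrable (lebesgue_on {0..l}) (\<lambda>x. f x * deriv \<phi> x)"
    "integrable (lebesgue_on {0..l}) (\<lambda>x. f' x * \<phi> x)"
    by (intro continuous_imp_integrable_real continuous_intros cf c\<phi> cont)+
  have "((\<lambda>x. f x * deriv \<phi> x + f' x * \<phi> x) has_integral f l * \<phi> l - f 0 * \<phi> 0) {0..l}"
  proof (rule fundamental_theorem_of_calculus)
    fix x assume "x \<in> {0..l}"
    then have "((\<lambda>x. f x * \<phi> x) has_real_derivative f x * deriv \<phi> x + f' x * \<phi> x) (at x within {0..l})"
      by (intro DERIV_mult' D DERIV_subset[OF smooth_DERIV[OF test_fun_smooth[OF \<phi>]]]) auto
    then show "((\<lambda>x. f x * \<phi> x) has_vector_derivative f x * deriv \<phi> x + f' x * \<phi> x) (at x within {0..l})"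
      by (simp add: has_real_derivative_iff_has_vector_derivative)
  qed (use \<open>0 < l\<close> in simp)
  then have "integral {0..l} (\<lambda>x. f x * deriv \<phi> x + f' x * \<phi> x) = 0"
    using test_fun_outside[OF \<phi>] by (simp add: integral_unique)
  then have "integral\<^sup>L (lebesgue_on {0..l}) (\<lambda>x. f x * deriv \<phi> x + f' x * \<phi> x) = 0"
    using int by (subst lebesgue_integral_eq_integral) auto
  then show "inner_L2 l f ((deriv ^^ 1) \<phi>) = (-1) ^ 1 * inner_L2 l f' \<phi>"
    using int by simp
qed

lemma poly_has_weak_deriv: "0 < l \<Longrightarrow> has_weak_deriv l 1 (poly p) (poly (pderiv p))"
  by (rule C1_has_weak_deriv) (auto intro!: continuous_intros DERIV_subset[OF poly_DERIV])

section \<open>Sobolev spaces on an interval\<close>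

lemma H_interval_L2: "f \<in> H_interval r l \<Longrightarrow> f \<in> L2_interval l"
  by (simp add: H_interval_def)

lemma H_interval_mono: "r \<le> r' \<Longrightarrow> H_interval r' l \<subseteq> H_interval r l"
  unfolding H_interval_def using order_trans by blast

lemma weak_deriv:
  assumes "f \<in> H_interval r l" "k \<le> r"
  shows "weak_deriv l k f \<in> L2_interval l" "has_weak_deriv l k f (weak_deriv l k f)"
proof -
  have "\<exists>g. g \<in> L2_interval l \<and> has_weak_deriv l k f g"
    using assms unfolding H_interval_def by blast
  from someI_ex[OF this] show "weak_deriv l k f \<in> L2_interval l" "has_weak_deriv l k f (weak_deriv l k f)"
    unfolding weak_deriv_def by blast+
qed

lemma H_intervalI:
  assumes "\<And>k. k \<le> r \<Longrightarrow> g k \<in> L2_interval l" "\<And>k. k \<le> r \<Longrightarrow> has_weak_deriv l k f (g k)"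
    and "f \<in> L2_interval l"
  shows "f \<in> H_interval r l"
  using assms unfolding H_interval_def by blast

text \<open>Uniqueness up to null sets allows norms to be computed from any weak derivative instead
  of the one picked by \<open>SOME\<close>.\<close>

lemma L2_norm_weak_deriv:
  assumes "0 \<le> l" "g \<in> L2_interval l" "has_weak_deriv l k f g"
  shows "L2_norm_interval l (weak_deriv l k f) = L2_norm_interval l g"
proof -
  have "\<exists>g. g \<in> L2_interval l \<and> has_weak_deriv l k f g"
    using assms by blast
  from someI_ex[OF this] have "weak_deriv l k f \<in> L2_interval l" "has_weak_deriv l k f (weak_deriv l k f)"
    unfolding weak_deriv_def by blast+
  from has_weak_deriv_unique(2)[OF assms(1) this assms(2,3)] show ?thesis .
qed

lemma H_norm_eq_L2_set: "H_norm_interval r l f = L2_set (\<lambda>k. L2_norm_interval l (weak_deriv l k f)) {..r}"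
  by (simp add: H_norm_interval_def L2_set_def)

lemma H_norm_nonneg: "0 \<le> H_norm_interval r l f"
  by (simp add: H_norm_eq_L2_set)

lemma H_norm_eq:
  assumes "0 \<le> l" "\<And>k. k \<le> r \<Longrightarrow> g k \<in> L2_interval l" "\<And>k. k \<le> r \<Longrightarrow> has_weak_deriv l k f (g k)"
  shows "H_norm_interval r l f = L2_set (\<lambda>k. L2_norm_interval l (g k)) {..r}"
  unfolding H_norm_eq_L2_set
  by (rule L2_set_cong) (use assms L2_norm_weak_deriv in auto)

lemma H_interval_add:
  assumes "f \<in> H_interval r l" "g \<in> H_interval r l"
  shows "(\<lambda>x. f x + g x) \<in> H_interval r l"
  by (rule H_intervalI[where g = "\<lambda>k x. weak_deriv l k f x + weak_deriv l k g x"])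
    (intro L2_interval_add has_weak_deriv_add weak_deriv[OF assms(1)] weak_deriv[OF assms(2)]
      H_interval_L2[OF assms(1)] H_interval_L2[OF assms(2)]; assumption)+

lemma H_interval_cmult:
  assumes "f \<in> H_interval r l"
  shows "(\<lambda>x. c * f x) \<in> H_interval r l"
  by (rule H_intervalI[where g = "\<lambda>k x. c * weak_deriv l k f x"])
    (intro L2_interval_cmult has_weak_deriv_cmult weak_deriv[OF assms(1)] H_interval_L2[OF assms(1)]; assumption)+

lemma H_interval_diff:
  assumes "f \<in> H_interval r l" "g \<in> H_interval r l"
  shows "(\<lambda>x. f x - g x) \<in> H_interval r l"
  using H_interval_add[OF assms(1) H_interval_cmult[OF assms(2), of "-1"]] by simp

lemma H_norm_triangle:
  assumes "0 \<le> l" "f \<in> H_interval r l" "g \<in> H_interval r l"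
  shows "H_norm_interval r l (\<lambda>x. f x + g x) \<le> H_norm_interval r l f + H_norm_interval r l g"
proof -
  have "H_norm_interval r l (\<lambda>x. f x + g x) =
      L2_set (\<lambda>k. L2_norm_interval l (\<lambda>x. weak_deriv l k f x + weak_deriv l k g x)) {..r}"
    by (rule H_norm_eq[OF assms(1)])
      (intro L2_interval_add has_weak_deriv_add weak_deriv[OF assms(2)] weak_deriv[OF assms(3)]
      H_interval_L2[OF assms(2)] H_interval_L2[OF assms(3)]; assumption)+
  also have "\<dots> \<le> L2_set (\<lambda>k. L2_norm_interval l (weak_deriv l k f) + L2_norm_interval l (weak_deriv l k g)) {..r}"
    by (intro L2_set_mono L2_norm_triangle L2_norm_nonneg weak_deriv[OF assms(2)] weak_deriv[OF assms(3)])
      auto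
  also have "\<dots> \<le> H_norm_interval r l f + H_norm_interval r l g"
    unfolding H_norm_eq_L2_set by (rule L2_set_triangle_ineq)
  finally show ?thesis .
qed

lemma H_norm_cmult:
  assumes "0 \<le> l" "f \<in> H_interval r l"
  shows "H_norm_interval r l (\<lambda>x. c * f x) = \<bar>c\<bar> * H_norm_interval r l f"
proof -
  have "H_norm_interval r l (\<lambda>x. c * f x) =
      L2_set (\<lambda>k. L2_norm_interval l (\<lambda>x. c * weak_deriv l k f x)) {..r}"
    by (rule H_norm_eq[OF assms(1)])
      (intro L2_interval_cmult has_weak_deriv_cmult weak_deriv[OF assms(2)]; assumption)+
  then show ?thesis
    by (simp add: L2_norm_cmult L2_set_right_distrib H_norm_eq_L2_set)
qed

lemma H_norm_mono:
  assumes "r \<le> r'"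
  shows "H_norm_interval r l f \<le> H_norm_interval r' l f"
  unfolding H_norm_interval_def
  by (intro real_sqrt_le_mono sum_mono2) (use assms in auto)

lemma L2_norm_weak_deriv_le_H_norm:
  assumes "k \<le> r"
  shows "L2_norm_interval l (weak_deriv l k f) \<le> H_norm_interval r l f"
  unfolding H_norm_eq_L2_set using assms by (intro member_le_L2_set) auto

lemma L2_norm_le_H_norm:
  assumes "0 \<le> l" "f \<in> L2_interval l"
  shows "L2_norm_interval l f \<le> H_norm_interval r l f"
  using L2_norm_weak_deriv[OF assms has_weak_deriv_0] L2_norm_weak_deriv_le_H_norm[of 0 r l f] by simp

lemma H_interval_0: "H_interval 0 l = L2_interval l"
  using has_weak_deriv_0 by (auto simp: H_interval_def)

text \<open>Together with \<open>H_interval_weak_deriv\<close> and \<open>H_norm_Suc_le\<close> this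
  gives the recursion on the order by which polynomials are shown to be dense.\<close>

lemma H_interval_Suc:
  assumes "f \<in> L2_interval l" "has_weak_deriv l 1 f g" "g \<in> H_interval r l"
  shows "f \<in> H_interval (Suc r) l"
proof (rule H_intervalI[where g = "\<lambda>k. case k of 0 \<Rightarrow> f | Suc j \<Rightarrow> weak_deriv l j g"])
  fix k assume "k \<le> Suc r"
  then show "(case k of 0 \<Rightarrow> f | Suc j \<Rightarrow> weak_deriv l j g) \<in> L2_interval l"
    using assms(1) weak_deriv(1)[OF assms(3)] by (auto split: nat.split)
  show "has_weak_deriv l k f (case k of 0 \<Rightarrow> f | Suc j \<Rightarrow> weak_deriv l j g)"
    using \<open>k \<le> Suc r\<close> has_weak_deriv_trans[OF assms(2) weak_deriv(2)[OF assms(3)]]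
    by (auto split: nat.split intro: has_weak_deriv_0)
qed (rule assms)

lemma H_interval_weak_deriv:
  assumes "f \<in> H_interval (Suc r) l"
  shows "weak_deriv l 1 f \<in> H_interval r l"
proof (rule H_intervalI[where g = "\<lambda>k. weak_deriv l (Suc k) f"])
  fix k assume k: "k \<le> r"
  then show "weak_deriv l (Suc k) f \<in> L2_interval l"
    by (intro weak_deriv[OF assms]) simp
  have "has_weak_deriv l 1 f (weak_deriv l 1 f)" by (intro weak_deriv[OF assms]) simp
  moreover have "has_weak_deriv l (1 + k) f (weak_deriv l (Suc k) f)"
    using weak_deriv(2)[OF assms, of "Suc k"] k by simp
  ultimately show "has_weak_deriv l k (weak_deriv l 1 f) (weak_deriv l (Suc k) f)"
    by (rule has_weak_deriv_cancel)
qed (intro weak_deriv[OF assms]; simp)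

lemma H_norm_Suc_le:
  assumes "0 \<le> l" "f \<in> L2_interval l" "has_weak_deriv l 1 f g" "g \<in> H_interval r l"
  shows "H_norm_interval (Suc r) l f \<le> L2_norm_interval l f + H_norm_interval r l g"
proof -
  have "(\<Sum>k\<le>Suc r. (L2_norm_interval l (weak_deriv l k f))\<^sup>2) =
      (L2_norm_interval l (weak_deriv l 0 f))\<^sup>2 + (\<Sum>k\<le>r. (L2_norm_interval l (weak_deriv l (Suc k) f))\<^sup>2)"
    by (rule sum.atMost_Suc_shift)
  also have "L2_norm_interval l (weak_deriv l 0 f) = L2_norm_interval l f"
    by (rule L2_norm_weak_deriv[OF assms(1,2) has_weak_deriv_0])
  also have "(\<Sum>k\<le>r. (L2_norm_interval l (weak_deriv l (Suc k) f))\<^sup>2) =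
      (\<Sum>k\<le>r. (L2_norm_interval l (weak_deriv l k g))\<^sup>2)"
  proof (rule sum.cong[OF refl])
    fix k assume "k \<in> {..r}"
    then have "weak_deriv l k g \<in> L2_interval l" "has_weak_deriv l (Suc k) f (weak_deriv l k g)"
      using weak_deriv[OF assms(4), of k] has_weak_deriv_trans[OF assms(3), of k] by auto
    from L2_norm_weak_deriv[OF assms(1) this]
    show "(L2_norm_interval l (weak_deriv l (Suc k) f))\<^sup>2 = (L2_norm_interval l (weak_deriv l k g))\<^sup>2"
      by simp
  qed
  also have "\<dots> = (H_norm_interval r l g)\<^sup>2"
    by (simp add: H_norm_interval_def sum_nonneg)
  finally have "H_norm_interval (Suc r) l f = sqrt ((L2_norm_interval l f)\<^sup>2 + (H_norm_interval r l g)\<^sup>2)"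
    unfolding H_norm_interval_def[of "Suc r"] by (rule arg_cong)
  then show ?thesis
    using sqrt_sum_squares_le_sum[OF L2_norm_nonneg[of l f] H_norm_nonneg[of r l g]] by simp
qed

lemma C2_interval_subset_H_interval:
  assumes "0 < l"
  shows "C2_interval l \<subseteq> H_interval 2 l"
proof
  fix f assume "f \<in> C2_interval l"
  then obtain f' f'' where c: "continuous_on {0..l} f''"
    and D: "\<And>x. x \<in> {0..l} \<Longrightarrow> (f has_real_derivative f' x) (at x within {0..l})"
      "\<And>x. x \<in> {0..l} \<Longrightarrow> (f' has_real_derivative f'' x) (at x within {0..l})"
    unfolding C2_interval_def by blast
  have c': "continuous_on {0..l} f'" and c0: "continuous_on {0..l} f"
    using D DERIV_continuous_on by blast+
  have "f'' \<in> H_interval 0 l" using c by (simp add: H_interval_0 L2_interval_continuous)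
  then have "f' \<in> H_interval (Suc 0) l"
    by (rule H_interval_Suc[OF L2_interval_continuous[OF c'] C1_has_weak_deriv[OF assms D(2) c], rotated])
  then have "f \<in> H_interval (Suc (Suc 0)) l"
    by (rule H_interval_Suc[OF L2_interval_continuous[OF c0] C1_has_weak_deriv[OF assms D(1) c'], rotated])
  then show "f \<in> H_interval 2 l" by (simp add: numeral_2_eq_2)
qed

lemma poly_in_C2_interval: "poly p \<in> C2_interval l"
  unfolding C2_interval_def
  by (intro CollectI exI[of _ "poly (pderiv p)"] exI[of _ "poly (pderiv (pderiv p))"])
    (auto intro!: continuous_intros DERIV_subset[OF poly_DERIV])

lemma poly_in_H_interval: "0 < l \<Longrightarrow> poly p \<in> H_interval r l"
proof (induction r arbitrary: p)
  case 0
  then show ?case by (simp add: H_interval_0 L2_interval_poly)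
next
  case (Suc r)
  then show ?case by (intro H_interval_Suc[OF L2_interval_poly poly_has_weak_deriv])
qed

lemma poly_antiderivative:
  fixes q :: "real poly"
  obtains p where "pderiv p = q"
proof
  show "pderiv (\<Sum>i\<le>Polynomial.degree q. monom (coeff q i / (of_nat i + 1)) (Suc i)) = q"
  proof -
    have "pderiv (\<Sum>i\<le>Polynomial.degree q. monom (coeff q i / (of_nat i + 1)) (Suc i))
       = (\<Sum>i\<le>Polynomial.degree q. monom (coeff q i) i)"
      unfolding sum_comp_morphism[where h = pderiv, OF pderiv_0 pderiv_add, unfolded o_def, symmetric]
      by (intro sum.cong refl) (auto simp: pderiv_monom add.commute simp flip: of_nat_Suc)
    also have "\<dots> = q" by (rule poly_as_sum_of_monoms)
    finally show ?thesis .
  qed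
qed

subsection \<open>Poincare inequality and density of polynomials\<close>

lemma L2_norm_1: "0 \<le> l \<Longrightarrow> L2_norm_interval l (\<lambda>x. 1) = sqrt l"
  by (simp add: L2_norm_interval_def measure_restrict_space)

text \<open>If every test function had integral zero, duality would make the constant 1 a null
  function, but its norm is \<open>sqrt l\<close>. No explicit bump has to be integrated.\<close>

lemma test_fun_integral_one:
  assumes "0 < l"
  obtains \<eta> where "\<eta> \<in> test_fun l" "inner_L2 l (\<lambda>x. 1) \<eta> = 1"
proof -
  have "\<exists>\<psi>\<in>test_fun l. inner_L2 l (\<lambda>x. 1) \<psi> \<noteq> 0"
  proof (rule ccontr)
    assume "\<not> ?thesis"
    then have "L2_norm_interval l (\<lambda>x. 1) \<le> 0"
      using assms by (intro L2_norm_le_of_test_fun L2_interval_const) auto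
    then show False using L2_norm_1[of l] assms by simp
  qed
  then obtain \<psi> where \<psi>: "\<psi> \<in> test_fun l" "inner_L2 l (\<lambda>x. 1) \<psi> \<noteq> 0" by blast
  show thesis
  proof
    show "(\<lambda>x. (1 / inner_L2 l (\<lambda>x. 1) \<psi>) * \<psi> x) \<in> test_fun l"
      by (rule test_fun_cmult[OF \<psi>(1)])
    show "inner_L2 l (\<lambda>x. 1) (\<lambda>x. (1 / inner_L2 l (\<lambda>x. 1) \<psi>) * \<psi> x) = 1"
      unfolding inner_L2_cmult_right using \<psi>(2) by simp
  qed
qed

lemma integral_test_fun_eq_inner:
  assumes "\<psi> \<in> test_fun l"
  shows "integral {0..l} \<psi> = inner_L2 l (\<lambda>x. 1) \<psi>"
  using assms by (simp add: lebesgue_integral_eq_integral continuous_imp_integrable_real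
    smooth_continuous_on test_fun_smooth)

lemma abs_integral_le_L2_norm:
  assumes "continuous_on {0..l} f" "x \<in> {0..l}"
  shows "\<bar>integral {0..x} f\<bar> \<le> sqrt l * L2_norm_interval l f"
proof -
  have c: "continuous_on {0..x} f" "continuous_on {0..l} (\<lambda>x. \<bar>f x\<bar>)"
    using assms by (auto intro!: continuous_on_subset[OF assms(1)] continuous_on_rabs)
  have "\<bar>integral {0..x} f\<bar> \<le> integral {0..x} (\<lambda>x. \<bar>f x\<bar>)"
    using integral_norm_bound_integral[of f "{0..x}" "\<lambda>x. \<bar>f x\<bar>"] c(1)
    by (simp add: integrable_continuous_interval continuous_on_rabs)
  also have "\<dots> \<le> integral {0..l} (\<lambda>x. \<bar>f x\<bar>)"
    using assms(2) c(1) c(2) by (intro integral_subset_le integrable_continuous_interval)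
      (simp_all add: continuous_on_rabs)
  also have "\<dots> = inner_L2 l (\<lambda>x. 1) (\<lambda>x. \<bar>f x\<bar>)"
    using c(2) by (simp add: lebesgue_integral_eq_integral continuous_imp_integrable_real)
  also have "\<dots> \<le> L2_norm_interval l (\<lambda>x. 1) * L2_norm_interval l (\<lambda>x. \<bar>f x\<bar>)"
    using L2_Cauchy_Schwarz[OF L2_interval_const L2_interval_continuous[OF c(2)], of 1] by simp
  also have "\<dots> = sqrt l * L2_norm_interval l f"
    using assms(2) by (simp add: L2_norm_1) (simp add: L2_norm_interval_def)
  finally show ?thesis .
qed

text \<open>Duality: tested against \<open>\<psi>\<close>, the difference \<open>v - \<integral> v \<eta>\<close> gives \<open>v\<close> tested against the mean-free
  function \<open>\<psi> - (\<integral> \<psi>) \<eta>\<close>, which is the derivative of a test function.\<close>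

theorem weak_Poincare:
  assumes "0 < l"
  obtains \<eta> C where "\<eta> \<in> test_fun l" "0 \<le> C"
    "\<And>v g. v \<in> L2_interval l \<Longrightarrow> g \<in> L2_interval l \<Longrightarrow> has_weak_deriv l 1 v g \<Longrightarrow>
      L2_norm_interval l (\<lambda>x. v x - inner_L2 l v \<eta>) \<le> C * L2_norm_interval l g"
proof -
  \<comment> \<open>The mean is taken against a test function and not against the constant 1/l, so
    that \<open>\<psi>0\<close> below is again a test function.\<close>
  obtain \<eta> where \<eta>: "\<eta> \<in> test_fun l" "inner_L2 l (\<lambda>x. 1) \<eta> = 1"
    using test_fun_integral_one[OF assms] .
  \<comment> \<open>\<open>K\<close> bounds the map from \<open>\<psi>\<close> to its mean-free part
    \<open>\<psi>0\<close>. The further factor \<open>l\<close> in the estimate is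
    \<open>sqrt l\<close> for bounding the primitive pointwise by Cauchy-Schwarz, times
    \<open>sqrt l\<close> for returning to the L2 norm.\<close>
  define K where "K = 1 + sqrt l * L2_norm_interval l \<eta>"
  have K: "0 \<le> K" unfolding K_def using assms by (simp add: L2_norm_nonneg)
  note L2\<eta> = test_fun_L2[OF \<eta>(1)]
  have main: "L2_norm_interval l (\<lambda>x. v x - inner_L2 l v \<eta>) \<le> (l * K) * L2_norm_interval l g"
    if v: "v \<in> L2_interval l" and g: "g \<in> L2_interval l" and vg: "has_weak_deriv l 1 v g" for v g
  proof (rule L2_norm_le_of_test_fun)
    define c where "c = inner_L2 l v \<eta>"
    show w: "(\<lambda>x. v x - inner_L2 l v \<eta>) \<in> L2_interval l"
      by (intro L2_interval_diff v L2_interval_const)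
    show "0 \<le> (l * K) * L2_norm_interval l g" using assms K by (simp add: L2_norm_nonneg)
    fix \<psi> assume \<psi>: "\<psi> \<in> test_fun l"
    note L2\<psi> = test_fun_L2[OF \<psi>]
    define m where "m = inner_L2 l (\<lambda>x. 1) \<psi>"
    define \<psi>0 where "\<psi>0 = (\<lambda>x. \<psi> x - m * \<eta> x)"
    have \<psi>0: "\<psi>0 \<in> test_fun l"
      unfolding \<psi>0_def by (intro test_fun_diff test_fun_cmult \<psi> \<eta>(1))
    have "inner_L2 l (\<lambda>x. 1) \<psi>0 = m - m * inner_L2 l (\<lambda>x. 1) \<eta>"
      unfolding \<psi>0_def inner_L2_diff_right[OF L2\<psi> L2_interval_cmult[OF L2\<eta>] L2_interval_const]
        inner_L2_cmult_right m_def ..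
    then have "integral {0..l} \<psi>0 = 0"
      using \<eta>(2) by (simp add: integral_test_fun_eq_inner[OF \<psi>0])
    then obtain \<phi> where \<phi>: "\<phi> \<in> test_fun l" "\<And>x. (\<phi> has_real_derivative \<psi>0 x) (at x)"
      "\<And>x. \<phi> x = integral {0..x} \<psi>0"
      using test_fun_antiderivative[OF assms \<psi>0] by blast
    have "deriv \<phi> = \<psi>0" using \<phi>(2) by (intro ext DERIV_imp_deriv)
    have m: "\<bar>m\<bar> \<le> sqrt l * L2_norm_interval l \<psi>"
      using L2_Cauchy_Schwarz[OF L2_interval_const L2\<psi>, of 1] L2_norm_1[of l] assms by (simp add: m_def)
    have "L2_norm_interval l \<psi>0 \<le> L2_norm_interval l \<psi> + \<bar>m\<bar> * L2_norm_interval l \<eta>"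
      using L2_norm_triangle[OF L2\<psi> L2_interval_cmult[OF L2\<eta>, of "-m"]]
      unfolding L2_norm_cmult by (simp add: \<psi>0_def)
    also have "\<dots> \<le> L2_norm_interval l \<psi> + (sqrt l * L2_norm_interval l \<psi>) * L2_norm_interval l \<eta>"
      using m by (intro add_mono mult_right_mono) (auto simp: L2_norm_nonneg)
    also have "\<dots> = K * L2_norm_interval l \<psi>"
      by (simp add: K_def algebra_simps)
    finally have N\<psi>0: "L2_norm_interval l \<psi>0 \<le> K * L2_norm_interval l \<psi>" .
    have "L2_norm_interval l \<phi> \<le> (sqrt l * L2_norm_interval l \<psi>0) * sqrt l"
    proof (rule L2_norm_bounded)
      show "\<bar>\<phi> x\<bar> \<le> sqrt l * L2_norm_interval l \<psi>0" if "x \<in> {0..l}" for x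
        unfolding \<phi>(3) using that
        by (intro abs_integral_le_L2_norm smooth_continuous_on test_fun_smooth[OF \<psi>0])
    qed (use assms \<phi>(1) in \<open>auto intro: L2_interval_measurable test_fun_L2 simp: L2_norm_nonneg\<close>)
    also have "\<dots> = l * L2_norm_interval l \<psi>0" using assms by simp
    also have "\<dots> \<le> l * (K * L2_norm_interval l \<psi>)"
      using N\<psi>0 assms by (intro mult_left_mono) auto
    finally have N\<phi>: "L2_norm_interval l \<phi> \<le> l * (K * L2_norm_interval l \<psi>)" .
    have "inner_L2 l (\<lambda>x. v x - inner_L2 l v \<eta>) \<psi> = inner_L2 l v \<psi> - inner_L2 l (\<lambda>x. c * 1) \<psi>"
      using inner_L2_diff_left[OF v L2_interval_const L2\<psi>, of c] by (simp add: c_def)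
    also have "inner_L2 l (\<lambda>x. c * 1) \<psi> = c * m"
      unfolding inner_L2_cmult_left[of l c "\<lambda>x. 1"] m_def ..
    also have "inner_L2 l v \<psi> - c * m = inner_L2 l v \<psi>0"
      unfolding \<psi>0_def inner_L2_diff_right[OF L2\<psi> L2_interval_cmult[OF L2\<eta>] v]
        inner_L2_cmult_right c_def by (simp add: mult.commute)
    also have "\<dots> = - inner_L2 l g \<phi>"
      using has_weak_derivD[OF vg \<phi>(1)] \<open>deriv \<phi> = \<psi>0\<close> by simp
    finally have "\<bar>inner_L2 l (\<lambda>x. v x - inner_L2 l v \<eta>) \<psi>\<bar> = \<bar>inner_L2 l g \<phi>\<bar>" by simp
    also have "\<dots> \<le> L2_norm_interval l g * L2_norm_interval l \<phi>"
      by (rule L2_Cauchy_Schwarz[OF g test_fun_L2[OF \<phi>(1)]])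
    also have "\<dots> \<le> L2_norm_interval l g * (l * (K * L2_norm_interval l \<psi>))"
      by (intro mult_left_mono N\<phi> L2_norm_nonneg)
    finally show "\<bar>inner_L2 l (\<lambda>x. v x - inner_L2 l v \<eta>) \<psi>\<bar>
        \<le> (l * K) * L2_norm_interval l g * L2_norm_interval l \<psi>"
      by (simp add: mult_ac)
  qed (use assms in simp)
  show thesis
    by (rule that[OF \<eta>(1) _ main]) (use assms K in simp_all)
qed

text \<open>Induction on the order: approximate the weak derivative by a polynomial, integrate it,
  and choose the constant of integration by Poincare's inequality, so that the error of the function
  is controlled by that of its derivative.\<close>

theorem H_interval_polynomial_dense:
  assumes "0 < l" "f \<in> H_interval r l" "0 < \<epsilon>"
  shows "\<exists>p. H_norm_interval r l (\<lambda>x. f x - poly p x) < \<epsilon>"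
  using assms(2,3)
proof (induction r arbitrary: f \<epsilon>)
  case 0
  then have f: "f \<in> L2_interval l" by (simp add: H_interval_0)
  obtain p where p: "L2_norm_interval l (\<lambda>x. f x - poly p x) < \<epsilon>"
    using L2_polynomial_dense[OF f \<open>0 < \<epsilon>\<close>] assms(1) by auto
  have "H_norm_interval 0 l (\<lambda>x. f x - poly p x) = L2_norm_interval l (\<lambda>x. f x - poly p x)"
    using assms(1) L2_norm_weak_deriv[OF _ L2_interval_diff[OF f L2_interval_poly] has_weak_deriv_0, of p]
    by (simp add: H_norm_interval_def L2_norm_nonneg)
  with p show ?case by metis
next
  case (Suc r)
  obtain \<eta> C where C: "0 \<le> C"
    and poincare: "\<And>v g. v \<in> L2_interval l \<Longrightarrow> g \<in> L2_interval l \<Longrightarrow> has_weak_deriv l 1 v g \<Longrightarrow>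
      L2_norm_interval l (\<lambda>x. v x - inner_L2 l v \<eta>) \<le> C * L2_norm_interval l g"
    using weak_Poincare[OF assms(1)] by metis
  define g where "g = weak_deriv l 1 f"
  have fL2: "f \<in> L2_interval l" by (rule H_interval_L2[OF Suc.prems(1)])
  have gH: "g \<in> H_interval r l" unfolding g_def by (rule H_interval_weak_deriv[OF Suc.prems(1)])
  have fg: "has_weak_deriv l 1 f g" unfolding g_def by (rule weak_deriv[OF Suc.prems(1)]) simp
  \<comment> \<open>In the factor \<open>C + 1\<close>, Poincare's inequality accounts for
    \<open>C\<close> and the derivative itself for 1.\<close>
  obtain q where q: "H_norm_interval r l (\<lambda>x. g x - poly q x) < \<epsilon> / (C + 1)"
    using Suc.IH[OF gH, of "\<epsilon> / (C + 1)"] C Suc.prems(2) by auto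
  obtain P where P: "pderiv P = q" by (rule poly_antiderivative)
  define w where "w = (\<lambda>x. f x - poly P x)"
  define c where "c = inner_L2 l w \<eta>"
  have w: "w \<in> L2_interval l" unfolding w_def by (intro L2_interval_diff fL2 L2_interval_poly)
  have gq: "(\<lambda>x. g x - poly q x) \<in> H_interval r l"
    by (intro H_interval_diff gH poly_in_H_interval assms)
  note gqL2 = H_interval_L2[OF gq]
  have wd: "has_weak_deriv l 1 w (\<lambda>x. g x - poly q x)"
    unfolding w_def P[symmetric]
    by (intro has_weak_deriv_diff fL2 fg H_interval_L2[OF gH] L2_interval_poly poly_has_weak_deriv assms)
  have "L2_norm_interval l (\<lambda>x. w x - c) \<le> C * L2_norm_interval l (\<lambda>x. g x - poly q x)"
    unfolding c_def by (rule poincare[OF w gqL2 wd])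
  also have "\<dots> \<le> C * H_norm_interval r l (\<lambda>x. g x - poly q x)"
    using assms(1) by (intro mult_left_mono C L2_norm_le_H_norm gqL2) simp
  finally have N: "L2_norm_interval l (\<lambda>x. w x - c) \<le> C * H_norm_interval r l (\<lambda>x. g x - poly q x)" .
  have "has_weak_deriv l 1 (\<lambda>x. w x - poly [:c:] x) (\<lambda>x. (g x - poly q x) - poly (pderiv [:c:]) x)"
    by (intro has_weak_deriv_diff w gqL2 wd L2_interval_poly poly_has_weak_deriv assms)
  then have wd': "has_weak_deriv l 1 (\<lambda>x. w x - c) (\<lambda>x. g x - poly q x)"
    by simp
  have "H_norm_interval (Suc r) l (\<lambda>x. w x - c) \<le> L2_norm_interval l (\<lambda>x. w x - c)
      + H_norm_interval r l (\<lambda>x. g x - poly q x)"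
    using assms(1) by (intro H_norm_Suc_le wd' gq L2_interval_diff w L2_interval_const) simp
  also have "\<dots> \<le> (C + 1) * H_norm_interval r l (\<lambda>x. g x - poly q x)"
    using N by (simp add: distrib_right)
  also have "\<dots> < \<epsilon>"
    using q C by (simp add: pos_less_divide_eq mult.commute)
  also have "(\<lambda>x. w x - c) = (\<lambda>x. f x - poly (P + [:c:]) x)"
    by (simp add: w_def fun_eq_iff)
  finally show ?case by blast
qed

section \<open>Approximate evaluation at the ends of an interval\<close>

lemma abs_integral_le_supported:
  fixes a b l :: real
  assumes "integrable (lebesgue_on {0..l}) h" "{a..b} \<subseteq> {0..l}" "a \<le> b"
    and "\<And>x. x \<in> {a..b} \<Longrightarrow> \<bar>h x\<bar> \<le> C" "\<And>x. x \<notin> {a..b} \<Longrightarrow> h x = 0"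
  shows "\<bar>integral\<^sup>L (lebesgue_on {0..l}) h\<bar> \<le> C * (b - a)"
proof -
  have S: "{a..b} \<inter> space (lebesgue_on {0..l}) = {a..b}" using assms(2) by auto
  have meas: "emeasure (lebesgue_on {0..l}) {a..b} = ennreal (b - a)"
    using assms(2,3) by (simp add: emeasure_restrict_space)
  have fin: "emeasure (lebesgue_on {0..l}) {a..b} < \<infinity>" unfolding meas by simp
  have mS: "{a..b} \<in> sets (lebesgue_on {0..l})"
    using assms(2) by (simp add: sets_restrict_space_iff)
  have "\<bar>integral\<^sup>L (lebesgue_on {0..l}) h\<bar> \<le> integral\<^sup>L (lebesgue_on {0..l}) (\<lambda>x. \<bar>h x\<bar>)"
    by (rule integral_abs_bound)
  also have "\<dots> \<le> integral\<^sup>L (lebesgue_on {0..l}) (\<lambda>x. C * indicator {a..b} x)"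
    using assms mS fin by (intro integral_mono integrable_abs integrable_mult_right integrable_real_indicator)
      (auto simp: indicator_def)
  also have "\<dots> = C * (b - a)"
    using assms(3) meas S by (simp add: measure_def)
  finally show ?thesis .
qed

text \<open>The factor \<open>sqrt (b - a)\<close> is the source of the powers of
  \<open>sqrt 2\<close> in the kernel bounds, as the supports have length of order 2^(-j).\<close>

lemma L2_norm_le_supported:
  assumes "f \<in> L2_interval l" "{a..b} \<subseteq> {0..l}" "a \<le> b" "0 \<le> C"
    and "\<And>x. x \<in> {a..b} \<Longrightarrow> \<bar>f x\<bar> \<le> C" "\<And>x. x \<notin> {a..b} \<Longrightarrow> f x = 0"
  shows "L2_norm_interval l f \<le> C * sqrt (b - a)"
proof -
  have "\<bar>integral\<^sup>L (lebesgue_on {0..l}) (\<lambda>x. (f x)\<^sup>2)\<bar> \<le> C\<^sup>2 * (b - a)"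
  proof (rule abs_integral_le_supported[OF L2_interval_integrable_square[OF assms(1)] assms(2,3)])
    show "\<bar>(f x)\<^sup>2\<bar> \<le> C\<^sup>2" if "x \<in> {a..b}" for x
      using power_mono[OF assms(5)[OF that], of 2] by simp
  qed (use assms(6) in simp)
  then have "sqrt (integral\<^sup>L (lebesgue_on {0..l}) (\<lambda>x. (f x)\<^sup>2)) \<le> sqrt (C\<^sup>2 * (b - a))"
    by (intro real_sqrt_le_mono) simp
  then show ?thesis
    using assms(4) by (simp add: L2_norm_interval_def real_sqrt_mult)
qed

lemma inner_L2_deriv_test_fun:
  assumes "0 < l" "\<phi> \<in> test_fun l"
  shows "inner_L2 l (\<lambda>x. 1) (deriv \<phi>) = 0"
  using has_weak_derivD[OF poly_has_weak_deriv[OF assms(1), of 1] assms(2)] by (simp add: pderiv_1)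

lemma inner_L2_dilate:
  assumes "0 < l" "\<eta> \<in> test_fun l" "1 \<le> c"
  shows "inner_L2 l (\<lambda>x. 1) (\<lambda>x. c * \<eta> (c * x)) = inner_L2 l (\<lambda>x. 1) \<eta>"
proof -
  have d: "(\<lambda>x. \<eta> (c * x)) \<in> test_fun l" by (rule test_fun_dilate[OF assms(2,3)])
  have "(\<eta> has_integral integral {0..l} \<eta>) {0..l}"
    by (intro integrable_integral integrable_continuous_interval smooth_continuous_on
        test_fun_smooth[OF assms(2)])
  from has_integral_stretch_real[OF this, of c]
  have "((\<lambda>x. \<eta> (c * x)) has_integral integral {0..l} \<eta> / c) ((\<lambda>x. x / c) ` {0..l})"
    using assms(3) by simp
  also have "(\<lambda>x. x / c) ` {0..l} = {0..l / c}"
    using assms by (simp add: image_divide_atLeastAtMost)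
  finally have "((\<lambda>x. \<eta> (c * x)) has_integral integral {0..l} \<eta> / c) {0..l}"
  proof (rule has_integral_on_superset)
    show "\<eta> (c * x) = 0" if "x \<notin> {0..l / c}" for x
      by (rule test_fun_outside[OF assms(2)]) (use that assms(3) in \<open>auto simp: field_simps mult_le_0_iff\<close>)
    have "l / c \<le> l / 1" using assms by (intro divide_left_mono) auto
    then show "{0..l / c} \<subseteq> {0..l}" by simp
  qed
  then have "integral {0..l} (\<lambda>x. \<eta> (c * x)) = integral {0..l} \<eta> / c" by (rule integral_unique)
  then show ?thesis
    using assms(3) unfolding inner_L2_cmult_right integral_test_fun_eq_inner[OF d]
      integral_test_fun_eq_inner[OF assms(2)] by simp
qed

section \<open>Kernels concentrating at an end of an interval\<close>

fun end_pos :: "real \<Rightarrow> edge_end \<Rightarrow> real" where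
  "end_pos l Initial = 0"
| "end_pos l Terminal = l"

text \<open>Writing kernels as functions of the distance to the chosen end lets one construction
  serve both ends; at the terminal end this is a reflection of the interval, an involution.\<close>

fun end_dist :: "real \<Rightarrow> edge_end \<Rightarrow> real \<Rightarrow> real" where
  "end_dist l Initial x = x"
| "end_dist l Terminal x = l - x"

lemma test_fun_end_dist: "\<phi> \<in> test_fun l \<Longrightarrow> (\<lambda>x. \<phi> (end_dist l b x)) \<in> test_fun l"
  by (cases b) (auto simp: test_fun_reflect)

text \<open>Approximate point masses. Height 2^j on a length of order 2^(-j) gives the norm
  \<open>sqrt 2 ^ j\<close> up to a constant; the primitive of a difference has bounded height on
  the same length, hence the reciprocal power. One constant serves both bounds.\<close>

definition trace_kernels :: "real \<Rightarrow> edge_end \<Rightarrow> (nat \<Rightarrow> real \<Rightarrow> real) \<Rightarrow> bool" where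
  "trace_kernels l b \<kappa> \<longleftrightarrow> (\<forall>j. \<kappa> j \<in> test_fun l) \<and>
     (\<exists>C\<ge>0. \<forall>j. L2_norm_interval l (\<kappa> j) \<le> C * sqrt 2 ^ j \<and>
        (\<exists>\<phi>\<in>test_fun l. deriv \<phi> = (\<lambda>x. \<kappa> j x - \<kappa> (Suc j) x) \<and> L2_norm_interval l \<phi> \<le> C / sqrt 2 ^ j)) \<and>
     (\<forall>u. continuous_on {0..l} u \<longrightarrow> (\<lambda>j. inner_L2 l u (\<kappa> j)) \<longlonglongrightarrow> u (end_pos l b))"

text \<open>The kernels are dilations \<open>\<kappa> j x = 2^j * \<theta> (2^j * d)\<close> of a test function, where \<open>d\<close> is the
  distance to the end. As \<open>\<kappa> j - \<kappa> (j + 1)\<close> has mean zero, it is the derivative of a test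
  function, which is again a dilation.\<close>

theorem trace_kernels_exist:
  assumes l: "0 < l"
  shows "\<exists>\<kappa>. trace_kernels l b \<kappa>"
proof -
  obtain \<zeta> where \<zeta>: "\<zeta> \<in> test_fun l" "inner_L2 l (\<lambda>x. 1) \<zeta> = 1"
    using test_fun_integral_one[OF l] .
  define \<theta> where "\<theta> = (\<lambda>x. \<zeta> (end_dist l b x))"
  have \<theta>: "\<theta> \<in> test_fun l" unfolding \<theta>_def by (rule test_fun_end_dist[OF \<zeta>(1)])
  define \<psi> where "\<psi> = (\<lambda>x. \<theta> x - 2 * \<theta> (2 * x))"
  have t2: "(\<lambda>x. 2 * \<theta> (2 * x)) \<in> test_fun l"
    by (intro test_fun_cmult test_fun_dilate \<theta>) simp
  have \<psi>: "\<psi> \<in> test_fun l" unfolding \<psi>_def by (rule test_fun_diff[OF \<theta> t2])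
  have "inner_L2 l (\<lambda>x. 1) \<psi> = 0"
    unfolding \<psi>_def inner_L2_diff_right[OF test_fun_L2[OF \<theta>] test_fun_L2[OF t2] L2_interval_const]
    using inner_L2_dilate[OF l \<theta>, of 2] by simp
  then have \<psi>_int: "integral {0..l} \<psi> = 0" unfolding integral_test_fun_eq_inner[OF \<psi>] .
  obtain \<Phi> where \<Phi>: "\<Phi> \<in> test_fun l" "\<And>x. (\<Phi> has_real_derivative \<psi> x) (at x)"
    "\<And>x. \<Phi> x = integral {0..x} \<psi>"
    by (rule test_fun_antiderivative[OF l \<psi> \<psi>_int]) (rule that)
  obtain M1 where M1: "\<And>x. \<bar>\<theta> x\<bar> \<le> M1" "0 < M1" by (rule test_fun_bounded[OF \<theta>]) (rule that)
  obtain M2 where M2: "\<And>x. \<bar>\<Phi> x\<bar> \<le> M2" "0 < M2" by (rule test_fun_bounded[OF \<Phi>(1)]) (rule that)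
  define M where "M = max M1 M2"
  have M: "\<bar>\<theta> x\<bar> \<le> M" "\<bar>\<Phi> x\<bar> \<le> M" "0 < M" for x
    unfolding M_def using M1 M2 by (simp_all add: le_max_iff_disj less_max_iff_disj)
  \<comment> \<open>The derivative of the distance to the end. Since \<open>s * s = 1\<close>, the
    factor \<open>s\<close> in \<open>\<phi>\<close> cancels the sign from the chain rule.\<close>
  define s :: real where "s = (case b of Initial \<Rightarrow> 1 | Terminal \<Rightarrow> -1)"
  define \<kappa> where "\<kappa> j x = 2 ^ j * \<theta> (2 ^ j * end_dist l b x)" for j x
  define \<phi> where "\<phi> j x = s * \<Phi> (2 ^ j * end_dist l b x)" for j x
  have \<kappa>: "\<kappa> j \<in> test_fun l" for j
    unfolding \<kappa>_def by (intro test_fun_cmult test_fun_end_dist[of "\<lambda>x. \<theta> (2 ^ j * x)"] test_fun_dilate \<theta>) simp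
  have \<phi>: "\<phi> j \<in> test_fun l" for j
    unfolding \<phi>_def by (intro test_fun_cmult test_fun_end_dist[of "\<lambda>x. \<Phi> (2 ^ j * x)"] test_fun_dilate \<Phi>(1)) simp
  have D: "deriv (\<phi> j) = (\<lambda>x. \<kappa> j x - \<kappa> (Suc j) x)" for j
  proof
    fix x
    have "((\<lambda>x. 2 ^ j * end_dist l b x) has_real_derivative 2 ^ j * s) (at x)"
      by (cases b) (auto simp: s_def intro!: derivative_eq_intros)
    from DERIV_cmult[OF DERIV_chain2[OF \<Phi>(2) this], of s]
    have "(\<phi> j has_real_derivative s * (\<psi> (2 ^ j * end_dist l b x) * (2 ^ j * s))) (at x)"
      unfolding \<phi>_def .
    moreover have "s * s = 1" by (cases b) (auto simp: s_def)
    then have "s * (\<psi> (2 ^ j * end_dist l b x) * (2 ^ j * s)) = 2 ^ j * \<psi> (2 ^ j * end_dist l b x)"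
      by (metis mult.assoc mult.commute mult.left_neutral)
    ultimately have "deriv (\<phi> j) x = 2 ^ j * \<psi> (2 ^ j * end_dist l b x)"
      by (simp add: DERIV_imp_deriv)
    then show "deriv (\<phi> j) x = \<kappa> j x - \<kappa> (Suc j) x"
      by (simp add: \<psi>_def \<kappa>_def right_diff_distrib mult_ac)
  qed
  \<comment> \<open>Mass 1 is inherited from \<open>\<kappa> 0\<close>, since consecutive
    differences are derivatives of test functions. The reflection occurs both in
    \<open>\<theta>\<close> and in \<open>\<kappa>\<close>, so it cancels and
    \<open>\<kappa> 0 = \<zeta>\<close>.\<close>
  have one: "inner_L2 l (\<lambda>x. 1) (\<kappa> j) = 1" for j
  proof (induction j)
    case 0
    have "\<kappa> 0 = \<zeta>" by (cases b) (auto simp: \<kappa>_def \<theta>_def fun_eq_iff)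
    then show ?case using \<zeta> by simp
  next
    case (Suc j)
    have "0 = inner_L2 l (\<lambda>x. 1) (\<lambda>x. \<kappa> j x - \<kappa> (Suc j) x)"
      using inner_L2_deriv_test_fun[OF l \<phi>, of j] unfolding D by simp
    also have "\<dots> = inner_L2 l (\<lambda>x. 1) (\<kappa> j) - inner_L2 l (\<lambda>x. 1) (\<kappa> (Suc j))"
      by (rule inner_L2_diff_right[OF test_fun_L2[OF \<kappa>] test_fun_L2[OF \<kappa>] L2_interval_const])
    finally show ?case using Suc by simp
  qed

  \<comment> \<open>The interval of length \<open>l / 2 ^ j\<close> at the chosen end outside of
    which \<open>\<kappa> j\<close> and \<open>\<phi> j\<close> vanish.\<close>
  define A B where "A j = (case b of Initial \<Rightarrow> 0 | Terminal \<Rightarrow> l - l / 2 ^ j)"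
    and "B j = (case b of Initial \<Rightarrow> l / 2 ^ j | Terminal \<Rightarrow> l)" for j :: nat
  have le: "l / 2 ^ j \<le> l" for j :: nat
  proof -
    have "l / 2 ^ j \<le> l / 1" using l by (intro divide_left_mono) auto
    then show ?thesis by simp
  qed
  have AB: "{A j..B j} \<subseteq> {0..l}" "A j \<le> B j" "B j - A j = l / 2 ^ j" for j
    using l le by (cases b; auto simp: A_def B_def)+
  have supp: "2 ^ j * end_dist l b x \<le> 0 \<or> l \<le> 2 ^ j * end_dist l b x" if "x \<notin> {A j..B j}" for j x
    using that by (cases b) (auto simp: A_def B_def field_simps not_le mult_le_0_iff)
  have \<kappa>0: "\<kappa> j x = 0" "\<phi> j x = 0" if "x \<notin> {A j..B j}" for j x
    using test_fun_outside[OF \<theta> supp[OF that]] test_fun_outside[OF \<Phi>(1) supp[OF that]]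
    by (simp_all add: \<kappa>_def \<phi>_def)
  have \<kappa>M: "\<bar>\<kappa> j x\<bar> \<le> 2 ^ j * M" for j x
    using M(1) by (simp add: \<kappa>_def abs_mult)
  have \<phi>M: "\<bar>\<phi> j x\<bar> \<le> M" for j x
    using M(2) by (cases b) (simp_all add: \<phi>_def s_def)
  have pow: "(2::real) ^ j = sqrt 2 ^ j * sqrt 2 ^ j" for j
    by (simp flip: power_mult_distrib)
  have N\<kappa>: "L2_norm_interval l (\<kappa> j) \<le> (M * sqrt l) * sqrt 2 ^ j" for j
  proof -
    have "L2_norm_interval l (\<kappa> j) \<le> (2 ^ j * M) * sqrt (B j - A j)"
      by (rule L2_norm_le_supported[OF test_fun_L2[OF \<kappa>] AB(1,2)]) (use M \<kappa>M \<kappa>0 in auto)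
    also have "\<dots> = (M * sqrt l) * sqrt 2 ^ j"
      unfolding AB(3) by (simp add: real_sqrt_divide real_sqrt_power) (simp add: pow)
    finally show ?thesis .
  qed
  have N\<phi>: "L2_norm_interval l (\<phi> j) \<le> (M * sqrt l) / sqrt 2 ^ j" for j
  proof -
    have "L2_norm_interval l (\<phi> j) \<le> M * sqrt (B j - A j)"
      by (rule L2_norm_le_supported[OF test_fun_L2[OF \<phi>] AB(1,2)]) (use M \<phi>M \<kappa>0 in auto)
    then show ?thesis
      unfolding AB(3) by (simp add: real_sqrt_divide real_sqrt_power)
  qed
  have lim: "(\<lambda>j. inner_L2 l u (\<kappa> j)) \<longlonglongrightarrow> u (end_pos l b)" if u: "continuous_on {0..l} u" for u
  proof (rule LIMSEQ_I)
    fix r :: real assume r: "0 < r"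
    let ?e = "end_pos l b"
    \<comment> \<open>All kernels have L1 norm at most \<open>M * l\<close>, namely height
      \<open>2 ^ j * M\<close> on length \<open>l / 2 ^ j\<close>; an oscillation of
      \<open>u\<close> below \<open>\<delta>\<close> thus changes the average by at most
      r/2.\<close>
    define \<delta> where "\<delta> = r / (2 * (M * l))"
    have \<delta>: "0 < \<delta>" unfolding \<delta>_def using r M l by simp
    have "?e \<in> {0..l}" using l by (cases b) auto
    then obtain d where d: "0 < d" "\<And>x. x \<in> {0..l} \<Longrightarrow> \<bar>x - ?e\<bar> < d \<Longrightarrow> \<bar>u x - u ?e\<bar> < \<delta>"
      using u \<delta> unfolding continuous_on_iff dist_real_def by blast
    have "(\<lambda>j. l * (1 / 2) ^ j) \<longlonglongrightarrow> l * 0"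
      by (intro tendsto_mult_left LIMSEQ_power_zero) simp
    then have "\<forall>\<^sub>F j in sequentially. l * (1 / 2) ^ j < d"
      using order_tendstoD(2) d(1) by fastforce
    then obtain J where J: "\<And>j. J \<le> j \<Longrightarrow> l / 2 ^ j < d"
      by (auto simp: eventually_sequentially power_one_over)
    show "\<exists>J. \<forall>j\<ge>J. norm (inner_L2 l u (\<kappa> j) - u ?e) < r"
    proof (intro exI[of _ J] allI impI)
      fix j assume "J \<le> j"
      note L2 = L2_interval_continuous[OF u] L2_interval_const[of "u ?e" l] test_fun_L2[OF \<kappa>, of j]
      have "inner_L2 l u (\<kappa> j) - u ?e = inner_L2 l u (\<kappa> j) - inner_L2 l (\<lambda>x. u ?e * 1) (\<kappa> j)"
        unfolding inner_L2_cmult_left[of l "u ?e" "\<lambda>x. 1"] one by simp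
      also have "\<dots> = inner_L2 l (\<lambda>x. u x - u ?e) (\<kappa> j)"
        using inner_L2_diff_left[OF L2] by simp
      also have "\<bar>\<dots>\<bar> \<le> (\<delta> * (2 ^ j * M)) * (B j - A j)"
      proof (rule abs_integral_le_supported[OF L2_interval_integrable_mult[OF L2_interval_diff[OF L2(1,2)] L2(3)] AB(1,2)])
        fix x assume x: "x \<in> {A j..B j}"
        then have "x \<in> {0..l}" using AB(1) by blast
        moreover have "\<bar>x - ?e\<bar> \<le> l / 2 ^ j"
          using x by (cases b) (auto simp: A_def B_def)
        ultimately have "\<bar>u x - u ?e\<bar> \<le> \<delta>" using d(2) J[OF \<open>J \<le> j\<close>] by fastforce
        then show "\<bar>(u x - u ?e) * \<kappa> j x\<bar> \<le> \<delta> * (2 ^ j * M)"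
          unfolding abs_mult using \<kappa>M \<delta> by (intro mult_mono) auto
      qed (use \<kappa>0 in simp)
      also have "\<dots> = r / 2"
        unfolding AB(3) \<delta>_def using M(3) l by simp
      also have "\<dots> < r" using r by simp
      finally show "norm (inner_L2 l u (\<kappa> j) - u ?e) < r" by simp
    qed
  qed
  have "\<exists>\<phi>\<in>test_fun l. deriv \<phi> = (\<lambda>x. \<kappa> j x - \<kappa> (Suc j) x) \<and> L2_norm_interval l \<phi> \<le> M * sqrt l / sqrt 2 ^ j" for j
    by (rule bexI[of _ "\<phi> j"], rule conjI[OF D N\<phi>], rule \<phi>)
  moreover have "0 \<le> M * sqrt l" using M(3) l by simp
  ultimately have "trace_kernels l b \<kappa>"
    unfolding trace_kernels_def using \<kappa> N\<kappa> lim by (intro conjI allI impI exI[of _ "M * sqrt l"])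
  then show ?thesis by blast
qed

text \<open>One fixed family for each length and end, so that the trace is the same formula in every
  space and for every function.\<close>

definition trace_kernel :: "real \<Rightarrow> edge_end \<Rightarrow> nat \<Rightarrow> real \<Rightarrow> real" where
  "trace_kernel l b = (SOME \<kappa>. trace_kernels l b \<kappa>)"

lemma trace_kernels_trace_kernel: "0 < l \<Longrightarrow> trace_kernels l b (trace_kernel l b)"
  unfolding trace_kernel_def by (rule someI_ex[OF trace_kernels_exist])

lemma trace_kernel_test_fun: "0 < l \<Longrightarrow> trace_kernel l b j \<in> test_fun l"
  and trace_kernel_tendsto: "0 < l \<Longrightarrow> continuous_on {0..l} u \<Longrightarrow>
    (\<lambda>j. inner_L2 l u (trace_kernel l b j)) \<longlonglongrightarrow> u (end_pos l b)"
  using trace_kernels_trace_kernel unfolding trace_kernels_def by blast+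

abbreviation trace_approx :: "real \<Rightarrow> edge_end \<Rightarrow> nat \<Rightarrow> (real \<Rightarrow> real) \<Rightarrow> real" where
  "trace_approx l b j u \<equiv> inner_L2 l u (trace_kernel l b j)"

abbreviation trace_jump :: "real \<Rightarrow> edge_end \<Rightarrow> nat \<Rightarrow> (real \<Rightarrow> real) \<Rightarrow> real" where
  "trace_jump l b j u \<equiv> \<bar>trace_approx l b (Suc j) u - trace_approx l b j u\<bar>"

text \<open>The two endpoint estimates for interpolation. On L2 each average is estimated by itself;
  on H^1 the difference is tested as a derivative, which passes to \<open>u\<close> and leaves the
  small primitive.\<close>

lemma trace_approx_bounds:
  assumes l: "0 < l"
  obtains C where "0 \<le> C"
    "\<And>u. u \<in> L2_interval l \<Longrightarrow> \<bar>trace_approx l b 0 u\<bar> \<le> C * L2_norm_interval l u"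
    "\<And>u j. u \<in> L2_interval l \<Longrightarrow>
       trace_jump l b j u \<le> C * sqrt 2 ^ j * L2_norm_interval l u"
    "\<And>u j. u \<in> H_interval 1 l \<Longrightarrow>
       trace_jump l b j u \<le> C / sqrt 2 ^ j * H_norm_interval 1 l u"
proof -
  let ?\<kappa> = "trace_kernel l b"
  obtain C where C: "0 \<le> C" "\<And>j. L2_norm_interval l (?\<kappa> j) \<le> C * sqrt 2 ^ j"
    "\<And>j. \<exists>\<phi>\<in>test_fun l. deriv \<phi> = (\<lambda>x. ?\<kappa> j x - ?\<kappa> (Suc j) x) \<and> L2_norm_interval l \<phi> \<le> C / sqrt 2 ^ j"
    using trace_kernels_trace_kernel[OF l, of b] unfolding trace_kernels_def by blast
  note \<kappa>L2 = test_fun_L2[OF trace_kernel_test_fun[OF l]]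
  have at: "\<bar>trace_approx l b j u\<bar> \<le> C * sqrt 2 ^ j * L2_norm_interval l u" if u: "u \<in> L2_interval l" for u j
  proof -
    have "\<bar>trace_approx l b j u\<bar> \<le> L2_norm_interval l u * L2_norm_interval l (?\<kappa> j)"
      by (rule L2_Cauchy_Schwarz[OF u \<kappa>L2])
    also have "\<dots> \<le> L2_norm_interval l u * (C * sqrt 2 ^ j)"
      by (rule mult_left_mono[OF C(2) L2_norm_nonneg])
    finally show ?thesis by (simp add: mult_ac)
  qed
  \<comment> \<open>The two averages contribute \<open>sqrt 2 + 1\<close>, rounded up to 3; all
    three bounds then share the constant \<open>3 * C\<close>.\<close>
  have 1: "trace_jump l b j u \<le> (3 * C) * sqrt 2 ^ j * L2_norm_interval l u"
    if u: "u \<in> L2_interval l" for u j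
  proof -
    have "sqrt 2 \<le> 2" by (rule real_le_lsqrt) auto
    then have "(sqrt 2 + 1) * (C * sqrt 2 ^ j * L2_norm_interval l u) \<le> 3 * (C * sqrt 2 ^ j * L2_norm_interval l u)"
      using C(1) by (intro mult_right_mono mult_nonneg_nonneg) (auto simp: L2_norm_nonneg)
    moreover have "C * sqrt 2 ^ Suc j * L2_norm_interval l u + C * sqrt 2 ^ j * L2_norm_interval l u
        = (sqrt 2 + 1) * (C * sqrt 2 ^ j * L2_norm_interval l u)"
      by (simp add: algebra_simps)
    moreover have "trace_jump l b j u
        \<le> \<bar>trace_approx l b (Suc j) u\<bar> + \<bar>trace_approx l b j u\<bar>"
      by (rule abs_triangle_ineq4)
    ultimately show ?thesis
      using at[OF u, of j] at[OF u, of "Suc j"] by linarith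
  qed
  have 2: "trace_jump l b j u \<le> (3 * C) / sqrt 2 ^ j * H_norm_interval 1 l u"
    if u: "u \<in> H_interval 1 l" for u j
  proof -
    obtain \<phi> where \<phi>: "\<phi> \<in> test_fun l" "deriv \<phi> = (\<lambda>x. ?\<kappa> j x - ?\<kappa> (Suc j) x)"
      "L2_norm_interval l \<phi> \<le> C / sqrt 2 ^ j" using C(3) by blast
    have w: "weak_deriv l 1 u \<in> L2_interval l" "has_weak_deriv l 1 u (weak_deriv l 1 u)"
      by (auto intro: weak_deriv[OF u])
    have "trace_approx l b j u - trace_approx l b (Suc j) u = inner_L2 l u (deriv \<phi>)"
      unfolding \<phi>(2) using inner_L2_diff_right[OF \<kappa>L2 \<kappa>L2 H_interval_L2[OF u]] by simp
    also have "\<dots> = - inner_L2 l (weak_deriv l 1 u) \<phi>"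
      using has_weak_derivD[OF w(2) \<phi>(1)] by simp
    finally have "trace_jump l b j u = \<bar>inner_L2 l (weak_deriv l 1 u) \<phi>\<bar>"
      by linarith
    also have "\<dots> \<le> L2_norm_interval l (weak_deriv l 1 u) * L2_norm_interval l \<phi>"
      by (rule L2_Cauchy_Schwarz[OF w(1) test_fun_L2[OF \<phi>(1)]])
    also have "\<dots> \<le> H_norm_interval 1 l u * (C / sqrt 2 ^ j)"
      by (intro mult_mono \<phi>(3) L2_norm_weak_deriv_le_H_norm L2_norm_nonneg H_norm_nonneg) simp
    also have "\<dots> \<le> H_norm_interval 1 l u * ((3 * C) / sqrt 2 ^ j)"
      using C(1) by (intro mult_left_mono divide_right_mono) (auto simp: H_norm_nonneg)
    finally show ?thesis by (simp add: mult_ac)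
  qed
  show thesis
  proof (rule that[of "3 * C"])
    show "\<bar>trace_approx l b 0 u\<bar> \<le> 3 * C * L2_norm_interval l u" if "u \<in> L2_interval l" for u
    proof -
      have "C * L2_norm_interval l u \<le> (3 * C) * L2_norm_interval l u"
        using C(1) by (intro mult_right_mono) (auto simp: L2_norm_nonneg)
      with at[OF that, of 0] show ?thesis by simp
    qed
  qed (use C(1) 1 2 in simp_all)
qed

section \<open>Real interpolation\<close>

text \<open>\<open>M\<close> will be 1 for the spaces of integer order and 2 for the interpolation
  spaces. The factor 2 replaces Minkowski's inequality for the interpolation integral and is
  harmless for density and boundedness.\<close>

definition quasi_normed :: "real \<Rightarrow> 'e gfun seminormed \<Rightarrow> bool" where
  "quasi_normed M X \<longleftrightarrow> 0 \<in> carrier X \<and>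
     (\<forall>u\<in>carrier X. 0 \<le> seminorm X u) \<and>
     (\<forall>u\<in>carrier X. \<forall>v\<in>carrier X. u + v \<in> carrier X \<and>
        seminorm X (u + v) \<le> M * (seminorm X u + seminorm X v)) \<and>
     (\<forall>c. \<forall>u\<in>carrier X. (\<lambda>e x. c * u e x) \<in> carrier X \<and>
        seminorm X (\<lambda>e x. c * u e x) \<le> \<bar>c\<bar> * seminorm X u)"

lemma quasi_normed_zero: "quasi_normed M X \<Longrightarrow> 0 \<in> carrier X"
  and quasi_normed_nonneg: "quasi_normed M X \<Longrightarrow> u \<in> carrier X \<Longrightarrow> 0 \<le> seminorm X u"
  and quasi_normed_add: "quasi_normed M X \<Longrightarrow> u \<in> carrier X \<Longrightarrow> v \<in> carrier X \<Longrightarrow> u + v \<in> carrier X"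
  and quasi_normed_triangle: "quasi_normed M X \<Longrightarrow> u \<in> carrier X \<Longrightarrow> v \<in> carrier X \<Longrightarrow>
    seminorm X (u + v) \<le> M * (seminorm X u + seminorm X v)"
  and quasi_normed_cmult: "quasi_normed M X \<Longrightarrow> u \<in> carrier X \<Longrightarrow> (\<lambda>e x. c * u e x) \<in> carrier X"
  and quasi_normed_cmult_le: "quasi_normed M X \<Longrightarrow> u \<in> carrier X \<Longrightarrow>
    seminorm X (\<lambda>e x. c * u e x) \<le> \<bar>c\<bar> * seminorm X u"
  unfolding quasi_normed_def by blast+

lemma quasi_normed_mono:
  assumes X: "quasi_normed M X" and "M \<le> M'"
  shows "quasi_normed M' X"
proof -
  have "seminorm X (u + v) \<le> M' * (seminorm X u + seminorm X v)" if uv: "u \<in> carrier X" "v \<in> carrier X" for u v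
  proof -
    have "M * (seminorm X u + seminorm X v) \<le> M' * (seminorm X u + seminorm X v)"
      using assms(2) uv by (intro mult_right_mono add_nonneg_nonneg quasi_normed_nonneg[OF X])
    then show ?thesis using quasi_normed_triangle[OF X uv] by linarith
  qed
  then show ?thesis using X unfolding quasi_normed_def by blast
qed

lemma gfun_diff_eq: "u - v = u + (\<lambda>e x. (-1) * v e x)" for u v :: "'e gfun"
  by (simp add: fun_eq_iff)

lemma quasi_normed_diff: "quasi_normed M X \<Longrightarrow> u \<in> carrier X \<Longrightarrow> v \<in> carrier X \<Longrightarrow> u - v \<in> carrier X"
  unfolding gfun_diff_eq by (intro quasi_normed_add quasi_normed_cmult)

lemma quasi_normed_seminorm_zero:
  assumes "quasi_normed M X"
  shows "seminorm X 0 = 0"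
proof -
  have "(\<lambda>e x. 0 * (0 :: 'a gfun) e x) = 0" by (simp add: fun_eq_iff)
  then have "seminorm X 0 \<le> 0"
    using quasi_normed_cmult_le[OF assms quasi_normed_zero[OF assms], of 0] by simp
  then show ?thesis
    using quasi_normed_nonneg[OF assms quasi_normed_zero[OF assms]] by simp
qed

text \<open>The weight of the squared K-functional on a tail, where the functional will be bounded
  by a constant. The next lemma is its counterpart near 0, where the functional is at most linear in
  \<open>t\<close> and contributes a further t^2. Convergence needs 0 < \<theta> here and \<theta> <
  1 there.\<close>

lemma nn_integral_powr_atLeast:
  assumes "0 < \<theta>" "0 < \<tau>"
  shows "(\<integral>\<^sup>+t. ennreal (t powr (- 2 * \<theta> - 1)) * indicator {\<tau>..} t \<partial>lborel)
    = ennreal (\<tau> powr (- 2 * \<theta>) / (2 * \<theta>))"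
proof -
  have "((\<lambda>x. x powr (- 2 * \<theta> - 1)) has_integral \<tau> powr (- 2 * \<theta>) / (2 * \<theta>)) {\<tau>..}"
    using has_integral_powr_to_inf[of "- 2 * \<theta> - 1" \<tau>] assms by simp
  then show ?thesis
    by (rule nn_integral_has_integral_lebesgue'[rotated]) simp
qed

lemma nn_integral_powr_from_0:
  assumes "\<theta> < 1" "0 \<le> \<tau>"
  shows "(\<integral>\<^sup>+t. ennreal (t powr (1 - 2 * \<theta>)) * indicator {0..\<tau>} t \<partial>lborel)
    = ennreal (\<tau> powr (2 - 2 * \<theta>) / (2 - 2 * \<theta>))"
proof -
  have "((\<lambda>x. x powr (1 - 2 * \<theta>)) has_integral \<tau> powr (2 - 2 * \<theta>) / (2 - 2 * \<theta>)) {0..\<tau>}"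
    using has_integral_powr_from_0[of "1 - 2 * \<theta>" \<tau>] assms by simp
  then show ?thesis
    by (rule nn_integral_has_integral_lebesgue'[rotated]) simp
qed

text \<open>The ordered case: \<open>Y\<close> embeds in \<open>X\<close> with constant 1, so the
  sum of the couple is \<open>X\<close>, and the K-functional of any \<open>u\<close> stays bounded
  for large \<open>t\<close>.\<close>

locale interpolation_couple =
  fixes X Y :: "'e gfun seminormed" and \<theta> :: real
  assumes X: "quasi_normed 1 X" and Y: "quasi_normed 1 Y"
    and Y_sub: "carrier Y \<subseteq> carrier X"
    and Y_le: "\<And>u. u \<in> carrier Y \<Longrightarrow> seminorm X u \<le> seminorm Y u"
    and \<theta>: "0 < \<theta>" "\<theta> < 1"
begin

section \<open>The K-functional\<close>

abbreviation K :: "real \<Rightarrow> 'e gfun \<Rightarrow> real" where "K \<equiv> K_fun X Y"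

abbreviation cost :: "real \<Rightarrow> 'e gfun \<Rightarrow> 'e gfun \<Rightarrow> real" where
  "cost t a b \<equiv> sqrt ((seminorm X a)\<^sup>2 + t\<^sup>2 * (seminorm Y b)\<^sup>2)"

lemma K_le:
  assumes "a \<in> carrier X" "b \<in> carrier Y" "u = a + b"
  shows "K t u \<le> cost t a b"
  unfolding K_fun_def
proof (rule cInf_lower)
  show "bdd_below {cost t a b |a b. a \<in> carrier X \<and> b \<in> carrier Y \<and> u = a + b}"
    by (rule bdd_belowI[of _ 0]) auto
qed (use assms in blast)

lemma K_ge:
  assumes "u \<in> carrier X"
    and "\<And>a b. a \<in> carrier X \<Longrightarrow> b \<in> carrier Y \<Longrightarrow> u = a + b \<Longrightarrow> m \<le> cost t a b"
  shows "m \<le> K t u"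
  unfolding K_fun_def
proof (rule cInf_greatest)
  have "u = u + 0" by simp
  then show "{cost t a b |a b. a \<in> carrier X \<and> b \<in> carrier Y \<and> u = a + b} \<noteq> {}"
    using assms(1) quasi_normed_zero[OF Y] by blast
qed (use assms(2) in blast)

lemma K_nonneg: "u \<in> carrier X \<Longrightarrow> 0 \<le> K t u"
  by (rule K_ge) auto

lemma K_approx:
  assumes "u \<in> carrier X" "K t u < m"
  obtains a b where "a \<in> carrier X" "b \<in> carrier Y" "u = a + b" "cost t a b < m"
  using K_ge[OF assms(1), of m t] assms(2) by (meson linorder_not_le)

lemma K_mono:
  assumes "u \<in> carrier X" "0 \<le> s" "s \<le> t"
  shows "K s u \<le> K t u"
proof (rule K_ge[OF assms(1)])
  fix a b assume ab: "a \<in> carrier X" "b \<in> carrier Y" "u = a + b"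
  have "K s u \<le> cost s a b" by (rule K_le[OF ab])
  also have "\<dots> \<le> cost t a b"
    using assms by (intro real_sqrt_le_mono add_left_mono mult_right_mono power_mono) auto
  finally show "K s u \<le> cost t a b" .
qed

text \<open>In other words \<open>K t u / t\<close> is nonincreasing. Scaling the cost at
  \<open>t\<close> by \<open>s / t\<close> reproduces the \<open>Y\<close> term of the cost at
  \<open>s\<close> and shrinks the \<open>X\<close> term.\<close>

lemma K_scale:
  assumes "u \<in> carrier X" "0 < s" "s \<le> t"
  shows "s / t * K t u \<le> K s u"
proof (rule K_ge[OF assms(1)])
  fix a b assume ab: "a \<in> carrier X" "b \<in> carrier Y" "u = a + b"
  have le: "(s / t)\<^sup>2 \<le> 1" using assms by (simp add: power_le_one divide_le_eq)
  have "s / t * K t u \<le> s / t * cost t a b"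
    using assms by (intro mult_left_mono K_le[OF ab]) auto
  also have "\<dots> = sqrt ((s / t)\<^sup>2 * ((seminorm X a)\<^sup>2 + t\<^sup>2 * (seminorm Y b)\<^sup>2))"
    using assms by (simp add: real_sqrt_mult)
  also have "\<dots> = sqrt ((s / t)\<^sup>2 * (seminorm X a)\<^sup>2 + s\<^sup>2 * (seminorm Y b)\<^sup>2)"
    using assms by (simp add: distrib_left power_divide)
  also have "\<dots> \<le> cost s a b"
    using mult_right_mono[OF le, of "(seminorm X a)\<^sup>2"] by (intro real_sqrt_le_mono add_right_mono) simp
  finally show "s / t * K t u \<le> cost s a b" .
qed

lemma K_le_X: "u \<in> carrier X \<Longrightarrow> K t u \<le> seminorm X u"
  using K_le[of u 0 u t] quasi_normed_zero[OF Y] quasi_normed_seminorm_zero[OF Y] quasi_normed_nonneg[OF X, of u]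
  by simp

lemma K_le_Y: "u \<in> carrier Y \<Longrightarrow> 0 \<le> t \<Longrightarrow> K t u \<le> t * seminorm Y u"
  using K_le[of 0 u u t] quasi_normed_zero[OF X] quasi_normed_seminorm_zero[OF X] quasi_normed_nonneg[OF Y, of u]
  by (simp add: real_sqrt_mult)

text \<open>The cost is the Euclidean norm of the pair formed by \<open>seminorm X a\<close> and
  \<open>t * seminorm Y b\<close>, so the triangle inequality in the plane applies to nearly optimal
  decompositions.\<close>

lemma K_add:
  assumes u: "u \<in> carrier X" and v: "v \<in> carrier X"
  shows "K t (u + v) \<le> K t u + K t v"
proof (rule field_le_epsilon)
  fix e :: real assume "0 < e"
  then have *: "K t u < K t u + e / 2" "K t v < K t v + e / 2" by simp_all
  obtain a b where ab: "a \<in> carrier X" "b \<in> carrier Y" "u = a + b" "cost t a b < K t u + e / 2"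
    using K_approx[OF u *(1)] .
  obtain c d where cd: "c \<in> carrier X" "d \<in> carrier Y" "v = c + d" "cost t c d < K t v + e / 2"
    using K_approx[OF v *(2)] .
  let ?a = "seminorm X a" and ?b = "seminorm Y b" and ?c = "seminorm X c" and ?d = "seminorm Y d"
  have "K t (u + v) \<le> cost t (a + c) (b + d)"
    by (rule K_le) (use ab cd in \<open>auto intro: quasi_normed_add[OF X] quasi_normed_add[OF Y] simp: add_ac\<close>)
  also have "\<dots> \<le> sqrt ((1 * (?a + ?c))\<^sup>2 + t\<^sup>2 * (1 * (?b + ?d))\<^sup>2)"
    using ab cd by (intro real_sqrt_le_mono add_mono mult_left_mono power_mono
      quasi_normed_triangle[OF X] quasi_normed_triangle[OF Y]
      quasi_normed_nonneg[OF X] quasi_normed_nonneg[OF Y] quasi_normed_add[OF X] quasi_normed_add[OF Y]) auto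
  also have "\<dots> = sqrt ((?a + ?c)\<^sup>2 + (t * ?b + t * ?d)\<^sup>2)"
    by (simp add: power_mult_distrib flip: distrib_left)
  also have "\<dots> \<le> cost t a b + cost t c d"
    using real_sqrt_sum_squares_triangle_ineq[of ?a ?c "t * ?b" "t * ?d"]
    by (simp add: power_mult_distrib)
  also have "\<dots> \<le> K t u + K t v + e" using ab(4) cd(4) by simp
  finally show "K t (u + v) \<le> K t u + K t v + e" .
qed

lemma K_cmult:
  assumes u: "u \<in> carrier X"
  shows "K t (\<lambda>e x. c * u e x) \<le> \<bar>c\<bar> * K t u"
proof (cases "c = 0")
  case True
  then have "(\<lambda>e x. c * u e x) = 0" by (simp add: fun_eq_iff)
  then show ?thesis
    using K_le_X[OF quasi_normed_zero[OF X], of t] True by (simp add: quasi_normed_seminorm_zero[OF X])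
next
  case False
  have "K t (\<lambda>e x. c * u e x) / \<bar>c\<bar> \<le> K t u"
  proof (rule K_ge[OF u])
    fix a b assume ab: "a \<in> carrier X" "b \<in> carrier Y" "u = a + b"
    have "K t (\<lambda>e x. c * u e x) \<le> cost t (\<lambda>e x. c * a e x) (\<lambda>e x. c * b e x)"
      by (rule K_le) (auto intro: quasi_normed_cmult[OF X ab(1)] quasi_normed_cmult[OF Y ab(2)]
        simp: ab(3) fun_eq_iff distrib_left)
    also have "\<dots> \<le> sqrt ((\<bar>c\<bar> * seminorm X a)\<^sup>2 + t\<^sup>2 * (\<bar>c\<bar> * seminorm Y b)\<^sup>2)"
      by (intro real_sqrt_le_mono add_mono mult_left_mono power_mono
        quasi_normed_cmult_le[OF X ab(1)] quasi_normed_cmult_le[OF Y ab(2)]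
        quasi_normed_nonneg[OF X] quasi_normed_nonneg[OF Y]
        quasi_normed_cmult[OF X ab(1)] quasi_normed_cmult[OF Y ab(2)]) simp
    also have "\<dots> = sqrt (c\<^sup>2 * ((seminorm X a)\<^sup>2 + t\<^sup>2 * (seminorm Y b)\<^sup>2))"
      by (simp add: power_mult_distrib algebra_simps)
    also have "\<dots> = \<bar>c\<bar> * cost t a b" by (simp add: real_sqrt_mult)
    finally show "K t (\<lambda>e x. c * u e x) / \<bar>c\<bar> \<le> cost t a b"
      using False by (simp add: divide_le_eq mult.commute)
  qed
  then show ?thesis using False by (simp add: divide_le_eq mult.commute)
qed

section \<open>The interpolation norm as a weighted integral\<close>

abbreviation Z :: "'e gfun seminormed" where "Z \<equiv> interp X Y \<theta>"

abbreviation weighted :: "'e gfun \<Rightarrow> real \<Rightarrow> ennreal" where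
  "weighted u t \<equiv> ennreal ((K t u)\<^sup>2 * t powr (- 2 * \<theta> - 1))"

lemma interp_nn_eq: "interp_nn X Y \<theta> u = (\<integral>\<^sup>+t. weighted u t * indicator {0<..} t \<partial>lborel)"
  unfolding interp_nn_def
proof (rule nn_integral_cong)
  fix t :: real
  have "(t powr (- \<theta>) * K t u)\<^sup>2 / t = (K t u)\<^sup>2 * t powr (- 2 * \<theta> - 1)" if "0 < t"
  proof -
    have "(t powr (- \<theta>))\<^sup>2 / t = t powr (- 2 * \<theta> - 1)"
      using that by (simp add: powr_diff powr_power)
    then show ?thesis by (metis power_mult_distrib mult.commute times_divide_eq_left)
  qed
  then show "ennreal ((t powr (- \<theta>) * K t u)\<^sup>2 / t) * indicator {0<..} t = weighted u t * indicator {0<..} t"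
    by (auto simp: indicator_def)
qed

text \<open>As an infimum over uncountably many decompositions the K-functional is measurable for a
  different reason: it is monotone for positive \<open>t\<close>. It is even in \<open>t\<close>,
  hence the cut at 0.\<close>

lemma weighted_measurable:
  assumes "u \<in> carrier X" "S \<in> sets borel" "S \<subseteq> {0<..}"
  shows "(\<lambda>t. weighted u t * indicator S t) \<in> borel_measurable lborel"
proof -
  have "mono (\<lambda>t. if 0 < t then K t u else 0)"
    by (rule monoI) (use K_mono[OF assms(1)] K_nonneg[OF assms(1)] in auto)
  then have [measurable]: "(\<lambda>t. if 0 < t then K t u else 0) \<in> borel_measurable borel"
    by (rule borel_measurable_mono)
  have [measurable]: "S \<in> sets borel" by (rule assms)
  have "(\<lambda>t. weighted u t * indicator S t) =
      (\<lambda>t. ennreal ((if 0 < t then K t u else 0)\<^sup>2 * t powr (- 2 * \<theta> - 1)) * indicator S t)"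
    using assms(3) by (auto simp: fun_eq_iff indicator_def)
  also have "\<dots> \<in> borel_measurable lborel" by measurable
  finally show ?thesis .
qed

abbreviation interp_near_0 :: "'e gfun \<Rightarrow> real \<Rightarrow> ennreal" where
  "interp_near_0 u \<tau> \<equiv> (\<integral>\<^sup>+t. weighted u t * indicator {0<..<\<tau>} t \<partial>lborel)"

text \<open>The template for bounding an interpolation norm: below \<open>\<tau>\<close> by the
  K-functional of another element plus a linear term, beyond \<open>\<tau>\<close> by a constant.
  \<open>Y_interp\<close> uses it with \<open>c = 0\<close>, \<open>Y_dense_interp\<close> with
  \<open>c = 2\<close>.\<close>

lemma interp_nn_le:
  assumes u: "u \<in> carrier X" and "0 < \<tau>" "0 \<le> A" "0 \<le> B" "0 \<le> c"
    and small: "\<And>t. 0 < t \<Longrightarrow> t < \<tau> \<Longrightarrow> (K t v)\<^sup>2 \<le> c * (K t u)\<^sup>2 + A * t\<^sup>2"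
    and large: "\<And>t. \<tau> \<le> t \<Longrightarrow> (K t v)\<^sup>2 \<le> B"
  shows "interp_nn X Y \<theta> v \<le> ennreal c * interp_near_0 u \<tau> +
    ennreal (A * (\<tau> powr (2 - 2 * \<theta>) / (2 - 2 * \<theta>)) + B * (\<tau> powr (- 2 * \<theta>) / (2 * \<theta>)))"
proof -
  let ?f = "\<lambda>t. ennreal c * (weighted u t * indicator {0<..<\<tau>} t)"
  let ?g = "\<lambda>t. ennreal A * (ennreal (t powr (1 - 2 * \<theta>)) * indicator {0..\<tau>} t)"
  let ?h = "\<lambda>t. ennreal B * (ennreal (t powr (- 2 * \<theta> - 1)) * indicator {\<tau>..} t)"
  have f: "(\<lambda>t. weighted u t * indicator {0<..<\<tau>} t) \<in> borel_measurable lborel"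
    by (rule weighted_measurable[OF u]) auto
  have mf: "?f \<in> borel_measurable lborel"
    by (rule borel_measurable_times_ennreal[OF borel_measurable_const f])
  have mg: "?g \<in> borel_measurable lborel" and mh: "?h \<in> borel_measurable lborel" by measurable
  have "interp_nn X Y \<theta> v \<le> (\<integral>\<^sup>+t. ?f t + (?g t + ?h t) \<partial>lborel)"
    unfolding interp_nn_eq
  proof (rule nn_integral_mono)
    fix t :: real
    consider "t \<le> 0" | "0 < t" "t < \<tau>" | "0 < t" "\<tau> \<le> t" by linarith
    then show "weighted v t * indicator {0<..} t \<le> ?f t + (?g t + ?h t)"
    proof cases
      case 2
      have "t\<^sup>2 * t powr (- 2 * \<theta> - 1) = t powr (1 - 2 * \<theta>)"
        using 2 powr_add[of t 2 "- 2 * \<theta> - 1"] by simp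
      then have eq: "(c * (K t u)\<^sup>2 + A * t\<^sup>2) * t powr (- 2 * \<theta> - 1) =
          c * ((K t u)\<^sup>2 * t powr (- 2 * \<theta> - 1)) + A * t powr (1 - 2 * \<theta>)"
        by (simp add: distrib_right mult.assoc)
      have "weighted v t \<le> ennreal ((c * (K t u)\<^sup>2 + A * t\<^sup>2) * t powr (- 2 * \<theta> - 1))"
        by (intro ennreal_leI mult_right_mono small 2) simp
      also have "\<dots> = ennreal c * weighted u t + ennreal A * ennreal (t powr (1 - 2 * \<theta>))"
        unfolding eq using assms(3,5) by (simp add: ennreal_plus ennreal_mult)
      finally show ?thesis using 2 by (simp add: indicator_def)
    next
      case 3
      have "weighted v t \<le> ennreal (B * t powr (- 2 * \<theta> - 1))"
        by (intro ennreal_leI mult_right_mono large 3) simp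
      also have "\<dots> = ennreal B * ennreal (t powr (- 2 * \<theta> - 1))"
        using assms(4) by (simp add: ennreal_mult)
      also have "\<dots> \<le> ?g t + \<dots>" by simp
      finally show ?thesis using 3 by (simp add: indicator_def)
    qed simp
  qed
  also have "\<dots> = (\<integral>\<^sup>+t. ?f t \<partial>lborel) + ((\<integral>\<^sup>+t. ?g t \<partial>lborel) + (\<integral>\<^sup>+t. ?h t \<partial>lborel))"
    by (simp only: nn_integral_add mf mg mh borel_measurable_add)
  also have "(\<integral>\<^sup>+t. ?f t \<partial>lborel) = ennreal c * interp_near_0 u \<tau>"
    by (rule nn_integral_cmult[OF f])
  also have "(\<integral>\<^sup>+t. ?g t \<partial>lborel) = ennreal A * ennreal (\<tau> powr (2 - 2 * \<theta>) / (2 - 2 * \<theta>))"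
    using nn_integral_powr_from_0[OF \<theta>(2), of \<tau>] \<open>0 < \<tau>\<close> by (subst nn_integral_cmult) auto
  also have "(\<integral>\<^sup>+t. ?h t \<partial>lborel) = ennreal B * ennreal (\<tau> powr (- 2 * \<theta>) / (2 * \<theta>))"
    using nn_integral_powr_atLeast[OF \<theta>(1) \<open>0 < \<tau>\<close>] by (subst nn_integral_cmult) auto
  also have "ennreal A * ennreal (\<tau> powr (2 - 2 * \<theta>) / (2 - 2 * \<theta>)) = ennreal (A * (\<tau> powr (2 - 2 * \<theta>) / (2 - 2 * \<theta>)))"
    using assms(3) \<theta> by (intro ennreal_mult[symmetric]) auto
  also have "ennreal B * ennreal (\<tau> powr (- 2 * \<theta>) / (2 * \<theta>)) = ennreal (B * (\<tau> powr (- 2 * \<theta>) / (2 * \<theta>)))"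
    using assms(4) \<theta> by (intro ennreal_mult[symmetric]) auto
  also have "ennreal (A * (\<tau> powr (2 - 2 * \<theta>) / (2 - 2 * \<theta>))) + ennreal (B * (\<tau> powr (- 2 * \<theta>) / (2 * \<theta>))) =
      ennreal (A * (\<tau> powr (2 - 2 * \<theta>) / (2 - 2 * \<theta>)) + B * (\<tau> powr (- 2 * \<theta>) / (2 * \<theta>)))"
    using assms(3,4) \<theta> by (intro ennreal_plus[symmetric] mult_nonneg_nonneg) auto
  finally show ?thesis .
qed

lemma carrier_interp: "carrier Z = {u \<in> carrier X. interp_nn X Y \<theta> u < \<infinity>}"
proof -
  have "(\<exists>a\<in>carrier X. \<exists>b\<in>carrier Y. u = a + b) \<longleftrightarrow> u \<in> carrier X" for u
  proof
    assume "u \<in> carrier X"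
    moreover have "u = u + 0" by simp
    ultimately show "\<exists>a\<in>carrier X. \<exists>b\<in>carrier Y. u = a + b"
      using quasi_normed_zero[OF Y] by blast
  qed (use quasi_normed_add[OF X] Y_sub in blast)
  then show ?thesis by (auto simp: interp_def)
qed

lemma interp_carrier_X: "u \<in> carrier Z \<Longrightarrow> u \<in> carrier X"
  by (simp add: carrier_interp)

lemma interp_nn_eq_seminorm:
  assumes "u \<in> carrier Z"
  shows "interp_nn X Y \<theta> u = ennreal ((seminorm Z u)\<^sup>2)"
  using assms by (simp add: interp_def carrier_interp less_top)

lemma interp_seminorm_nonneg: "0 \<le> seminorm Z u"
  by (simp add: interp_def)

lemma interp_nn_leD:
  assumes "u \<in> carrier X" "interp_nn X Y \<theta> u \<le> ennreal (m\<^sup>2)" "0 \<le> m"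
  shows "u \<in> carrier Z" "seminorm Z u \<le> m"
proof -
  show u: "u \<in> carrier Z"
    using assms by (simp add: carrier_interp le_less_trans[OF assms(2)])
  have "(seminorm Z u)\<^sup>2 \<le> m\<^sup>2"
    using assms(2) unfolding interp_nn_eq_seminorm[OF u] by simp
  then show "seminorm Z u \<le> m"
    using assms(3) by (rule power2_le_imp_le)
qed

text \<open>The K-functional increases, so beyond \<open>\<tau>\<close> the integral is at least its
  squared value at \<open>\<tau>\<close> times the integral of the weight. This is the embedding of
  exponent 2 into exponent infinity, the form in which the interpolation norm enters the trace
  estimate.\<close>

lemma K_le_interp:
  assumes u: "u \<in> carrier Z" and "0 < \<tau>"
  shows "K \<tau> u \<le> sqrt (2 * \<theta>) * \<tau> powr \<theta> * seminorm Z u"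
proof (rule power2_le_imp_le)
  note uX = interp_carrier_X[OF u]
  let ?g = "\<lambda>t. ennreal (t powr (- 2 * \<theta> - 1)) * indicator {\<tau>..} t"
  have "ennreal ((K \<tau> u)\<^sup>2 * (\<tau> powr (- 2 * \<theta>) / (2 * \<theta>))) = ennreal ((K \<tau> u)\<^sup>2) * (\<integral>\<^sup>+t. ?g t \<partial>lborel)"
    unfolding nn_integral_powr_atLeast[OF \<theta>(1) \<open>0 < \<tau>\<close>] using \<theta> by (intro ennreal_mult) auto
  also have "\<dots> = (\<integral>\<^sup>+t. ennreal ((K \<tau> u)\<^sup>2) * ?g t \<partial>lborel)"
    by (rule nn_integral_cmult[symmetric]) measurable
  also have "\<dots> \<le> interp_nn X Y \<theta> u"
    unfolding interp_nn_eq
  proof (rule nn_integral_mono)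
    fix t :: real
    have "ennreal ((K \<tau> u)\<^sup>2) * ennreal (t powr (- 2 * \<theta> - 1)) \<le> weighted u t" if "\<tau> \<le> t"
    proof -
      have "(K \<tau> u)\<^sup>2 \<le> (K t u)\<^sup>2"
        using K_mono[OF uX _ that] K_nonneg[OF uX] \<open>0 < \<tau>\<close> by (intro power_mono) auto
      then have "ennreal ((K \<tau> u)\<^sup>2 * t powr (- 2 * \<theta> - 1)) \<le> weighted u t"
        by (intro ennreal_leI mult_right_mono) auto
      then show ?thesis by (simp add: ennreal_mult)
    qed
    then show "ennreal ((K \<tau> u)\<^sup>2) * ?g t \<le> weighted u t * indicator {0<..} t"
      using \<open>0 < \<tau>\<close> by (auto simp: indicator_def)
  qed
  also have "\<dots> = ennreal ((seminorm Z u)\<^sup>2)" by (rule interp_nn_eq_seminorm[OF u])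
  finally have "(K \<tau> u)\<^sup>2 * (\<tau> powr (- 2 * \<theta>) / (2 * \<theta>)) \<le> (seminorm Z u)\<^sup>2" by simp
  moreover have "\<tau> powr (- 2 * \<theta>) = 1 / (\<tau> powr \<theta>)\<^sup>2"
    using \<open>0 < \<tau>\<close> by (simp add: powr_minus_divide powr_power mult.commute)
  ultimately have "(K \<tau> u)\<^sup>2 / (2 * \<theta> * (\<tau> powr \<theta>)\<^sup>2) \<le> (seminorm Z u)\<^sup>2"
    by (simp add: mult_ac)
  moreover have "0 < 2 * \<theta> * (\<tau> powr \<theta>)\<^sup>2" using \<theta> \<open>0 < \<tau>\<close> by simp
  ultimately have "(K \<tau> u)\<^sup>2 \<le> 2 * \<theta> * (\<tau> powr \<theta>)\<^sup>2 * (seminorm Z u)\<^sup>2"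
    by (simp only: pos_divide_le_eq mult_ac)
  then show "(K \<tau> u)\<^sup>2 \<le> (sqrt (2 * \<theta>) * \<tau> powr \<theta> * seminorm Z u)\<^sup>2"
    using \<theta> by (simp add: power_mult_distrib)
qed (use \<theta> interp_seminorm_nonneg in simp)

text \<open>At \<open>t = 1\<close> the cost dominates both \<open>seminorm X a\<close> and
  \<open>seminorm Y b\<close>, hence half of the norm of \<open>u\<close> in
  \<open>X\<close>.\<close>

lemma X_le_interp:
  assumes u: "u \<in> carrier Z"
  shows "seminorm X u \<le> 2 * sqrt (2 * \<theta>) * seminorm Z u"
proof -
  note uX = interp_carrier_X[OF u]
  have "seminorm X u / 2 \<le> K 1 u"
  proof (rule K_ge[OF uX])
    fix a b assume ab: "a \<in> carrier X" "b \<in> carrier Y" "u = a + b"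
    have "seminorm X u \<le> 1 * (seminorm X a + seminorm X b)"
      using quasi_normed_triangle[OF X ab(1)] ab(2,3) Y_sub by blast
    also have "\<dots> \<le> seminorm X a + seminorm Y b" using Y_le[OF ab(2)] by simp
    also have "\<dots> \<le> cost 1 a b + cost 1 a b"
      by (intro add_mono) (auto intro: real_le_rsqrt)
    finally show "seminorm X u / 2 \<le> cost 1 a b" by simp
  qed
  with K_le_interp[OF u, of 1] show ?thesis by simp
qed

text \<open>On \<open>Y\<close> the K-functional is at most min(1, t) times the norm; splitting the
  integral at 1 gives the two terms of \<open>C\<close>.\<close>

lemma Y_interp:
  obtains C where "0 \<le> C" "\<And>v. v \<in> carrier Y \<Longrightarrow> v \<in> carrier Z"
    "\<And>v. v \<in> carrier Y \<Longrightarrow> seminorm Z v \<le> C * seminorm Y v"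
proof -
  define C where "C = sqrt (1 / (2 - 2 * \<theta>) + 1 / (2 * \<theta>))"
  have C: "0 \<le> C" "C\<^sup>2 = 1 / (2 - 2 * \<theta>) + 1 / (2 * \<theta>)" using \<theta> by (simp_all add: C_def)
  have *: "interp_nn X Y \<theta> v \<le> ennreal ((C * seminorm Y v)\<^sup>2)" if v: "v \<in> carrier Y" for v
  proof -
    have vX: "v \<in> carrier X" using v Y_sub by blast
    have "interp_nn X Y \<theta> v \<le> ennreal 0 * interp_near_0 v 1 +
        ennreal ((seminorm Y v)\<^sup>2 * (1 powr (2 - 2 * \<theta>) / (2 - 2 * \<theta>))
          + (seminorm Y v)\<^sup>2 * (1 powr (- 2 * \<theta>) / (2 * \<theta>)))"
    proof (rule interp_nn_le[OF vX])
      show "(K t v)\<^sup>2 \<le> 0 * (K t v)\<^sup>2 + (seminorm Y v)\<^sup>2 * t\<^sup>2" if "0 < t" for t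
        using power_mono[OF K_le_Y[OF v, of t] K_nonneg[OF vX], of 2] that
        by (simp add: power_mult_distrib mult.commute)
      show "(K t v)\<^sup>2 \<le> (seminorm Y v)\<^sup>2" for t
        by (rule power_mono[OF order_trans[OF K_le_X[OF vX] Y_le[OF v]] K_nonneg[OF vX]])
    qed auto
    also have "\<dots> = ennreal ((C * seminorm Y v)\<^sup>2)"
      using C(2) by (simp add: power_mult_distrib algebra_simps)
    finally show ?thesis .
  qed
  show thesis
  proof (rule that[OF C(1)])
    fix v assume v: "v \<in> carrier Y"
    have "0 \<le> C * seminorm Y v" using C(1) quasi_normed_nonneg[OF Y v] by simp
    from interp_nn_leD[OF _ *[OF v] this] v Y_sub
    show "v \<in> carrier Z" "seminorm Z v \<le> C * seminorm Y v" by blast+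
  qed
qed

lemma interp_seminorm_scale:
  assumes "u \<in> carrier Z" "v \<in> carrier X" "0 \<le> c"
    and "\<And>t. 0 < t \<Longrightarrow> K t v \<le> c * K t u"
  shows "v \<in> carrier Z" "seminorm Z v \<le> c * seminorm Z u"
proof -
  have uX: "u \<in> carrier X" by (rule interp_carrier_X[OF assms(1)])
  have "interp_nn X Y \<theta> v \<le> (\<integral>\<^sup>+t. ennreal (c\<^sup>2) * (weighted u t * indicator {0<..} t) \<partial>lborel)"
    unfolding interp_nn_eq
  proof (rule nn_integral_mono)
    fix t :: real
    have "weighted v t \<le> ennreal (c\<^sup>2 * ((K t u)\<^sup>2 * t powr (- 2 * \<theta> - 1)))" if "0 < t"
    proof (rule ennreal_leI)
      have "(K t v)\<^sup>2 \<le> (c * K t u)\<^sup>2"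
        by (rule power_mono[OF assms(4)[OF that] K_nonneg[OF assms(2)]])
      then have "(K t v)\<^sup>2 * t powr (- 2 * \<theta> - 1) \<le> (c * K t u)\<^sup>2 * t powr (- 2 * \<theta> - 1)"
        by (rule mult_right_mono) simp
      then show "(K t v)\<^sup>2 * t powr (- 2 * \<theta> - 1) \<le> c\<^sup>2 * ((K t u)\<^sup>2 * t powr (- 2 * \<theta> - 1))"
        by (simp add: power_mult_distrib mult.assoc)
    qed
    then show "weighted v t * indicator {0<..} t \<le> ennreal (c\<^sup>2) * (weighted u t * indicator {0<..} t)"
      by (auto simp: indicator_def ennreal_mult)
  qed
  also have "\<dots> = ennreal (c\<^sup>2) * interp_nn X Y \<theta> u"
    unfolding interp_nn_eq by (intro nn_integral_cmult weighted_measurable[OF uX]) auto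
  also have "\<dots> = ennreal ((c * seminorm Z u)\<^sup>2)"
    unfolding interp_nn_eq_seminorm[OF assms(1)] by (simp add: ennreal_mult power_mult_distrib)
  finally have "interp_nn X Y \<theta> v \<le> ennreal ((c * seminorm Z u)\<^sup>2)" .
  from interp_nn_leD[OF assms(2) this]
  show "v \<in> carrier Z" "seminorm Z v \<le> c * seminorm Z u"
    using assms(3) interp_seminorm_nonneg by simp_all
qed

lemma interp_add:
  assumes u: "u \<in> carrier Z" and v: "v \<in> carrier Z"
  shows "u + v \<in> carrier Z"
    "seminorm Z (u + v) \<le> 2 * (seminorm Z u + seminorm Z v)"
proof -
  let ?N = "seminorm Z"
  have uX: "u \<in> carrier X" and vX: "v \<in> carrier X" using u v by (simp_all add: carrier_interp)
  have uvX: "u + v \<in> carrier X" by (rule quasi_normed_add[OF X uX vX])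
  have meas: "(\<lambda>t. weighted w t * indicator {0<..} t) \<in> borel_measurable lborel" if "w \<in> carrier X" for w
    by (rule weighted_measurable[OF that]) auto
  have "interp_nn X Y \<theta> (u + v) \<le> (\<integral>\<^sup>+t. ennreal 2 * (weighted u t * indicator {0<..} t) +
      ennreal 2 * (weighted v t * indicator {0<..} t) \<partial>lborel)"
    unfolding interp_nn_eq
  proof (rule nn_integral_mono)
    fix t :: real
    have "weighted (u + v) t \<le> ennreal (2 * ((K t u)\<^sup>2 * t powr (- 2 * \<theta> - 1)) + 2 * ((K t v)\<^sup>2 * t powr (- 2 * \<theta> - 1)))"
    proof (rule ennreal_leI)
      have "(K t (u + v))\<^sup>2 \<le> (K t u + K t v)\<^sup>2"
        by (rule power_mono[OF K_add[OF uX vX] K_nonneg[OF uvX]])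
      also have "\<dots> \<le> 2 * (K t u)\<^sup>2 + 2 * (K t v)\<^sup>2"
        using sum_squares_bound[of "K t u" "K t v"] by (simp add: power2_sum power_mult_distrib)
      finally have "(K t (u + v))\<^sup>2 * t powr (- 2 * \<theta> - 1) \<le>
          (2 * (K t u)\<^sup>2 + 2 * (K t v)\<^sup>2) * t powr (- 2 * \<theta> - 1)"
        by (rule mult_right_mono) simp
      then show "(K t (u + v))\<^sup>2 * t powr (- 2 * \<theta> - 1) \<le>
          2 * ((K t u)\<^sup>2 * t powr (- 2 * \<theta> - 1)) + 2 * ((K t v)\<^sup>2 * t powr (- 2 * \<theta> - 1))"
        by (simp add: algebra_simps)
    qed
    also have "\<dots> = ennreal 2 * weighted u t + ennreal 2 * weighted v t"
      by (simp add: ennreal_plus ennreal_mult del: ennreal_numeral)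
    finally show "weighted (u + v) t * indicator {0<..} t \<le> ennreal 2 * (weighted u t * indicator {0<..} t) +
      ennreal 2 * (weighted v t * indicator {0<..} t)"
      by (auto simp: indicator_def)
  qed
  also have "\<dots> = ennreal 2 * interp_nn X Y \<theta> u + ennreal 2 * interp_nn X Y \<theta> v"
    unfolding interp_nn_eq
    by (subst nn_integral_add; (intro borel_measurable_times_ennreal borel_measurable_const meas uX vX)?)
      (simp only: nn_integral_cmult[OF meas[OF uX]] nn_integral_cmult[OF meas[OF vX]])
  also have "\<dots> = ennreal (2 * (?N u)\<^sup>2 + 2 * (?N v)\<^sup>2)"
    unfolding interp_nn_eq_seminorm[OF u] interp_nn_eq_seminorm[OF v]
    by (simp add: ennreal_plus ennreal_mult del: ennreal_numeral)
  also have "\<dots> \<le> ennreal ((2 * (?N u + ?N v))\<^sup>2)"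
    using interp_seminorm_nonneg[of u] interp_seminorm_nonneg[of v]
    by (intro ennreal_leI) (simp add: power2_sum power_mult_distrib)
  finally have "interp_nn X Y \<theta> (u + v) \<le> ennreal ((2 * (?N u + ?N v))\<^sup>2)" .
  from interp_nn_leD[OF uvX this]
  show "u + v \<in> carrier Z" "?N (u + v) \<le> 2 * (?N u + ?N v)"
    using interp_seminorm_nonneg[of u] interp_seminorm_nonneg[of v] by simp_all
qed

lemma interp_cmult:
  assumes u: "u \<in> carrier Z"
  shows "(\<lambda>e x. c * u e x) \<in> carrier Z"
    "seminorm Z (\<lambda>e x. c * u e x) \<le> \<bar>c\<bar> * seminorm Z u"
  using interp_seminorm_scale[OF u quasi_normed_cmult[OF X interp_carrier_X[OF u]], of "\<bar>c\<bar>"]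
    K_cmult[OF interp_carrier_X[OF u]] by simp_all

section \<open>Density of the smaller space of a couple\<close>

lemma interp_near_0_finite:
  assumes "u \<in> carrier Z"
  shows "interp_near_0 u \<tau> < \<infinity>"
proof -
  have "interp_near_0 u \<tau> \<le> interp_nn X Y \<theta> u"
    unfolding interp_nn_eq by (intro nn_integral_mono) (auto simp: indicator_def)
  also have "\<dots> < \<infinity>" using assms by (simp add: carrier_interp)
  finally show ?thesis .
qed

text \<open>Dominated convergence for a finite integral. There is no analogue for the exponent
  infinity, where indeed the smaller space need not be dense.\<close>

lemma interp_near_0_tendsto:
  assumes u: "u \<in> carrier Z"
  shows "(\<lambda>n. interp_near_0 u (1 / real (Suc n))) \<longlonglongrightarrow> 0"
proof -
  note uX = interp_carrier_X[OF u]
  have "(\<lambda>n. interp_near_0 u (1 / real (Suc n))) \<longlonglongrightarrow> (\<integral>\<^sup>+t. (0::ennreal) \<partial>(lborel :: real measure))"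
  proof (rule nn_integral_dominated_convergence[where w = "\<lambda>t. weighted u t * indicator {0<..} t"])
    show "(\<lambda>t. weighted u t * indicator {0<..<1 / real (Suc n)} t) \<in> borel_measurable lborel" for n
      by (rule weighted_measurable[OF uX]) auto
    show "(\<lambda>t. weighted u t * indicator {0<..} t) \<in> borel_measurable lborel"
      by (rule weighted_measurable[OF uX]) auto
    show "(\<integral>\<^sup>+t. weighted u t * indicator {0<..} t \<partial>lborel) < \<infinity>"
      using u by (simp add: carrier_interp interp_nn_eq)
    show "AE t in lborel. weighted u t * indicator {0<..<1 / real (Suc n)} t \<le> weighted u t * indicator {0<..} t" for n
      by (intro AE_I2) (auto simp: indicator_def)
    show "AE t in lborel. (\<lambda>n. weighted u t * indicator {0<..<1 / real (Suc n)} t) \<longlonglongrightarrow> 0"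
    proof (rule AE_I2)
      fix t :: real
      have "\<forall>\<^sub>F n in sequentially. t \<notin> {0<..<1 / real (Suc n)}"
      proof (cases "0 < t")
        case True
        have "\<forall>\<^sub>F n in sequentially. 1 / real (Suc n) < t"
          using order_tendstoD(2)[OF LIMSEQ_inverse_real_of_nat True] by (simp add: inverse_eq_divide)
        then show ?thesis by (rule eventually_mono) auto
      qed simp
      then show "(\<lambda>n. weighted u t * indicator {0<..<1 / real (Suc n)} t) \<longlonglongrightarrow> 0"
        by (intro tendsto_eventually) (auto elim!: eventually_mono simp: indicator_def)
    qed
  qed simp
  then show ?thesis by simp
qed

text \<open>The lower bound on the integral near 0 comes from \<open>K t u / t\<close> being decreasing in \<open>t\<close>.\<close>

lemma K_le_interp_near_0:
  assumes u: "u \<in> carrier Z" and "0 < \<tau>"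
  shows "(K \<tau> u)\<^sup>2 * \<tau> powr (- 2 * \<theta>) \<le> (2 - 2 * \<theta>) * enn2real (interp_near_0 u \<tau>)"
proof -
  note uX = interp_carrier_X[OF u]
  let ?k = "(K \<tau> u)\<^sup>2 / \<tau>\<^sup>2"
  let ?g = "\<lambda>t. ennreal (t powr (1 - 2 * \<theta>)) * indicator {0..\<tau>} t"
  have "ennreal (?k * (\<tau> powr (2 - 2 * \<theta>) / (2 - 2 * \<theta>))) = ennreal ?k * (\<integral>\<^sup>+t. ?g t \<partial>lborel)"
    unfolding nn_integral_powr_from_0[OF \<theta>(2) less_imp_le[OF \<open>0 < \<tau>\<close>]] using \<theta> by (intro ennreal_mult) auto
  also have "\<dots> = (\<integral>\<^sup>+t. ennreal ?k * ?g t \<partial>lborel)"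
    by (rule nn_integral_cmult[symmetric]) measurable
  also have "\<dots> \<le> interp_near_0 u \<tau>"
  proof (rule nn_integral_mono_AE)
    \<comment> \<open>The indicators disagree at \<open>\<tau>\<close>, which is a null set, and at
      0, where \<open>powr\<close> has the value 0 by convention.\<close>
    show "AE t in lborel. ennreal ?k * ?g t \<le> weighted u t * indicator {0<..<\<tau>} t"
      using AE_lborel_singleton[of \<tau>]
    proof eventually_elim
      case (elim t)
      have "ennreal ?k * ennreal (t powr (1 - 2 * \<theta>)) \<le> weighted u t" if t: "0 < t" "t < \<tau>"
      proof -
        have "(t / \<tau> * K \<tau> u)\<^sup>2 \<le> (K t u)\<^sup>2"
          using K_scale[OF uX t(1), of \<tau>] K_nonneg[OF uX] t by (intro power_mono) auto
        then have "(t / \<tau> * K \<tau> u)\<^sup>2 * t powr (- 2 * \<theta> - 1) \<le> (K t u)\<^sup>2 * t powr (- 2 * \<theta> - 1)"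
          by (rule mult_right_mono) simp
        moreover have "t\<^sup>2 * t powr (- 2 * \<theta> - 1) = t powr (1 - 2 * \<theta>)"
          using t powr_add[of t 2 "- 2 * \<theta> - 1"] by simp
        then have "(t / \<tau> * K \<tau> u)\<^sup>2 * t powr (- 2 * \<theta> - 1) = ?k * t powr (1 - 2 * \<theta>)"
          by (simp add: power_mult_distrib power_divide)
        ultimately show ?thesis by (simp add: ennreal_leI flip: ennreal_mult)
      qed
      then show ?case using elim by (cases "t = 0") (auto simp: indicator_def)
    qed
  qed
  finally have "?k * (\<tau> powr (2 - 2 * \<theta>) / (2 - 2 * \<theta>)) \<le> enn2real (interp_near_0 u \<tau>)"
    using interp_near_0_finite[OF u, of \<tau>] \<theta> enn2real_mono by fastforce
  moreover have "\<tau> powr (2 - 2 * \<theta>) = \<tau>\<^sup>2 * \<tau> powr (- 2 * \<theta>)"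
    using \<open>0 < \<tau>\<close> powr_add[of \<tau> 2 "- 2 * \<theta>"] by simp
  then have "?k * (\<tau> powr (2 - 2 * \<theta>) / (2 - 2 * \<theta>)) = (K \<tau> u)\<^sup>2 * \<tau> powr (- 2 * \<theta>) / (2 - 2 * \<theta>)"
    using \<open>0 < \<tau>\<close> by simp
  ultimately have "(K \<tau> u)\<^sup>2 * \<tau> powr (- 2 * \<theta>) / (2 - 2 * \<theta>) \<le> enn2real (interp_near_0 u \<tau>)"
    by (simp only:)
  moreover have "0 < 2 - 2 * \<theta>" using \<theta> by simp
  ultimately show ?thesis
    by (simp only: pos_divide_le_eq mult.commute)
qed

text \<open>If \<open>u = a + b\<close> is a nearly optimal decomposition for \<open>K \<tau> u\<close>, then \<open>b\<close> approximates \<open>u\<close> as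
  \<open>\<tau> \<longlongrightarrow> 0\<close>: for \<open>t \<ge> \<tau>\<close> the functional \<open>K t a\<close> is controlled by the norm of \<open>a\<close> in \<open>X\<close>, for
  \<open>t < \<tau>\<close> by \<open>K t u + K t b\<close>.\<close>

theorem Y_dense_interp:
  assumes u: "u \<in> carrier Z" and "0 < \<epsilon>"
  obtains b where "b \<in> carrier Y" "seminorm Z (u - b) < \<epsilon>"
proof -
  note uX = interp_carrier_X[OF u]
  \<comment> \<open>The constants of the two explicit integrals: the one below \<open>\<tau>\<close>
    carries a 2 from (x + y)^2 <= 2 x^2 + 2 y^2. \<open>R J \<tau>\<close> will bound the squared
    interpolation norm of \<open>a\<close>, where \<open>J\<close> is the part of the integral of
    \<open>u\<close> below \<open>\<tau>\<close>.\<close>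
  define c where "c = 2 / (2 - 2 * \<theta>) + 1 / (2 * \<theta>)"
  have c: "0 \<le> c" using \<theta> by (simp add: c_def)
  define R where "R J \<tau> = 2 * J + (2 * ((2 - 2 * \<theta>) * J) + 2 * \<tau> powr (2 - 2 * \<theta>)) * c" for J \<tau> :: real
  have J: "(\<lambda>n. enn2real (interp_near_0 u (1 / real (Suc n)))) \<longlonglongrightarrow> 0"
    by (rule tendsto_enn2real) (use interp_near_0_tendsto[OF u] in simp_all)
  have "(\<lambda>n. (1 / real (Suc n)) powr (2 - 2 * \<theta>)) \<longlonglongrightarrow> 0"
    using tendsto_powr'[of "\<lambda>n. 1 / real (Suc n)" 0 sequentially "\<lambda>_. 2 - 2 * \<theta>" "2 - 2 * \<theta>"]
      LIMSEQ_inverse_real_of_nat \<theta> by (simp add: inverse_eq_divide)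
  then have "(\<lambda>n. R (enn2real (interp_near_0 u (1 / real (Suc n)))) (1 / real (Suc n)))
      \<longlonglongrightarrow> 2 * 0 + (2 * ((2 - 2 * \<theta>) * 0) + 2 * 0) * c"
    unfolding R_def by (intro tendsto_intros J)
  then have "(\<lambda>n. R (enn2real (interp_near_0 u (1 / real (Suc n)))) (1 / real (Suc n))) \<longlonglongrightarrow> 0" by simp
  then have "\<forall>\<^sub>F n in sequentially. R (enn2real (interp_near_0 u (1 / real (Suc n)))) (1 / real (Suc n)) < (\<epsilon> / 2)\<^sup>2"
    using \<open>0 < \<epsilon>\<close> by (intro order_tendstoD(2)) auto
  then obtain n where n: "R (enn2real (interp_near_0 u (1 / real (Suc n)))) (1 / real (Suc n)) < (\<epsilon> / 2)\<^sup>2"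
    using eventually_happens by fastforce
  define \<tau> where "\<tau> = 1 / real (Suc n)"
  have \<tau>: "0 < \<tau>" by (simp add: \<tau>_def)
  define J where "J = enn2real (interp_near_0 u \<tau>)"
  have J_eq: "interp_near_0 u \<tau> = ennreal J" and J0: "0 \<le> J"
    using interp_near_0_finite[OF u, of \<tau>] by (simp_all add: J_def)
  \<comment> \<open>The infimum need not be attained, so some slack is required; a slack of
    \<open>\<tau>\<close> contributes \<tau>^(2 - 2\<theta>) after weighting, which tends to
    0.\<close>
  define m where "m = K \<tau> u + \<tau>"
  have "K \<tau> u < m" using \<tau> by (simp add: m_def)
  then obtain a b where ab: "a \<in> carrier X" "b \<in> carrier Y" "u = a + b" "cost \<tau> a b < m"
    using K_approx[OF uX] by metis
  have bX: "b \<in> carrier X" using ab(2) Y_sub by blast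
  have m0: "0 \<le> m" using K_nonneg[OF uX, of \<tau>] \<tau> by (simp add: m_def)
  have "seminorm X a \<le> cost \<tau> a b" by (rule real_le_rsqrt) simp
  then have Na: "seminorm X a \<le> m" using ab(4) by linarith
  have "\<tau> * seminorm Y b \<le> cost \<tau> a b" by (rule real_le_rsqrt) (simp add: power_mult_distrib)
  then have Nb: "seminorm Y b \<le> m / \<tau>" using ab(4) \<tau> by (simp add: field_simps)
  have aX_eq: "a = u + (\<lambda>e x. (-1) * b e x)" unfolding ab(3) by (simp add: fun_eq_iff)
  have "interp_nn X Y \<theta> a \<le> ennreal 2 * interp_near_0 u \<tau> +
    ennreal (2 * (m / \<tau>)\<^sup>2 * (\<tau> powr (2 - 2 * \<theta>) / (2 - 2 * \<theta>)) + m\<^sup>2 * (\<tau> powr (- 2 * \<theta>) / (2 * \<theta>)))"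
  proof (rule interp_nn_le[OF uX \<tau>])
    fix t :: real assume t: "0 < t" "t < \<tau>"
    have "K t a \<le> K t u + K t (\<lambda>e x. (-1) * b e x)"
      using K_add[OF uX quasi_normed_cmult[OF X bX], of t "-1"] unfolding aX_eq[symmetric] .
    also have "K t (\<lambda>e x. (-1) * b e x) \<le> \<bar>-1\<bar> * K t b" by (rule K_cmult[OF bX])
    also have "\<dots> \<le> t * seminorm Y b" using K_le_Y[OF ab(2), of t] t by simp
    also have "\<dots> \<le> t * (m / \<tau>)" using Nb t by (intro mult_left_mono) auto
    finally have "K t a \<le> K t u + t * (m / \<tau>)" by simp
    then have "(K t a)\<^sup>2 \<le> (K t u + t * (m / \<tau>))\<^sup>2" by (rule power_mono[OF _ K_nonneg[OF ab(1)]])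
    also have "\<dots> \<le> 2 * (K t u)\<^sup>2 + 2 * (t * (m / \<tau>))\<^sup>2"
      using sum_squares_bound[of "K t u" "t * (m / \<tau>)"] unfolding power2_sum by linarith
    also have "2 * (t * (m / \<tau>))\<^sup>2 = 2 * (m / \<tau>)\<^sup>2 * t\<^sup>2"
      by (simp only: power_mult_distrib mult_ac)
    finally show "(K t a)\<^sup>2 \<le> 2 * (K t u)\<^sup>2 + 2 * (m / \<tau>)\<^sup>2 * t\<^sup>2" .
  next
    show "(K t a)\<^sup>2 \<le> m\<^sup>2" for t
      by (rule power_mono[OF order_trans[OF K_le_X[OF ab(1)] Na] K_nonneg[OF ab(1)]])
  qed auto
  also have "2 * (m / \<tau>)\<^sup>2 * (\<tau> powr (2 - 2 * \<theta>) / (2 - 2 * \<theta>)) + m\<^sup>2 * (\<tau> powr (- 2 * \<theta>) / (2 * \<theta>))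
      = (m\<^sup>2 * \<tau> powr (- 2 * \<theta>)) * c"
  proof -
    have "\<tau> powr (2 - 2 * \<theta>) = \<tau>\<^sup>2 * \<tau> powr (- 2 * \<theta>)"
      using \<tau> powr_add[of \<tau> 2 "- 2 * \<theta>"] by simp
    then have "2 * (m / \<tau>)\<^sup>2 * (\<tau> powr (2 - 2 * \<theta>) / (2 - 2 * \<theta>))
        = m\<^sup>2 * \<tau> powr (- 2 * \<theta>) * (2 / (2 - 2 * \<theta>))"
      using \<tau> by (simp add: power_divide)
    then show ?thesis unfolding c_def by (simp add: distrib_left)
  qed
  also have "ennreal 2 * interp_near_0 u \<tau> + ennreal ((m\<^sup>2 * \<tau> powr (- 2 * \<theta>)) * c) =
      ennreal (2 * J + (m\<^sup>2 * \<tau> powr (- 2 * \<theta>)) * c)"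
    unfolding J_eq using J0 c by (simp add: ennreal_plus ennreal_mult del: ennreal_numeral)
  also have "\<dots> \<le> ennreal (R J \<tau>)"
  proof (rule ennreal_leI)
    have "m\<^sup>2 \<le> 2 * (K \<tau> u)\<^sup>2 + 2 * \<tau>\<^sup>2"
      using sum_squares_bound[of "K \<tau> u" \<tau>] unfolding m_def power2_sum by linarith
    then have "m\<^sup>2 * \<tau> powr (- 2 * \<theta>) \<le> (2 * (K \<tau> u)\<^sup>2 + 2 * \<tau>\<^sup>2) * \<tau> powr (- 2 * \<theta>)"
      by (rule mult_right_mono) simp
    also have "\<dots> = 2 * ((K \<tau> u)\<^sup>2 * \<tau> powr (- 2 * \<theta>)) + 2 * (\<tau>\<^sup>2 * \<tau> powr (- 2 * \<theta>))"
      by (simp add: algebra_simps)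
    also have "\<dots> \<le> 2 * ((2 - 2 * \<theta>) * J) + 2 * \<tau> powr (2 - 2 * \<theta>)"
      using K_le_interp_near_0[OF u \<tau>] \<tau> powr_add[of \<tau> 2 "- 2 * \<theta>"] unfolding J_def[symmetric] by simp
    finally show "2 * J + (m\<^sup>2 * \<tau> powr (- 2 * \<theta>)) * c \<le> R J \<tau>"
      unfolding R_def using c by (intro add_left_mono mult_right_mono)
  qed
  also have "\<dots> \<le> ennreal ((\<epsilon> / 2)\<^sup>2)"
    using n unfolding \<tau>_def[symmetric] J_def[symmetric] by (intro ennreal_leI) simp
  finally have "interp_nn X Y \<theta> a \<le> ennreal ((\<epsilon> / 2)\<^sup>2)" .
  from interp_nn_leD(2)[OF ab(1) this] \<open>0 < \<epsilon>\<close> have "seminorm Z a < \<epsilon>" by simp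
  moreover have "u - b = a" unfolding ab(3) by simp
  ultimately show thesis using that ab(2) by metis
qed

lemma Y_subset_interp: "carrier Y \<subseteq> carrier Z"
proof
  fix v assume "v \<in> carrier Y"
  then show "v \<in> carrier Z" by (rule_tac Y_interp) blast
qed

lemma quasi_normed_interp: "quasi_normed 2 Z"
proof -
  have "0 \<in> carrier Z" using quasi_normed_zero[OF Y] Y_subset_interp by blast
  then show ?thesis
    unfolding quasi_normed_def
    by (intro conjI ballI allI interp_seminorm_nonneg interp_add interp_cmult)
qed

text \<open>Approximation first by an element of \<open>Y\<close> and then inside \<open>Y\<close>;
  the triangle inequality of \<open>Z\<close> loses a factor 2, so each error is kept below
  \<epsilon>/4.\<close>

theorem dense_interp:
  assumes D: "D \<subseteq> carrier Y" "\<And>v \<delta>. v \<in> carrier Y \<Longrightarrow> 0 < \<delta> \<Longrightarrow> \<exists>d\<in>D. seminorm Y (v - d) < \<delta>"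
    and u: "u \<in> carrier Z" and "0 < \<epsilon>"
  shows "\<exists>d\<in>D. seminorm Z (u - d) < \<epsilon>"
proof -
  let ?N = "seminorm Z"
  obtain C where C: "0 \<le> C" "\<And>v. v \<in> carrier Y \<Longrightarrow> v \<in> carrier Z"
    "\<And>v. v \<in> carrier Y \<Longrightarrow> ?N v \<le> C * seminorm Y v"
    using Y_interp by metis
  obtain b where b: "b \<in> carrier Y" "?N (u - b) < \<epsilon> / 4"
    using Y_dense_interp[OF u, of "\<epsilon> / 4"] \<open>0 < \<epsilon>\<close> by auto
  obtain d where d: "d \<in> D" "seminorm Y (b - d) < \<epsilon> / (4 * (C + 1))"
    using D(2)[OF b(1), of "\<epsilon> / (4 * (C + 1))"] \<open>0 < \<epsilon>\<close> C(1) by auto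
  have bd: "b - d \<in> carrier Y" using b(1) d(1) D(1) by (intro quasi_normed_diff[OF Y]) auto
  have "?N (b - d) \<le> C * seminorm Y (b - d)" by (rule C(3)[OF bd])
  also have "\<dots> \<le> (C + 1) * seminorm Y (b - d)"
    by (rule mult_right_mono) (use quasi_normed_nonneg[OF Y bd] in auto)
  also have "\<dots> < \<epsilon> / 4" using d(2) C(1) by (simp add: field_simps)
  finally have *: "?N (b - d) < \<epsilon> / 4" .
  have "?N ((u - b) + (b - d)) \<le> 2 * (?N (u - b) + ?N (b - d))"
    by (intro interp_add(2) C(2)[OF bd] quasi_normed_diff[OF quasi_normed_interp] u C(2)[OF b(1)])
  also have "\<dots> < \<epsilon>" using * b(2) by simp
  also have "(u - b) + (b - d) = u - d" by simp
  finally show ?thesis using d(1) by blast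
qed

end

section \<open>Traces on an interval\<close>

text \<open>The telescoping series is dominated by a geometric one. The ratio will be 2^(-1/2) on
  H^1 and 2^(1/2 - s) for s < 1, so that \<open>\<rho> < 1\<close> expresses s > 1/2.\<close>

lemma geometric_increments:
  fixes a :: "nat \<Rightarrow> real"
  assumes "0 \<le> \<rho>" "\<rho> < 1" "\<And>j. \<bar>a (Suc j) - a j\<bar> \<le> c * \<rho> ^ j"
  shows "convergent a" "\<bar>lim a\<bar> \<le> \<bar>a 0\<bar> + c / (1 - \<rho>)"
proof -
  have geo: "(\<lambda>j. c * \<rho> ^ j) sums (c * (1 / (1 - \<rho>)))"
    using assms by (intro sums_mult geometric_sums) simp
  have sm: "summable (\<lambda>j. a (Suc j) - a j)"
    by (rule summable_comparison_test'[OF sums_summable[OF geo], of 0]) (use assms(3) in simp)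
  have "(\<lambda>n. \<Sum>j<n. a (Suc j) - a j) \<longlonglongrightarrow> suminf (\<lambda>j. a (Suc j) - a j)"
    by (rule summable_LIMSEQ[OF sm])
  then have "(\<lambda>n. a n - a 0) \<longlonglongrightarrow> suminf (\<lambda>j. a (Suc j) - a j)"
    by (simp add: sum_lessThan_telescope)
  from tendsto_add[OF this tendsto_const[of "a 0"]]
  have lim: "a \<longlonglongrightarrow> suminf (\<lambda>j. a (Suc j) - a j) + a 0" by simp
  then show "convergent a" by (rule convergentI)
  have sm': "summable (\<lambda>j. norm (a (Suc j) - a j))"
    by (rule summable_comparison_test'[OF sums_summable[OF geo], of 0]) (use assms(3) in simp)
  have "\<bar>suminf (\<lambda>j. a (Suc j) - a j)\<bar> \<le> suminf (\<lambda>j. norm (a (Suc j) - a j))"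
    using summable_norm[OF sm'] by simp
  also have "\<dots> \<le> suminf (\<lambda>j. c * \<rho> ^ j)"
    by (rule suminf_le[OF _ sm' sums_summable[OF geo]]) (use assms(3) in simp)
  also have "\<dots> = c / (1 - \<rho>)" using sums_unique[OF geo] by simp
  finally show "\<bar>lim a\<bar> \<le> \<bar>a 0\<bar> + c / (1 - \<rho>)"
    using limI[OF lim] by simp
qed

text \<open>Defined for arbitrary functions; where the averages diverge, \<open>lim\<close> carries
  no information, hence the convergence hypotheses in the linearity lemmas.\<close>

definition interval_trace :: "real \<Rightarrow> edge_end \<Rightarrow> (real \<Rightarrow> real) \<Rightarrow> real" where
  "interval_trace l b u = lim (\<lambda>j. trace_approx l b j u)"

lemma interval_trace_continuous:
  assumes "0 < l" "continuous_on {0..l} u"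
  shows "interval_trace l b u = u (end_pos l b)"
  unfolding interval_trace_def by (rule limI[OF trace_kernel_tendsto[OF assms]])

lemma trace_approx_add:
  assumes "0 < l" "u \<in> L2_interval l" "v \<in> L2_interval l"
  shows "trace_approx l b j (\<lambda>x. u x + v x) = trace_approx l b j u + trace_approx l b j v"
  by (rule inner_L2_add_left[OF assms(2,3) test_fun_L2[OF trace_kernel_test_fun[OF assms(1)]]])

lemma interval_trace_add:
  assumes "0 < l" "u \<in> L2_interval l" "v \<in> L2_interval l"
    and "convergent (\<lambda>j. trace_approx l b j u)" "convergent (\<lambda>j. trace_approx l b j v)"
  shows "interval_trace l b (\<lambda>x. u x + v x) = interval_trace l b u + interval_trace l b v"
proof -
  have "(\<lambda>j. trace_approx l b j u + trace_approx l b j v) \<longlonglongrightarrow> interval_trace l b u + interval_trace l b v"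
    unfolding interval_trace_def using assms(4,5) by (intro tendsto_add) (simp_all add: convergent_LIMSEQ_iff)
  then show ?thesis
    unfolding interval_trace_def[of l b "\<lambda>x. u x + v x"] trace_approx_add[OF assms(1-3)] by (rule limI)
qed

lemma interval_trace_cmult:
  assumes "convergent (\<lambda>j. trace_approx l b j u)"
  shows "interval_trace l b (\<lambda>x. c * u x) = c * interval_trace l b u"
proof -
  have "(\<lambda>j. c * trace_approx l b j u) \<longlonglongrightarrow> c * interval_trace l b u"
    unfolding interval_trace_def using assms by (intro tendsto_mult_left) (simp add: convergent_LIMSEQ_iff)
  then show ?thesis
    unfolding interval_trace_def[of l b "\<lambda>x. c * u x"] inner_L2_cmult_left by (rule limI)
qed

text \<open>Averages do not see null sets. This connects the trace of a member of
  \<open>HtC_int\<close> with the end values of its continuous representative.\<close>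

lemma interval_trace_cong_AE:
  assumes "0 < l" "u \<in> L2_interval l" "v \<in> L2_interval l" "AE x in lebesgue_on {0..l}. u x = v x"
  shows "interval_trace l b u = interval_trace l b v"
proof -
  have "trace_approx l b j u = trace_approx l b j v" for j
  proof (rule integral_cong_AE)
    have "trace_kernel l b j \<in> borel_measurable (lebesgue_on {0..l})"
      by (intro L2_interval_measurable test_fun_L2 trace_kernel_test_fun assms)
    then show "(\<lambda>x. u x * trace_kernel l b j x) \<in> borel_measurable (lebesgue_on {0..l})"
      "(\<lambda>x. v x * trace_kernel l b j x) \<in> borel_measurable (lebesgue_on {0..l})"
      using assms(2,3)[THEN L2_interval_measurable] by (simp_all only: borel_measurable_times)
  qed (use assms(4) in \<open>auto elim!: eventually_mono\<close>)
  then show ?thesis by (simp add: interval_trace_def)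
qed

lemma sqrt2_inverse: "0 \<le> 1 / sqrt 2" "1 / sqrt 2 < (1::real)"
  by simp_all

lemma interval_trace_H1:
  assumes "0 < l"
  obtains C where "0 \<le> C"
    "\<And>u. u \<in> H_interval 1 l \<Longrightarrow> convergent (\<lambda>j. trace_approx l b j u)"
    "\<And>u. u \<in> H_interval 1 l \<Longrightarrow> \<bar>interval_trace l b u\<bar> \<le> C * H_norm_interval 1 l u"
proof -
  obtain C where C: "0 \<le> C"
    "\<And>u. u \<in> L2_interval l \<Longrightarrow> \<bar>trace_approx l b 0 u\<bar> \<le> C * L2_norm_interval l u"
    "\<And>u j. u \<in> L2_interval l \<Longrightarrow>
       trace_jump l b j u \<le> C * sqrt 2 ^ j * L2_norm_interval l u"
    "\<And>u j. u \<in> H_interval 1 l \<Longrightarrow>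
       trace_jump l b j u \<le> C / sqrt 2 ^ j * H_norm_interval 1 l u"
    by (rule trace_approx_bounds[OF assms, of b]) (rule that)
  have inc: "trace_jump l b j u
      \<le> (C * H_norm_interval 1 l u) * (1 / sqrt 2) ^ j" if "u \<in> H_interval 1 l" for u j
    using C(4)[OF that, of j] by (simp add: power_one_over mult_ac)
  define C' where "C' = C + C / (1 - 1 / sqrt 2)"
  show thesis
  proof (rule that[of C'])
    show "0 \<le> C'" unfolding C'_def using C(1) by (intro add_nonneg_nonneg divide_nonneg_nonneg) simp_all
    fix u assume u: "u \<in> H_interval 1 l"
    show "convergent (\<lambda>j. trace_approx l b j u)"
      by (rule geometric_increments(1)[OF sqrt2_inverse inc[OF u]])
    have "\<bar>interval_trace l b u\<bar> \<le> \<bar>trace_approx l b 0 u\<bar> + C * H_norm_interval 1 l u / (1 - 1 / sqrt 2)"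
      unfolding interval_trace_def by (rule geometric_increments(2)[OF sqrt2_inverse inc[OF u]])
    also have "\<bar>trace_approx l b 0 u\<bar> \<le> C * H_norm_interval 1 l u"
      using C(2)[OF H_interval_L2[OF u]] L2_norm_le_H_norm[OF _ H_interval_L2[OF u], of 1] assms C(1)
      by (meson less_imp_le mult_left_mono order_trans)
    finally show "\<bar>interval_trace l b u\<bar> \<le> C' * H_norm_interval 1 l u"
      by (simp add: C'_def distrib_right)
  qed
qed

text \<open>The trace is bounded on H^1, so a polynomial close to \<open>f\<close> has nearly the
  right end values. The affine polynomial that interpolates the two defects is small in the norm of
  order \<open>r\<close>, and adding it makes the end values exact.\<close>

theorem H_interval_polynomial_dense_trace:
  assumes l: "0 < l" and f: "f \<in> H_interval r l" and r: "1 \<le> r" and "0 < \<epsilon>"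
  shows "\<exists>p. H_norm_interval r l (\<lambda>x. f x - poly p x) < \<epsilon> \<and>
    (\<forall>b. poly p (end_pos l b) = interval_trace l b f)"
proof -
  have sub: "H_interval r l \<subseteq> H_interval 1 l" by (rule H_interval_mono[OF r])
  obtain C0 where C0: "0 \<le> C0"
    "\<And>u. u \<in> H_interval 1 l \<Longrightarrow> convergent (\<lambda>j. trace_approx l Initial j u)"
    "\<And>u. u \<in> H_interval 1 l \<Longrightarrow> \<bar>interval_trace l Initial u\<bar> \<le> C0 * H_norm_interval 1 l u"
    by (rule interval_trace_H1[OF l, of Initial]) (rule that)
  obtain C1 where C1: "0 \<le> C1"
    "\<And>u. u \<in> H_interval 1 l \<Longrightarrow> convergent (\<lambda>j. trace_approx l Terminal j u)"
    "\<And>u. u \<in> H_interval 1 l \<Longrightarrow> \<bar>interval_trace l Terminal u\<bar> \<le> C1 * H_norm_interval 1 l u"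
    by (rule interval_trace_H1[OF l, of Terminal]) (rule that)
  have conv: "convergent (\<lambda>j. trace_approx l b j u)" if "u \<in> H_interval 1 l" for b u
    using C0(2)[OF that] C1(2)[OF that] by (cases b) auto
  let ?H = "H_norm_interval r l"
  \<comment> \<open>\<open>E\<close> bounds the norm of the affine corrector relative to that of the
    error: its coefficients \<open>\<alpha>\<close> and \<open>(\<beta> - \<alpha>) / l\<close> are
    controlled by the two trace constants.\<close>
  define E where "E = C0 * ?H (\<lambda>x. 1) + (C0 + C1) / l * ?H (\<lambda>x. x)"
  have E: "0 \<le> E" unfolding E_def using C0(1) C1(1) l by (simp add: H_norm_nonneg)
  define \<delta> where "\<delta> = \<epsilon> / (1 + E)"
  have \<delta>: "0 < \<delta>" using \<open>0 < \<epsilon>\<close> E by (simp add: \<delta>_def)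
  obtain p0 where p0: "?H (\<lambda>x. f x - poly p0 x) < \<delta>"
    using H_interval_polynomial_dense[OF l f \<delta>] by blast
  define g where "g = (\<lambda>x. f x - poly p0 x)"
  have gH: "g \<in> H_interval r l" unfolding g_def by (intro H_interval_diff f poly_in_H_interval l)
  have g1: "g \<in> H_interval 1 l" using gH sub by blast
  have Hle: "H_norm_interval 1 l g \<le> ?H g" by (rule H_norm_mono[OF r])
  define \<alpha> where "\<alpha> = interval_trace l Initial g"
  define \<beta> where "\<beta> = interval_trace l Terminal g"
  have \<alpha>: "\<bar>\<alpha>\<bar> \<le> C0 * ?H g" unfolding \<alpha>_def
    using C0(3)[OF g1] mult_left_mono[OF Hle C0(1)] by linarith
  have \<beta>: "\<bar>\<beta>\<bar> \<le> C1 * ?H g" unfolding \<beta>_def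
    using C1(3)[OF g1] mult_left_mono[OF Hle C1(1)] by linarith
  define q where "q = [:\<alpha>, (\<beta> - \<alpha>) / l:]"
  have "poly [:1:] = (\<lambda>x. 1 :: real)" "poly [:0, 1:] = (\<lambda>x. x :: real)" by (simp_all add: fun_eq_iff)
  then have one: "(\<lambda>x. 1) \<in> H_interval r l" and idH: "(\<lambda>x. x) \<in> H_interval r l"
    using poly_in_H_interval[OF l, of "[:1:]" r] poly_in_H_interval[OF l, of "[:0, 1:]" r] by metis+
  have "?H (poly q) = ?H (\<lambda>x. \<alpha> * 1 + (\<beta> - \<alpha>) / l * x)"
    by (rule arg_cong[where f = ?H]) (auto simp: q_def fun_eq_iff mult.commute)
  also have "\<dots> \<le> ?H (\<lambda>x. \<alpha> * 1) + ?H (\<lambda>x. (\<beta> - \<alpha>) / l * x)"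
    using l by (intro H_norm_triangle H_interval_cmult one idH) simp
  also have "\<dots> = \<bar>\<alpha>\<bar> * ?H (\<lambda>x. 1) + \<bar>(\<beta> - \<alpha>) / l\<bar> * ?H (\<lambda>x. x)"
    using H_norm_cmult[OF _ one, of \<alpha>] H_norm_cmult[OF _ idH, of "(\<beta> - \<alpha>) / l"] l by simp
  also have "\<dots> \<le> (C0 * ?H g) * ?H (\<lambda>x. 1) + ((C1 * ?H g + C0 * ?H g) / l) * ?H (\<lambda>x. x)"
  proof (intro add_mono mult_right_mono H_norm_nonneg \<alpha>)
    have "\<bar>\<beta> - \<alpha>\<bar> \<le> C1 * ?H g + C0 * ?H g" using \<alpha> \<beta> by linarith
    then show "\<bar>(\<beta> - \<alpha>) / l\<bar> \<le> (C1 * ?H g + C0 * ?H g) / l"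
      using l by (simp add: divide_right_mono)
  qed
  also have "\<dots> = E * ?H g" unfolding E_def by (simp add: algebra_simps add_divide_distrib)
  finally have Hq: "?H (poly q) \<le> E * ?H g" .
  have qH: "poly q \<in> H_interval r l" by (rule poly_in_H_interval[OF l])
  have "?H (\<lambda>x. g x + (-1) * poly q x) \<le> ?H g + ?H (\<lambda>x. (-1) * poly q x)"
    using l by (intro H_norm_triangle gH H_interval_cmult qH) simp
  also have "?H (\<lambda>x. (-1) * poly q x) = ?H (poly q)"
    using H_norm_cmult[OF _ qH, of "-1"] l by simp
  also have "?H g + ?H (poly q) \<le> (1 + E) * ?H g" using Hq by (simp add: distrib_right)
  also have "\<dots> < (1 + E) * \<delta>" using p0 E unfolding g_def by (intro mult_strict_left_mono) auto
  also have "\<dots> = \<epsilon>" using E by (simp add: \<delta>_def)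
  also have "(\<lambda>x. g x + (-1) * poly q x) = (\<lambda>x. f x - poly (p0 + q) x)"
    by (simp add: g_def fun_eq_iff)
  finally have small: "?H (\<lambda>x. f x - poly (p0 + q) x) < \<epsilon>" .
  have "poly (p0 + q) (end_pos l b) = interval_trace l b f" for b
  proof -
    have "interval_trace l b f = interval_trace l b (\<lambda>x. g x + poly p0 x)"
      by (simp add: g_def)
    also have "\<dots> = interval_trace l b g + interval_trace l b (poly p0)"
      by (intro interval_trace_add l H_interval_L2[OF g1] L2_interval_poly conv g1 poly_in_H_interval)
    also have "interval_trace l b (poly p0) = poly p0 (end_pos l b)"
      by (intro interval_trace_continuous l continuous_intros)
    also have "interval_trace l b g = poly q (end_pos l b)"
      using l by (cases b) (simp_all add: q_def \<alpha>_def \<beta>_def)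
    finally show ?thesis by simp
  qed
  with small show ?thesis by blast
qed

section \<open>Sobolev spaces on a graph\<close>

lemma edge_pt_ends:
  assumes "0 < len G e"
  shows "edge_pt G e 0 = Vertex (src G e)" "edge_pt G e (len G e) = Vertex (tgt G e)"
  using assms by (simp_all add: edge_pt_def)

lemma openin_graph_topology: "openin (graph_topology G) U \<longleftrightarrow> graph_open G U"
  unfolding graph_topology_def by (simp add: topology_inverse'[OF istopology_graph_open])

lemma edge_pt_in_points:
  assumes "compact_metric_graph G" "e \<in> edges G" "x \<in> {0..len G e}"
  shows "edge_pt G e x \<in> points G"
  using assms by (auto simp: compact_metric_graph_def edge_pt_def points_def)

lemma topspace_graph_topology:
  assumes "compact_metric_graph G"
  shows "topspace (graph_topology G) = points G"
proof -
  have "{x \<in> {0..len G e}. edge_pt G e x \<in> points G} = {0..len G e}" if "e \<in> edges G" for e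
    using edge_pt_in_points[OF assms that] by auto
  then have "graph_open G (points G)" by (simp add: graph_open_def)
  moreover have "U \<subseteq> points G" if "graph_open G U" for U using that by (simp add: graph_open_def)
  ultimately show ?thesis
    unfolding topspace_def openin_graph_topology by blast
qed

text \<open>A set is open in the quotient exactly if its preimage in every closed edge is, so
  continuity can be tested edge by edge; gluing remains only as the agreement of end values recorded
  by \<open>val\<close>.\<close>

theorem C_graph_iff:
  assumes G: "compact_metric_graph G"
  shows "u \<in> C_graph G \<longleftrightarrow> (\<exists>val. \<forall>e\<in>edges G. continuous_on {0..len G e} (u e) \<and>
    u e 0 = val (src G e) \<and> u e (len G e) = val (tgt G e))"
proof
  have len: "0 < len G e" if "e \<in> edges G" for e using G that by (simp add: compact_metric_graph_def)
  {
    assume "u \<in> C_graph G"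
    then obtain f where f: "continuous_map (graph_topology G) euclideanreal f"
      and u: "\<And>e x. e \<in> edges G \<Longrightarrow> x \<in> {0..len G e} \<Longrightarrow> u e x = f (edge_pt G e x)"
      unfolding C_graph_def by blast
    show "\<exists>val. \<forall>e\<in>edges G. continuous_on {0..len G e} (u e) \<and>
        u e 0 = val (src G e) \<and> u e (len G e) = val (tgt G e)"
    proof (intro exI[of _ "\<lambda>v. f (Vertex v)"] ballI conjI)
      fix e assume e: "e \<in> edges G"
      show "u e 0 = f (Vertex (src G e))" "u e (len G e) = f (Vertex (tgt G e))"
        using u[OF e] len[OF e] edge_pt_ends[of G e] by auto
      show "continuous_on {0..len G e} (u e)"
        unfolding continuous_on_open_invariant[of "{0..len G e}"] continuous_openin_preimage_eq
      proof (intro allI impI)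
        fix W :: "real set" assume "open W"
        then have "graph_open G {p \<in> points G. f p \<in> W}"
          using openin_continuous_map_preimage[OF f, of W]
          by (simp add: openin_graph_topology topspace_graph_topology[OF G])
        then have "openin (top_of_set {0..len G e})
            {x \<in> {0..len G e}. edge_pt G e x \<in> {p \<in> points G. f p \<in> W}}"
          using e by (simp add: graph_open_def)
        also have "{x \<in> {0..len G e}. edge_pt G e x \<in> {p \<in> points G. f p \<in> W}} = {0..len G e} \<inter> u e -` W"
          using u[OF e] edge_pt_in_points[OF G e] by auto
        finally show "openin (top_of_set {0..len G e}) ({0..len G e} \<inter> u e -` W)" .
      qed
    qed
  }
  {
    assume "\<exists>val. \<forall>e\<in>edges G. continuous_on {0..len G e} (u e) \<and>
        u e 0 = val (src G e) \<and> u e (len G e) = val (tgt G e)"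
    then obtain val where val: "\<And>e. e \<in> edges G \<Longrightarrow> continuous_on {0..len G e} (u e)"
      "\<And>e. e \<in> edges G \<Longrightarrow> u e 0 = val (src G e)"
      "\<And>e. e \<in> edges G \<Longrightarrow> u e (len G e) = val (tgt G e)" by blast
    define f where "f p = (case p of Vertex v \<Rightarrow> val v | Inner e x \<Rightarrow> u e x)" for p
    have fu: "f (edge_pt G e x) = u e x" if "e \<in> edges G" "x \<in> {0..len G e}" for e x
      using val(2,3)[OF that(1)] by (auto simp: f_def edge_pt_def)
    have "continuous_map (graph_topology G) euclideanreal f"
      unfolding continuous_map topspace_graph_topology[OF G] openin_graph_topology
    proof (intro conjI allI impI)
      fix W assume "openin euclideanreal W"
      then have W: "open W" by simp
      show "graph_open G {p \<in> points G. f p \<in> W}"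
        unfolding graph_open_def
      proof (intro conjI ballI)
        fix e assume e: "e \<in> edges G"
        have "openin (top_of_set {0..len G e}) ({0..len G e} \<inter> u e -` W)"
          using val(1)[OF e] W by (rule continuous_openin_preimage_gen)
        also have "{0..len G e} \<inter> u e -` W = {x \<in> {0..len G e}. edge_pt G e x \<in> {p \<in> points G. f p \<in> W}}"
          using fu[OF e] edge_pt_in_points[OF G e] by auto
        finally show "openin (top_of_set {0..len G e})
          {x \<in> {0..len G e}. edge_pt G e x \<in> {p \<in> points G. f p \<in> W}}" .
      qed auto
    qed simp
    then show "u \<in> C_graph G" unfolding C_graph_def using fu by fastforce
  }
qed

lemma C_graph_add:
  assumes "compact_metric_graph G" "u \<in> C_graph G" "v \<in> C_graph G"
  shows "u + v \<in> C_graph G"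
proof -
  obtain p q where
    "\<forall>e\<in>edges G. continuous_on {0..len G e} (u e) \<and> u e 0 = p (src G e) \<and> u e (len G e) = p (tgt G e)"
    "\<forall>e\<in>edges G. continuous_on {0..len G e} (v e) \<and> v e 0 = q (src G e) \<and> v e (len G e) = q (tgt G e)"
    using assms(2,3) unfolding C_graph_iff[OF assms(1)] by metis
  then show ?thesis
    unfolding C_graph_iff[OF assms(1)]
    by (intro exI[of _ "\<lambda>w. p w + q w"]) (simp add: plus_fun_def continuous_on_add)
qed

lemma C_graph_cmult:
  assumes "compact_metric_graph G" "u \<in> C_graph G"
  shows "(\<lambda>e x. c * u e x) \<in> C_graph G"
proof -
  obtain p where
    "\<forall>e\<in>edges G. continuous_on {0..len G e} (u e) \<and> u e 0 = p (src G e) \<and> u e (len G e) = p (tgt G e)"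
    using assms(2) unfolding C_graph_iff[OF assms(1)] by metis
  then show ?thesis
    unfolding C_graph_iff[OF assms(1)]
    by (intro exI[of _ "\<lambda>w. c * p w"]) (simp add: continuous_on_mult_left)
qed

lemma carrier_L2_graph: "u \<in> carrier (L2_graph G) \<longleftrightarrow> (\<forall>e\<in>edges G. u e \<in> L2_interval (len G e))"
  and carrier_Ht_int: "u \<in> carrier (Ht_int G r) \<longleftrightarrow> (\<forall>e\<in>edges G. u e \<in> H_interval r (len G e))"
  and carrier_HtC_int: "u \<in> carrier (HtC_int G r) \<longleftrightarrow> u \<in> carrier (Ht_int G r) \<and>
    (\<exists>w\<in>C_graph G. \<forall>e\<in>edges G. AE x in lebesgue_on {0..len G e}. u e x = w e x)"
  by (simp_all add: L2_graph_def Ht_int_def HtC_int_def)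

lemma seminorm_L2_graph: "seminorm (L2_graph G) u = L2_set (\<lambda>e. L2_norm_interval (len G e) (u e)) (edges G)"
  and seminorm_Ht_int: "seminorm (Ht_int G r) u = L2_set (\<lambda>e. H_norm_interval r (len G e) (u e)) (edges G)"
  and seminorm_HtC_int: "seminorm (HtC_int G r) = seminorm (Ht_int G r)"
  by (simp_all add: L2_graph_def Ht_int_def HtC_int_def L2_set_def)

lemma gfun_plus: "(u + v) e = (\<lambda>x. u e x + v e x)" for u v :: "'e gfun"
  by (simp add: fun_eq_iff)

text \<open>Stated for abstract edge spaces \<open>S\<close> and norms \<open>N\<close>, so that
  \<open>L2_graph\<close> and \<open>Ht_int\<close> are both instances.\<close>

lemma quasi_normed_L2_set:
  fixes S :: "'e \<Rightarrow> (real \<Rightarrow> real) set" and N :: "'e \<Rightarrow> (real \<Rightarrow> real) \<Rightarrow> real"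
  assumes nonneg: "\<And>e f. e \<in> E \<Longrightarrow> f \<in> S e \<Longrightarrow> 0 \<le> N e f"
    and zero: "\<And>e. e \<in> E \<Longrightarrow> (\<lambda>x. 0) \<in> S e"
    and add: "\<And>e f g. e \<in> E \<Longrightarrow> f \<in> S e \<Longrightarrow> g \<in> S e \<Longrightarrow> (\<lambda>x. f x + g x) \<in> S e"
    and triangle: "\<And>e f g. e \<in> E \<Longrightarrow> f \<in> S e \<Longrightarrow> g \<in> S e \<Longrightarrow> N e (\<lambda>x. f x + g x) \<le> N e f + N e g"
    and cmult: "\<And>e f c. e \<in> E \<Longrightarrow> f \<in> S e \<Longrightarrow> (\<lambda>x. c * f x) \<in> S e"
    and cmult_norm: "\<And>e f c. e \<in> E \<Longrightarrow> f \<in> S e \<Longrightarrow> N e (\<lambda>x. c * f x) = \<bar>c\<bar> * N e f"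
  shows "quasi_normed 1 ({u. \<forall>e\<in>E. u e \<in> S e}, \<lambda>u. L2_set (\<lambda>e. N e (u e)) E)"
  unfolding quasi_normed_def fst_conv snd_conv
proof (intro conjI ballI allI)
  show "0 \<in> {u. \<forall>e\<in>E. u e \<in> S e}" using zero by (simp add: zero_fun_def)
next
  fix u v assume u: "u \<in> {u. \<forall>e\<in>E. u e \<in> S e}" and v: "v \<in> {u. \<forall>e\<in>E. u e \<in> S e}"
  show "u + v \<in> {u. \<forall>e\<in>E. u e \<in> S e}" using u v add by (simp add: plus_fun_def)
  have "L2_set (\<lambda>e. N e ((u + v) e)) E \<le> L2_set (\<lambda>e. N e (u e) + N e (v e)) E"
  proof (rule L2_set_mono)
    fix e assume e: "e \<in> E"
    then have "u e \<in> S e" "v e \<in> S e" using u v by auto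
    then show "N e ((u + v) e) \<le> N e (u e) + N e (v e)" "0 \<le> N e ((u + v) e)"
      unfolding gfun_plus using triangle[OF e] nonneg[OF e add[OF e]] by auto
  qed
  also have "\<dots> \<le> L2_set (\<lambda>e. N e (u e)) E + L2_set (\<lambda>e. N e (v e)) E"
    by (rule L2_set_triangle_ineq)
  finally show "L2_set (\<lambda>e. N e ((u + v) e)) E
      \<le> 1 * (L2_set (\<lambda>e. N e (u e)) E + L2_set (\<lambda>e. N e (v e)) E)" by simp
next
  fix c u assume u: "u \<in> {u. \<forall>e\<in>E. u e \<in> S e}"
  then show "(\<lambda>e x. c * u e x) \<in> {u. \<forall>e\<in>E. u e \<in> S e}" using cmult by simp
  have "L2_set (\<lambda>e. N e (\<lambda>x. c * u e x)) E = L2_set (\<lambda>e. \<bar>c\<bar> * N e (u e)) E"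
    by (rule L2_set_cong) (use u cmult_norm in auto)
  then show "L2_set (\<lambda>e. N e (\<lambda>x. c * u e x)) E \<le> \<bar>c\<bar> * L2_set (\<lambda>e. N e (u e)) E"
    by (simp add: L2_set_right_distrib)
qed simp

locale metric_graph =
  fixes G :: "('v, 'e) metric_graph"
  assumes G: "compact_metric_graph G"
begin

section \<open>Seminorms and embeddings on a graph\<close>

lemma len_pos: "e \<in> edges G \<Longrightarrow> 0 < len G e"
  and finite_edges: "finite (edges G)"
  using G by (simp_all add: compact_metric_graph_def)

lemma finite_edge_ends: "finite (edge_ends G)"
  using finite_edges by (simp add: edge_ends_def)

lemma quasi_normed_L2_graph: "quasi_normed 1 (L2_graph G)"
proof -
  have "quasi_normed 1 ({u. \<forall>e\<in>edges G. u e \<in> L2_interval (len G e)},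
      \<lambda>u. L2_set (\<lambda>e. L2_norm_interval (len G e) (u e)) (edges G))"
    by (rule quasi_normed_L2_set)
      (auto intro: L2_norm_nonneg L2_interval_const L2_interval_add L2_norm_triangle L2_interval_cmult L2_norm_cmult)
  then show ?thesis by (simp add: L2_graph_def L2_set_def)
qed

lemma quasi_normed_Ht_int: "quasi_normed 1 (Ht_int G r)"
proof -
  have "quasi_normed 1 ({u. \<forall>e\<in>edges G. u e \<in> H_interval r (len G e)},
      \<lambda>u. L2_set (\<lambda>e. H_norm_interval r (len G e) (u e)) (edges G))"
  proof (rule quasi_normed_L2_set)
    fix e assume e: "e \<in> edges G"
    show "(\<lambda>x. 0) \<in> H_interval r (len G e)"
      using H_interval_cmult[OF poly_in_H_interval[OF len_pos[OF e], of 0 r], of 0] by simp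
  qed (auto intro: H_norm_nonneg H_interval_add H_norm_triangle H_interval_cmult H_norm_cmult less_imp_le[OF len_pos])
  then show ?thesis by (simp add: Ht_int_def L2_set_def)
qed

text \<open>The seminorm is inherited from \<open>Ht_int\<close>; new is only the closure of the
  carrier, for which sums and multiples of the continuous representatives serve.\<close>

lemma quasi_normed_HtC_int: "quasi_normed 1 (HtC_int G r)"
proof -
  note base = quasi_normed_Ht_int[of r]
  have sub: "u \<in> carrier (Ht_int G r)" if "u \<in> carrier (HtC_int G r)" for u
    using that by (simp add: carrier_HtC_int)
  have C0: "\<exists>w\<in>C_graph G. \<forall>e\<in>edges G. AE x in lebesgue_on {0..len G e}. (0 :: 'e gfun) e x = w e x"
  proof (rule bexI[of _ 0])
    show "0 \<in> C_graph G" unfolding C_graph_iff[OF G] by (intro exI[of _ "\<lambda>_. 0"]) (simp add: zero_fun_def)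
  qed simp
  have C_add: "\<exists>w\<in>C_graph G. \<forall>e\<in>edges G. AE x in lebesgue_on {0..len G e}. (u + v) e x = w e x"
    if uv: "u \<in> carrier (HtC_int G r)" "v \<in> carrier (HtC_int G r)" for u v
  proof -
    obtain w where w: "w \<in> C_graph G" "\<forall>e\<in>edges G. AE x in lebesgue_on {0..len G e}. u e x = w e x"
      using uv(1) unfolding carrier_HtC_int by blast
    obtain z where z: "z \<in> C_graph G" "\<forall>e\<in>edges G. AE x in lebesgue_on {0..len G e}. v e x = z e x"
      using uv(2) unfolding carrier_HtC_int by blast
    show ?thesis
    proof (intro bexI[of _ "w + z"] C_graph_add[OF G] ballI w(1) z(1))
      fix e assume e: "e \<in> edges G"
      show "AE x in lebesgue_on {0..len G e}. (u + v) e x = (w + z) e x"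
        using bspec[OF w(2) e] bspec[OF z(2) e] by eventually_elim simp
    qed
  qed
  have C_cmult: "\<exists>w\<in>C_graph G. \<forall>e\<in>edges G. AE x in lebesgue_on {0..len G e}. c * u e x = w e x"
    if u: "u \<in> carrier (HtC_int G r)" for c u
  proof -
    obtain w where w: "w \<in> C_graph G" "\<forall>e\<in>edges G. AE x in lebesgue_on {0..len G e}. u e x = w e x"
      using u unfolding carrier_HtC_int by blast
    show ?thesis
    proof (intro bexI[of _ "\<lambda>e x. c * w e x"] C_graph_cmult[OF G] ballI w(1))
      fix e assume e: "e \<in> edges G"
      show "AE x in lebesgue_on {0..len G e}. c * u e x = c * w e x"
        using bspec[OF w(2) e] by eventually_elim simp
    qed
  qed
  show ?thesis
    unfolding quasi_normed_def
  proof (intro conjI ballI allI)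
    show "0 \<in> carrier (HtC_int G r)"
      unfolding carrier_HtC_int by (rule conjI[OF quasi_normed_zero[OF base] C0])
    fix u assume u: "u \<in> carrier (HtC_int G r)"
    show "0 \<le> seminorm (HtC_int G r) u"
      unfolding seminorm_HtC_int by (rule quasi_normed_nonneg[OF base sub[OF u]])
    fix v assume v: "v \<in> carrier (HtC_int G r)"
    show "u + v \<in> carrier (HtC_int G r)"
      unfolding carrier_HtC_int by (rule conjI[OF quasi_normed_add[OF base sub[OF u] sub[OF v]] C_add[OF u v]])
    show "seminorm (HtC_int G r) (u + v) \<le> 1 * (seminorm (HtC_int G r) u + seminorm (HtC_int G r) v)"
      unfolding seminorm_HtC_int by (rule quasi_normed_triangle[OF base sub[OF u] sub[OF v]])
  next
    fix c u assume u: "u \<in> carrier (HtC_int G r)"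
    show "(\<lambda>e x. c * u e x) \<in> carrier (HtC_int G r)"
      unfolding carrier_HtC_int by (rule conjI[OF quasi_normed_cmult[OF base sub[OF u]] C_cmult[OF u]])
    show "seminorm (HtC_int G r) (\<lambda>e x. c * u e x) \<le> \<bar>c\<bar> * seminorm (HtC_int G r) u"
      unfolding seminorm_HtC_int by (rule quasi_normed_cmult_le[OF base sub[OF u]])
  qed
qed

lemma L2_norm_le_L2_graph:
  assumes "e \<in> edges G"
  shows "L2_norm_interval (len G e) (u e) \<le> seminorm (L2_graph G) u"
  unfolding seminorm_L2_graph by (rule member_le_L2_set[OF finite_edges assms])

lemma H_norm_le_Ht_int:
  assumes "e \<in> edges G"
  shows "H_norm_interval r (len G e) (u e) \<le> seminorm (Ht_int G r) u"
  unfolding seminorm_Ht_int by (rule member_le_L2_set[OF finite_edges assms])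

lemma Ht_int_subset_L2_graph: "carrier (Ht_int G r) \<subseteq> carrier (L2_graph G)"
  unfolding subset_iff carrier_Ht_int carrier_L2_graph using H_interval_L2 by blast

lemma L2_graph_le_Ht_int:
  assumes "u \<in> carrier (Ht_int G r)"
  shows "seminorm (L2_graph G) u \<le> seminorm (Ht_int G r) u"
  unfolding seminorm_L2_graph seminorm_Ht_int
  using assms less_imp_le[OF len_pos]
  by (intro L2_set_mono L2_norm_le_H_norm L2_norm_nonneg) (auto simp: carrier_Ht_int intro: H_interval_L2)

lemma Ht_int_mono:
  assumes "r \<le> r'"
  shows "carrier (Ht_int G r') \<subseteq> carrier (Ht_int G r)" "seminorm (Ht_int G r) u \<le> seminorm (Ht_int G r') u"
proof -
  show "carrier (Ht_int G r') \<subseteq> carrier (Ht_int G r)"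
    using H_interval_mono[OF assms] unfolding subset_iff carrier_Ht_int by blast
  show "seminorm (Ht_int G r) u \<le> seminorm (Ht_int G r') u"
    unfolding seminorm_Ht_int by (intro L2_set_mono H_norm_mono H_norm_nonneg assms)
qed

section \<open>Density of smooth functions on a graph\<close>

lemma C2_edges_subset_Ht_int:
  assumes "r \<le> 2"
  shows "C2_edges G \<subseteq> carrier (Ht_int G r)"
  using C2_interval_subset_H_interval[OF len_pos] H_interval_mono[OF assms]
  unfolding C2_edges_def by (fastforce simp: carrier_Ht_int)

lemma C_C2_subset_HtC_int:
  assumes "r \<le> 2"
  shows "C_graph G \<inter> C2_edges G \<subseteq> carrier (HtC_int G r)"
proof
  fix u assume u: "u \<in> C_graph G \<inter> C2_edges G"
  then have "\<exists>w\<in>C_graph G. \<forall>e\<in>edges G. AE x in lebesgue_on {0..len G e}. u e x = w e x"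
    by (intro bexI[of _ u]) auto
  with u C2_edges_subset_Ht_int[OF assms] show "u \<in> carrier (HtC_int G r)"
    unfolding carrier_HtC_int by blast
qed

text \<open>The Euclidean sum over the edges is at most the plain sum, so equal shares of \<delta>
  suffice; the added 1 in \<open>?n\<close> yields the strict inequality and covers a graph without
  edges.\<close>

lemma Ht_int_dense_trace:
  assumes u: "u \<in> carrier (Ht_int G r)" and r: "1 \<le> r" and "0 < \<delta>"
  shows "\<exists>d\<in>C2_edges G. seminorm (Ht_int G r) (u - d) < \<delta> \<and>
    (\<forall>e\<in>edges G. continuous_on {0..len G e} (d e) \<and>
      (\<forall>b. d e (end_pos (len G e) b) = interval_trace (len G e) b (u e)))"
proof -
  let ?n = "real (card (edges G)) + 1"
  have \<delta>': "0 < \<delta> / ?n" using \<open>0 < \<delta>\<close> by simp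
  have "\<forall>e\<in>edges G. \<exists>p. H_norm_interval r (len G e) (\<lambda>x. u e x - poly p x) < \<delta> / ?n \<and>
      (\<forall>b. poly p (end_pos (len G e) b) = interval_trace (len G e) b (u e))"
    using u by (intro ballI H_interval_polynomial_dense_trace len_pos r \<delta>') (auto simp: carrier_Ht_int)
  then obtain P where P: "\<And>e. e \<in> edges G \<Longrightarrow> H_norm_interval r (len G e) (\<lambda>x. u e x - poly (P e) x) < \<delta> / ?n"
    "\<And>e b. e \<in> edges G \<Longrightarrow> poly (P e) (end_pos (len G e) b) = interval_trace (len G e) b (u e)"
    by metis
  have "seminorm (Ht_int G r) (u - (\<lambda>e. poly (P e))) \<le>
      (\<Sum>e\<in>edges G. H_norm_interval r (len G e) (\<lambda>x. u e x - poly (P e) x))"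
    unfolding seminorm_Ht_int by (simp add: fun_diff_def L2_set_le_sum H_norm_nonneg)
  also have "\<dots> \<le> (\<Sum>e\<in>edges G. \<delta> / ?n)" by (intro sum_mono less_imp_le P(1))
  also have "\<dots> = real (card (edges G)) * (\<delta> / ?n)" by simp
  also have "\<dots> < ?n * (\<delta> / ?n)" using \<delta>' by (intro mult_strict_right_mono) auto
  also have "\<dots> = \<delta>" by simp
  finally show ?thesis
    by (intro bexI[of _ "\<lambda>e. poly (P e)"] conjI ballI allI P(2))
      (auto simp: C2_edges_def poly_in_C2_interval intro!: continuous_intros)
qed

lemma Ht_int_dense:
  assumes "u \<in> carrier (Ht_int G r)" "1 \<le> r" "0 < \<delta>"
  shows "\<exists>d\<in>C2_edges G. seminorm (Ht_int G r) (u - d) < \<delta>"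
  using Ht_int_dense_trace[OF assms] by blast

text \<open>The polynomials constructed above have the same traces as \<open>u\<close>, so they inherit its continuity
  at the vertices.\<close>

lemma HtC_int_dense:
  assumes u: "u \<in> carrier (HtC_int G r)" and r: "1 \<le> r" and "0 < \<delta>"
  shows "\<exists>d\<in>C_graph G \<inter> C2_edges G. seminorm (HtC_int G r) (u - d) < \<delta>"
proof -
  have uH: "u \<in> carrier (Ht_int G r)" using u by (simp add: carrier_HtC_int)
  obtain w where w: "w \<in> C_graph G" "\<And>e. e \<in> edges G \<Longrightarrow> AE x in lebesgue_on {0..len G e}. u e x = w e x"
    using u unfolding carrier_HtC_int by blast
  obtain val where val: "\<And>e. e \<in> edges G \<Longrightarrow> continuous_on {0..len G e} (w e)"
      "\<And>e. e \<in> edges G \<Longrightarrow> w e 0 = val (src G e)"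
      "\<And>e. e \<in> edges G \<Longrightarrow> w e (len G e) = val (tgt G e)"
    using w(1) unfolding C_graph_iff[OF G] by blast
  obtain d where d: "d \<in> C2_edges G" "seminorm (Ht_int G r) (u - d) < \<delta>"
    "\<And>e. e \<in> edges G \<Longrightarrow> continuous_on {0..len G e} (d e)"
    "\<And>e b. e \<in> edges G \<Longrightarrow> d e (end_pos (len G e) b) = interval_trace (len G e) b (u e)"
    using Ht_int_dense_trace[OF uH r \<open>0 < \<delta>\<close>] by blast
  \<comment> \<open>\<open>u\<close> and its continuous representative \<open>w\<close> have the
    same trace, and the trace of \<open>w\<close> consists of its end values, which agree at the
    vertices.\<close>
  have tr: "d e (end_pos (len G e) b) = w e (end_pos (len G e) b)" if e: "e \<in> edges G" for e b
  proof -
    have "interval_trace (len G e) b (u e) = interval_trace (len G e) b (w e)"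
    proof (rule interval_trace_cong_AE[OF len_pos[OF e] _ L2_interval_continuous[OF val(1)[OF e]] w(2)[OF e]])
      have "u e \<in> H_interval r (len G e)" using uH e by (simp add: carrier_Ht_int)
      then show "u e \<in> L2_interval (len G e)" by (rule H_interval_L2)
    qed
    then show ?thesis
      using d(4)[OF e] interval_trace_continuous[OF len_pos[OF e] val(1)[OF e]] by simp
  qed
  have "d \<in> C_graph G"
    unfolding C_graph_iff[OF G]
    using d(3) tr[of _ Initial] tr[of _ Terminal] val(2,3) by (intro exI[of _ val]) simp
  with d(1,2) show ?thesis unfolding seminorm_HtC_int by blast
qed

section \<open>Extension of the trace\<close>

text \<open>Boundedness is stated for the averages, not for their limit: this makes sense before the
  limit is known to exist, yields both its existence and its bound, and passes to continuously
  embedded spaces.\<close>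

definition trace_bound :: "'e gfun seminormed \<Rightarrow> 'e \<Rightarrow> edge_end \<Rightarrow> real \<Rightarrow> real \<Rightarrow> bool" where
  "trace_bound X e b C \<rho> \<longleftrightarrow> 0 \<le> \<rho> \<and> \<rho> < 1 \<and> (\<forall>u\<in>carrier X.
     \<bar>trace_approx (len G e) b 0 (u e)\<bar> \<le> C * seminorm X u \<and>
     (\<forall>j. trace_jump (len G e) b j (u e) \<le> C * \<rho> ^ j * seminorm X u))"

definition trace_bounded :: "'e gfun seminormed \<Rightarrow> bool" where
  "trace_bounded X \<longleftrightarrow> carrier X \<subseteq> carrier (L2_graph G) \<and>
     (\<forall>e\<in>edges G. \<forall>b. \<exists>C \<rho>. trace_bound X e b C \<rho>)"

lemma trace_boundD:
  assumes "trace_bound X e b C \<rho>"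
  shows "0 \<le> \<rho>" "\<rho> < 1"
    "u \<in> carrier X \<Longrightarrow> \<bar>trace_approx (len G e) b 0 (u e)\<bar> \<le> C * seminorm X u"
    "u \<in> carrier X \<Longrightarrow> trace_jump (len G e) b j (u e) \<le> C * \<rho> ^ j * seminorm X u"
  using assms unfolding trace_bound_def by blast+

lemma trace_bounded_limit:
  assumes X: "trace_bounded X" and e: "e \<in> edges G"
  obtains C where "\<And>u. u \<in> carrier X \<Longrightarrow> convergent (\<lambda>j. trace_approx (len G e) b j (u e))"
    "\<And>u. u \<in> carrier X \<Longrightarrow> \<bar>interval_trace (len G e) b (u e)\<bar> \<le> C * seminorm X u"
proof -
  obtain C \<rho> where C: "trace_bound X e b C \<rho>"
    using X e unfolding trace_bounded_def by blast
  have jump: "trace_jump (len G e) b j (u e) \<le> (C * seminorm X u) * \<rho> ^ j" if "u \<in> carrier X" for u j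
    using trace_boundD(4)[OF C that, of j] by (simp add: mult_ac)
  show thesis
  proof (rule that[of "C + C / (1 - \<rho>)"])
    fix u assume u: "u \<in> carrier X"
    note limit = geometric_increments[OF trace_boundD(1,2)[OF C] jump[OF u]]
    show "convergent (\<lambda>j. trace_approx (len G e) b j (u e))" by (rule limit(1))
    show "\<bar>interval_trace (len G e) b (u e)\<bar> \<le> (C + C / (1 - \<rho>)) * seminorm X u"
      using limit(2) trace_boundD(3)[OF C u] by (simp add: interval_trace_def distrib_right)
  qed
qed

definition graph_trace :: "'e gfun \<Rightarrow> 'e \<times> edge_end \<Rightarrow> real" where
  "graph_trace u = (\<lambda>(e, b). if e \<in> edges G then interval_trace (len G e) b (u e) else 0)"

lemma bounded_operator_graph_trace:
  assumes X: "quasi_normed 2 X" and tb: "trace_bounded X"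
  shows "bounded_operator G X (restrict graph_trace (carrier X))"
proof -
  have L2: "u e \<in> L2_interval (len G e)" if "u \<in> carrier X" "e \<in> edges G" for u e
    using tb that unfolding trace_bounded_def carrier_L2_graph[abs_def] by (auto simp: subset_iff carrier_L2_graph)
  have conv: "convergent (\<lambda>j. trace_approx (len G e) b j (u e))" if "u \<in> carrier X" "e \<in> edges G" for u e b
    by (rule trace_bounded_limit[OF tb that(2), of b]) (use that(1) in blast)
  have add: "graph_trace (u + v) = graph_trace u + graph_trace v" if "u \<in> carrier X" "v \<in> carrier X" for u v
    using that by (auto simp: graph_trace_def fun_eq_iff plus_fun_def intro!: interval_trace_add len_pos L2 conv)
  have cmult: "graph_trace (\<lambda>e x. c * u e x) = (\<lambda>i. c * graph_trace u i)" if "u \<in> carrier X" for c u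
    using that by (auto simp: graph_trace_def fun_eq_iff intro!: interval_trace_cmult conv)
  have "\<forall>i\<in>edge_ends G. \<exists>C. \<forall>u\<in>carrier X. \<bar>graph_trace u i\<bar> \<le> C * seminorm X u"
  proof
    fix i assume "i \<in> edge_ends G"
    then obtain e b where i: "i = (e, b)" "e \<in> edges G" by (auto simp: edge_ends_def)
    obtain C where "\<And>u. u \<in> carrier X \<Longrightarrow> convergent (\<lambda>j. trace_approx (len G e) b j (u e))"
      "\<And>u. u \<in> carrier X \<Longrightarrow> \<bar>interval_trace (len G e) b (u e)\<bar> \<le> C * seminorm X u"
      by (rule trace_bounded_limit[OF tb i(2), of b]) (rule that)
    then show "\<exists>C. \<forall>u\<in>carrier X. \<bar>graph_trace u i\<bar> \<le> C * seminorm X u"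
      using i by (auto simp: graph_trace_def)
  qed
  then obtain C where C: "\<And>i u. i \<in> edge_ends G \<Longrightarrow> u \<in> carrier X \<Longrightarrow> \<bar>graph_trace u i\<bar> \<le> C i * seminorm X u"
    by metis
  have bound: "L2_set (graph_trace u) (edge_ends G) \<le> (\<Sum>i\<in>edge_ends G. C i) * seminorm X u"
    if "u \<in> carrier X" for u
  proof -
    have "L2_set (graph_trace u) (edge_ends G) \<le> (\<Sum>i\<in>edge_ends G. \<bar>graph_trace u i\<bar>)"
      by (rule L2_set_le_sum_abs)
    also have "\<dots> \<le> (\<Sum>i\<in>edge_ends G. C i * seminorm X u)" by (intro sum_mono C that)
    finally show ?thesis by (simp add: sum_distrib_right)
  qed
  have range: "graph_trace u \<in> trace_space G" for u
  proof -
    have "b = Initial \<or> b = Terminal" for b by (cases b) auto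
    then show ?thesis by (auto simp: trace_space_def graph_trace_def edge_ends_def)
  qed
  show ?thesis
    unfolding bounded_operator_def
    using range add cmult bound quasi_normed_add[OF X] quasi_normed_cmult[OF X]
    by (intro conjI ballI allI exI[of _ "\<Sum>i\<in>edge_ends G. C i"] restrict_PiE_iff[THEN iffD2]) auto
qed

text \<open>Off the carrier both operators are \<open>undefined\<close> by extensionality, and off
  the edge ends both vanish by the choice of \<open>trace_space\<close>. In the remaining
  coordinates density decides, through additivity applied to \<open>(u - d) + d\<close>.\<close>

lemma bounded_operator_unique:
  assumes X: "quasi_normed M X" and D: "D \<subseteq> carrier X"
    and dense: "\<And>u \<epsilon>. u \<in> carrier X \<Longrightarrow> 0 < \<epsilon> \<Longrightarrow> \<exists>d\<in>D. seminorm X (u - d) < \<epsilon>"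
    and T: "bounded_operator G X T" and S: "bounded_operator G X S" and eq: "\<And>u. u \<in> D \<Longrightarrow> T u = S u"
  shows "T = S"
proof
  fix u
  show "T u = S u"
  proof (cases "u \<in> carrier X")
    case False
    then show ?thesis
      using T S unfolding bounded_operator_def by (auto simp: PiE_def extensional_def)
  next
    case u: True
    have bound: "\<exists>B. \<forall>u\<in>carrier X. \<forall>i\<in>edge_ends G. \<bar>R u i\<bar> \<le> \<bar>B\<bar> * seminorm X u"
      if R: "bounded_operator G X R" for R
    proof -
      obtain B where B: "\<And>u. u \<in> carrier X \<Longrightarrow> L2_set (R u) (edge_ends G) \<le> B * seminorm X u"
        using R unfolding bounded_operator_def by blast
      have "\<bar>R u i\<bar> \<le> \<bar>B\<bar> * seminorm X u" if "u \<in> carrier X" "i \<in> edge_ends G" for u i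
      proof -
        have "\<bar>R u i\<bar> \<le> L2_set (\<lambda>i. \<bar>R u i\<bar>) (edge_ends G)"
          by (rule member_le_L2_set[OF finite_edge_ends that(2)])
        also have "\<dots> = L2_set (R u) (edge_ends G)" by (simp add: L2_set_def)
        also have "\<dots> \<le> B * seminorm X u" by (rule B[OF that(1)])
        also have "\<dots> \<le> \<bar>B\<bar> * seminorm X u"
          by (intro mult_right_mono quasi_normed_nonneg[OF X] that(1)) simp
        finally show ?thesis .
      qed
      then show ?thesis by blast
    qed
    obtain B where B: "\<And>u i. u \<in> carrier X \<Longrightarrow> i \<in> edge_ends G \<Longrightarrow> \<bar>T u i\<bar> \<le> \<bar>B\<bar> * seminorm X u"
      using bound[OF T] by blast
    obtain B' where B': "\<And>u i. u \<in> carrier X \<Longrightarrow> i \<in> edge_ends G \<Longrightarrow> \<bar>S u i\<bar> \<le> \<bar>B'\<bar> * seminorm X u"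
      using bound[OF S] by blast
    have "T u i = S u i" for i
    proof (cases "i \<in> edge_ends G")
      case False
      have zero: "R u i = 0" if "bounded_operator G X R" for R
      proof -
        have "R \<in> carrier X \<rightarrow>\<^sub>E trace_space G" using that unfolding bounded_operator_def by blast
        then have "R u \<in> trace_space G" using u by (rule PiE_mem)
        then show ?thesis using False unfolding trace_space_def by blast
      qed
      show ?thesis using zero[OF T] zero[OF S] by simp
    next
      case i: True
      have "\<bar>T u i - S u i\<bar> \<le> \<epsilon>" if "0 < \<epsilon>" for \<epsilon>
      proof -
        \<comment> \<open>The added 1 keeps the denominator positive when both operator bounds are
          zero.\<close>
        define \<delta> where "\<delta> = \<epsilon> / (\<bar>B\<bar> + \<bar>B'\<bar> + 1)"
        have \<delta>: "0 < \<delta>" using that by (simp add: \<delta>_def add_nonneg_pos)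
        obtain d where d: "d \<in> D" "seminorm X (u - d) < \<delta>" using dense[OF u \<delta>] by blast
        have dX: "d \<in> carrier X" using d(1) D by blast
        have ud: "u - d \<in> carrier X" by (rule quasi_normed_diff[OF X u dX])
        have split: "R u i = R (u - d) i + R d i" if "bounded_operator G X R" for R
        proof -
          have "R ((u - d) + d) = R (u - d) + R d"
            using that ud dX unfolding bounded_operator_def by blast
          from fun_cong[OF this, of i] show ?thesis by simp
        qed
        have "\<bar>T u i - S u i\<bar> = \<bar>T (u - d) i - S (u - d) i\<bar>"
          using split[OF T] split[OF S] eq[OF d(1)] by simp
        also have "\<dots> \<le> \<bar>B\<bar> * seminorm X (u - d) + \<bar>B'\<bar> * seminorm X (u - d)"
          using B[OF ud i] B'[OF ud i] by linarith
        also have "\<dots> = (\<bar>B\<bar> + \<bar>B'\<bar>) * seminorm X (u - d)" by (simp add: distrib_right)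
        also have "\<dots> \<le> (\<bar>B\<bar> + \<bar>B'\<bar> + 1) * \<delta>"
          using d(2) quasi_normed_nonneg[OF X ud] by (intro mult_mono) auto
        also have "\<dots> = \<epsilon>" by (simp add: \<delta>_def add_nonneg_pos less_imp_neq[symmetric])
        finally show ?thesis .
      qed
      then have "\<bar>T u i - S u i\<bar> \<le> 0" by (rule field_le_epsilon[of _ 0, simplified])
      then show ?thesis by simp
    qed
    then show ?thesis by blast
  qed
qed

text \<open>On \<open>D\<close> the functions are continuous on the closed edges, so the averages
  converge to the end values and \<open>graph_trace\<close> does extend
  \<open>end_trace G\<close>.\<close>

lemma unique_extensionI:
  assumes X: "quasi_normed 2 X" and tb: "trace_bounded X" and D: "D \<subseteq> carrier X"
    and cont: "\<And>u e. u \<in> D \<Longrightarrow> e \<in> edges G \<Longrightarrow> continuous_on {0..len G e} (u e)"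
    and dense: "\<And>u \<epsilon>. u \<in> carrier X \<Longrightarrow> 0 < \<epsilon> \<Longrightarrow> \<exists>d\<in>D. seminorm X (u - d) < \<epsilon>"
  shows "has_unique_bounded_extension G D (end_trace G) X"
  unfolding has_unique_bounded_extension_def
proof (intro conjI D ex1I[of _ "restrict graph_trace (carrier X)"] ballI bounded_operator_graph_trace[OF X tb])
  show restrict: "restrict graph_trace (carrier X) u = end_trace G u" if u: "u \<in> D" for u
  proof -
    have "graph_trace u i = end_trace G u i" for i :: "'e \<times> edge_end"
      using interval_trace_continuous[OF len_pos cont[OF u], of "fst i" "snd i"]
      by (cases i; cases "snd i") (auto simp: graph_trace_def end_trace_def)
    then show ?thesis using u D by (auto simp: fun_eq_iff)
  qed
  fix T assume "bounded_operator G X T \<and> (\<forall>u\<in>D. T u = end_trace G u)"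
  then show "T = restrict graph_trace (carrier X)"
    using restrict by (intro bounded_operator_unique[OF X D dense _ bounded_operator_graph_trace[OF X tb]]) auto
qed

section \<open>The trace bound in each order\<close>

lemma trace_bounded_Ht_int_1: "trace_bounded (Ht_int G 1)"
  unfolding trace_bounded_def
proof (intro conjI ballI allI)
  fix e b assume e: "e \<in> edges G"
  obtain C where C: "0 \<le> C"
    "\<And>u. u \<in> L2_interval (len G e) \<Longrightarrow> \<bar>trace_approx (len G e) b 0 u\<bar> \<le> C * L2_norm_interval (len G e) u"
    "\<And>u j. u \<in> L2_interval (len G e) \<Longrightarrow>
       trace_jump (len G e) b j u \<le> C * sqrt 2 ^ j * L2_norm_interval (len G e) u"
    "\<And>u j. u \<in> H_interval 1 (len G e) \<Longrightarrow>
       trace_jump (len G e) b j u \<le> C / sqrt 2 ^ j * H_norm_interval 1 (len G e) u"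
    by (rule trace_approx_bounds[OF len_pos[OF e], of b]) (rule that)
  have *: "\<bar>trace_approx (len G e) b 0 (u e)\<bar> \<le> C * seminorm (Ht_int G 1) u"
    "trace_jump (len G e) b j (u e)
         \<le> C * (1 / sqrt 2) ^ j * seminorm (Ht_int G 1) u" if u: "u \<in> carrier (Ht_int G 1)" for u j
  proof -
    have ue: "u e \<in> H_interval 1 (len G e)" using u e by (simp add: carrier_Ht_int)
    have "\<bar>trace_approx (len G e) b 0 (u e)\<bar> \<le> C * L2_norm_interval (len G e) (u e)"
      by (rule C(2)[OF H_interval_L2[OF ue]])
    also have "\<dots> \<le> C * seminorm (Ht_int G 1) u"
      using L2_norm_le_L2_graph[OF e, of u] L2_graph_le_Ht_int[OF u] by (intro mult_left_mono C(1)) simp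
    finally show "\<bar>trace_approx (len G e) b 0 (u e)\<bar> \<le> C * seminorm (Ht_int G 1) u" .
    have "trace_jump (len G e) b j (u e)
        \<le> C / sqrt 2 ^ j * H_norm_interval 1 (len G e) (u e)" by (rule C(4)[OF ue])
    also have "\<dots> \<le> C / sqrt 2 ^ j * seminorm (Ht_int G 1) u"
      using C(1) by (intro mult_left_mono H_norm_le_Ht_int e) simp
    finally show "trace_jump (len G e) b j (u e)
         \<le> C * (1 / sqrt 2) ^ j * seminorm (Ht_int G 1) u" by (simp add: power_one_over)
  qed
  show "\<exists>C \<rho>. trace_bound (Ht_int G 1) e b C \<rho>"
    unfolding trace_bound_def
    by (rule exI[of _ C], rule exI[of _ "1 / sqrt 2"], intro conjI ballI allI sqrt2_inverse *)
qed (rule Ht_int_subset_L2_graph)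

text \<open>Reduces every order s >= 1 to H^1. The constant in \<open>trace_bound\<close> has no
  prescribed sign, hence the absolute value in the proof.\<close>

lemma trace_bounded_mono:
  assumes X: "trace_bounded X" "quasi_normed M X" and sub: "carrier Z \<subseteq> carrier X"
    and le: "\<And>u. u \<in> carrier Z \<Longrightarrow> seminorm X u \<le> c * seminorm Z u"
  shows "trace_bounded Z"
  unfolding trace_bounded_def
proof (intro conjI ballI allI)
  show "carrier Z \<subseteq> carrier (L2_graph G)" using X(1) sub by (auto simp: trace_bounded_def)
  fix e b assume e: "e \<in> edges G"
  obtain C \<rho> where C: "trace_bound X e b C \<rho>"
    using X(1) e unfolding trace_bounded_def by blast
  have scale: "C * k * seminorm X u \<le> (\<bar>C\<bar> * c) * k * seminorm Z u" if u: "u \<in> carrier Z" "0 \<le> k" for u k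
  proof -
    have "C * k * seminorm X u \<le> \<bar>C\<bar> * k * seminorm X u"
      using u sub by (intro mult_right_mono quasi_normed_nonneg[OF X(2)]) auto
    also have "\<dots> \<le> \<bar>C\<bar> * k * (c * seminorm Z u)"
      using u by (intro mult_left_mono le) auto
    finally show ?thesis by (simp add: mult_ac)
  qed
  show "\<exists>C \<rho>. trace_bound Z e b C \<rho>"
    unfolding trace_bound_def
  proof (rule exI[of _ "\<bar>C\<bar> * c"], rule exI[of _ \<rho>], intro conjI ballI allI trace_boundD(1,2)[OF C])
    fix u j assume u: "u \<in> carrier Z"
    then have uX: "u \<in> carrier X" using sub by blast
    show "\<bar>trace_approx (len G e) b 0 (u e)\<bar> \<le> \<bar>C\<bar> * c * seminorm Z u"
      using trace_boundD(3)[OF C uX] scale[OF u, of 1] by simp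
    show "trace_jump (len G e) b j (u e)
         \<le> \<bar>C\<bar> * c * \<rho> ^ j * seminorm Z u"
      using trace_boundD(4)[OF C uX, of j] scale[OF u, of "\<rho> ^ j"] trace_boundD(1)[OF C] by simp
  qed
qed

text \<open>Splitting \<open>u = a + b\<close>, the \<open>j\<close>-th increment of the approximate traces is at most a multiple of
  \<open>2^(j/2) (\<parallel>a\<parallel> + 2^(-j) \<parallel>b\<parallel>)\<close>, hence of \<open>2^(j/2) K(2^(-j), u)\<close>, and thus decays like
  \<open>2^(j (1/2 - s))\<close>.\<close>

theorem trace_bounded_interp:
  assumes H: "quasi_normed 1 Y" "carrier Y \<subseteq> carrier (Ht_int G 1)" "seminorm Y = seminorm (Ht_int G 1)"
    and s: "1 / 2 < s" "s < 1"
  shows "trace_bounded (interp (L2_graph G) Y s)"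
  unfolding trace_bounded_def
proof (intro conjI ballI allI)
  interpret interpolation_couple "L2_graph G" Y s
  proof
    show "carrier Y \<subseteq> carrier (L2_graph G)" using H(2) Ht_int_subset_L2_graph by blast
    show "seminorm (L2_graph G) u \<le> seminorm Y u" if "u \<in> carrier Y" for u
      unfolding H(3) using that H(2) L2_graph_le_Ht_int by blast
  qed (use H s quasi_normed_L2_graph in auto)
  let ?Z = "interp (L2_graph G) Y s"
  show "carrier ?Z \<subseteq> carrier (L2_graph G)" using interp_carrier_X by blast
  fix e b assume e: "e \<in> edges G"
  obtain C where C: "0 \<le> C"
    "\<And>u. u \<in> L2_interval (len G e) \<Longrightarrow> \<bar>trace_approx (len G e) b 0 u\<bar> \<le> C * L2_norm_interval (len G e) u"
    "\<And>u j. u \<in> L2_interval (len G e) \<Longrightarrow>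
       trace_jump (len G e) b j u \<le> C * sqrt 2 ^ j * L2_norm_interval (len G e) u"
    "\<And>u j. u \<in> H_interval 1 (len G e) \<Longrightarrow>
       trace_jump (len G e) b j u \<le> C / sqrt 2 ^ j * H_norm_interval 1 (len G e) u"
    by (rule trace_approx_bounds[OF len_pos[OF e], of b]) (rule that)
  define \<rho> where "\<rho> = sqrt 2 * 2 powr (- s)"
  have \<rho>: "0 \<le> \<rho>" "\<rho> < 1"
  proof -
    have "\<rho> = 2 powr (1 / 2 - s)" unfolding \<rho>_def
      by (simp add: powr_diff powr_minus_divide powr_half_sqrt)
    also have "\<dots> < 2 powr 0" using s by (intro powr_less_mono) auto
    finally show "\<rho> < 1" by simp
  qed (simp add: \<rho>_def)
  \<comment> \<open>Large enough for the increments, by \<open>inc_K\<close> and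
    \<open>K_le_interp\<close>, and for the first average, by \<open>X_le_interp\<close>.\<close>
  define C' where "C' = 2 * C * sqrt (2 * s)"
  have inc_K: "trace_jump (len G e) b j (u e)
      \<le> 2 * C * sqrt 2 ^ j * K ((1 / 2) ^ j) u" if u: "u \<in> carrier (L2_graph G)" for u j
  \<comment> \<open>To pass to the infimum over decompositions by \<open>K_ge\<close>, the constant
    is divided away and has to be nonzero.\<close>
  proof (cases "C = 0")
    case True
    then show ?thesis using C(3)[of "u e" j] u e by (simp add: carrier_L2_graph)
  next
    case False
    then have pos: "0 < 2 * C * sqrt 2 ^ j" using C(1) by simp
    let ?\<Delta> = "\<lambda>f. trace_approx (len G e) b (Suc j) f - trace_approx (len G e) b j f"
    have "\<bar>?\<Delta> (u e)\<bar> / (2 * C * sqrt 2 ^ j) \<le> K ((1 / 2) ^ j) u"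
    proof (rule K_ge[OF u])
      fix a c assume ac: "a \<in> carrier (L2_graph G)" "c \<in> carrier Y" "u = a + c"
      let ?A = "seminorm (L2_graph G) a" and ?B = "seminorm Y c"
      have ae: "a e \<in> L2_interval (len G e)" using ac(1) e by (simp add: carrier_L2_graph)
      have ce: "c e \<in> H_interval 1 (len G e)" using ac(2) e H(2) by (auto simp: carrier_Ht_int)
      have "?\<Delta> (u e) = ?\<Delta> (a e) + ?\<Delta> (c e)"
        unfolding ac(3) gfun_plus trace_approx_add[OF len_pos[OF e] ae H_interval_L2[OF ce]] by simp
      then have "\<bar>?\<Delta> (u e)\<bar> \<le> \<bar>?\<Delta> (a e)\<bar> + \<bar>?\<Delta> (c e)\<bar>" by simp
      also have "\<bar>?\<Delta> (a e)\<bar> \<le> C * sqrt 2 ^ j * ?A"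
        using C(3)[OF ae, of j] mult_left_mono[OF L2_norm_le_L2_graph[OF e, of a], of "C * sqrt 2 ^ j"] C(1)
        by simp
      also have "\<bar>?\<Delta> (c e)\<bar> \<le> C / sqrt 2 ^ j * ?B"
        unfolding H(3)
        using C(4)[OF ce, of j] mult_left_mono[OF H_norm_le_Ht_int[OF e, of 1 c], of "C / sqrt 2 ^ j"] C(1)
        by simp
      also have "C / sqrt 2 ^ j * ?B = C * sqrt 2 ^ j * ((1 / 2) ^ j * ?B)"
      proof -
        have "sqrt 2 ^ j * sqrt 2 ^ j = (2::real) ^ j" by (simp flip: power_mult_distrib)
        then show ?thesis by (simp add: power_one_over field_simps)
      qed
      also have "C * sqrt 2 ^ j * ?A + \<dots> = C * sqrt 2 ^ j * (?A + (1 / 2) ^ j * ?B)"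
        by (simp add: distrib_left)
      \<comment> \<open>Each of the two summands is at most the quadratic cost; this is the factor 2
        in \<open>inc_K\<close>.\<close>
      also have "\<dots> \<le> C * sqrt 2 ^ j * (cost ((1 / 2) ^ j) a c + cost ((1 / 2) ^ j) a c)"
        using C(1) by (intro mult_left_mono add_mono real_le_rsqrt) (auto simp: power_mult_distrib)
      finally have "\<bar>?\<Delta> (u e)\<bar> \<le> 2 * C * sqrt 2 ^ j * cost ((1 / 2) ^ j) a c" by simp
      then show "\<bar>?\<Delta> (u e)\<bar> / (2 * C * sqrt 2 ^ j) \<le> cost ((1 / 2) ^ j) a c"
        using pos by (simp only: pos_divide_le_eq mult.commute)
    qed
    then show ?thesis using pos by (simp only: pos_divide_le_eq mult.commute)
  qed
  have inc: "trace_jump (len G e) b j (u e)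
      \<le> C' * \<rho> ^ j * seminorm ?Z u" if u: "u \<in> carrier ?Z" for u j
  proof -
    note inc_K[OF interp_carrier_X[OF u], of j]
    also have "2 * C * sqrt 2 ^ j * K ((1 / 2) ^ j) u \<le>
        2 * C * sqrt 2 ^ j * (sqrt (2 * s) * ((1 / 2) ^ j) powr s * seminorm ?Z u)"
      using C(1) by (intro mult_left_mono K_le_interp u) auto
    also have "((1 / 2) ^ j) powr s = (2 powr (- s)) ^ j"
      by (simp add: powr_minus_divide powr_divide power_one_over powr_power powr_realpow[symmetric] powr_powr mult.commute)
    also have "2 * C * sqrt 2 ^ j * (sqrt (2 * s) * (2 powr - s) ^ j * seminorm ?Z u) = C' * \<rho> ^ j * seminorm ?Z u"
      by (simp add: C'_def \<rho>_def power_mult_distrib mult_ac)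
    finally show ?thesis .
  qed
  have start: "\<bar>trace_approx (len G e) b 0 (u e)\<bar> \<le> C' * seminorm ?Z u" if u: "u \<in> carrier ?Z" for u
  proof -
    have ue: "u e \<in> L2_interval (len G e)" using interp_carrier_X[OF u] e by (simp add: carrier_L2_graph)
    have "\<bar>trace_approx (len G e) b 0 (u e)\<bar> \<le> C * L2_norm_interval (len G e) (u e)" by (rule C(2)[OF ue])
    also have "\<dots> \<le> C * (2 * sqrt (2 * s) * seminorm ?Z u)"
      using L2_norm_le_L2_graph[OF e, of u] X_le_interp[OF u] by (intro mult_left_mono C(1)) simp
    finally show ?thesis by (simp add: C'_def mult_ac)
  qed
  show "\<exists>C \<rho>. trace_bound ?Z e b C \<rho>"
    unfolding trace_bound_def
    by (rule exI[of _ C'], rule exI[of _ \<rho>], intro conjI ballI allI \<rho> start inc)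
qed

text \<open>The two scales of the theorem are treated simultaneously: \<open>H\<close> is either \<open>Ht_int G\<close> or
  \<open>HtC_int G\<close>.\<close>

theorem unique_extension_scale:
  assumes H: "\<And>r. quasi_normed 1 (H r)" "\<And>r. carrier (H r) \<subseteq> carrier (Ht_int G r)"
      "\<And>r. seminorm (H r) = seminorm (Ht_int G r)" "carrier (H 2) \<subseteq> carrier (H 1)"
    and D: "D \<subseteq> carrier (H 2)" "\<And>u e. u \<in> D \<Longrightarrow> e \<in> edges G \<Longrightarrow> continuous_on {0..len G e} (u e)"
    and dense: "\<And>r u \<epsilon>. 1 \<le> r \<Longrightarrow> u \<in> carrier (H r) \<Longrightarrow> 0 < \<epsilon> \<Longrightarrow> \<exists>d\<in>D. seminorm (H r) (u - d) < \<epsilon>"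
    and s: "1 / 2 < s" "s \<le> 2"
  shows "has_unique_bounded_extension G D (end_trace G)
     (if s < 1 then interp (L2_graph G) (H 1) s else if s = 1 then H 1
      else if s < 2 then interp (H 1) (H 2) (s - 1) else H 2)"
proof -
  have D1: "D \<subseteq> carrier (H 1)" using D(1) H(4) by blast
  have q2: "quasi_normed 2 (H r)" for r by (rule quasi_normed_mono[OF H(1)]) simp
  have tb1: "trace_bounded (H 1)"
    by (rule trace_bounded_mono[OF trace_bounded_Ht_int_1 quasi_normed_Ht_int H(2), of 1]) (simp add: H(3))
  have le12: "seminorm (H 1) u \<le> seminorm (H 2) u" for u
    unfolding H(3) by (rule Ht_int_mono(2)) simp
  note dense1 = dense[of 1, OF order_refl] and dense2 = dense[of 2, OF one_le_numeral]
  \<comment> \<open>Only the first case interpolates the trace estimate; the others inherit it from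
    \<open>H 1\<close>. Density is taken from \<open>H 1\<close> for \<open>s <= 1\<close> and from
    \<open>H 2\<close> otherwise, the smaller space of the couple when there is one.\<close>
  consider "s < 1" | "s = 1" | "1 < s" "s < 2" | "s = 2" using s(2) by linarith
  then show ?thesis
  proof cases
    case 1
    interpret interpolation_couple "L2_graph G" "H 1" s
    proof
      show "carrier (H 1) \<subseteq> carrier (L2_graph G)" using H(2) Ht_int_subset_L2_graph by blast
      show "seminorm (L2_graph G) u \<le> seminorm (H 1) u" if "u \<in> carrier (H 1)" for u
        unfolding H(3) using that H(2) L2_graph_le_Ht_int by blast
    qed (use 1 s in \<open>simp_all add: H(1) quasi_normed_L2_graph del: One_nat_def\<close>)
    have sub: "D \<subseteq> carrier (interp (L2_graph G) (H 1) s)"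
      using D1 Y_subset_interp by blast
    have tb: "trace_bounded (interp (L2_graph G) (H 1) s)"
      by (rule trace_bounded_interp[OF H(1-3) s(1) 1])
    have "has_unique_bounded_extension G D (end_trace G) (interp (L2_graph G) (H 1) s)"
    proof (rule unique_extensionI[OF quasi_normed_interp tb sub])
      show "\<exists>d\<in>D. seminorm (interp (L2_graph G) (H 1) s) (u - d) < \<epsilon>"
        if "u \<in> carrier (interp (L2_graph G) (H 1) s)" "0 < \<epsilon>" for u \<epsilon>
        by (rule dense_interp[OF D1 _ that]) (rule dense1)
    qed (rule D(2))
    then show ?thesis using 1 by (simp only: if_True)
  next
    case 2
    have "has_unique_bounded_extension G D (end_trace G) (H 1)"
      by (rule unique_extensionI[OF q2 tb1 D1]) (rule D(2) dense1; assumption)+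
    then show ?thesis using 2 by simp
  next
    case 3
    interpret interpolation_couple "H 1" "H 2" "s - 1"
      by (unfold_locales; (rule H(1) H(4) le12)?) (use 3 in simp_all)
    have sub: "D \<subseteq> carrier (interp (H 1) (H 2) (s - 1))"
      using D(1) Y_subset_interp by blast
    have "carrier (interp (H 1) (H 2) (s - 1)) \<subseteq> carrier (H 1)"
      using interp_carrier_X by blast
    then have tb: "trace_bounded (interp (H 1) (H 2) (s - 1))"
      by (rule trace_bounded_mono[OF tb1 H(1) _ X_le_interp])
    have "has_unique_bounded_extension G D (end_trace G) (interp (H 1) (H 2) (s - 1))"
    proof (rule unique_extensionI[OF quasi_normed_interp tb sub])
      show "\<exists>d\<in>D. seminorm (interp (H 1) (H 2) (s - 1)) (u - d) < \<epsilon>"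
        if "u \<in> carrier (interp (H 1) (H 2) (s - 1))" "0 < \<epsilon>" for u \<epsilon>
        by (rule dense_interp[OF D(1) _ that]) (rule dense2)
    qed (rule D(2))
    then show ?thesis using 3 by simp
  next
    case 4
    have tb2: "trace_bounded (H 2)"
      by (rule trace_bounded_mono[OF tb1 H(1) H(4), of 1]) (simp only: mult_1 le12)
    have "has_unique_bounded_extension G D (end_trace G) (H 2)"
      by (rule unique_extensionI[OF q2 tb2 D(1)]) (rule D(2) dense2; assumption)+
    then show ?thesis using 4 by simp
  qed
qed

lemma C2_edges_continuous_on:
  assumes "u \<in> C2_edges G" "e \<in> edges G"
  shows "continuous_on {0..len G e} (u e)"
proof -
  obtain f' where "\<And>x. x \<in> {0..len G e} \<Longrightarrow> (u e has_real_derivative f' x) (at x within {0..len G e})"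
    using assms unfolding C2_edges_def C2_interval_def by blast
  then show ?thesis by (rule DERIV_continuous_on)
qed

end

theorem theorem5p6:
  fixes G :: "('v, 'e) metric_graph"
  assumes "compact_metric_graph G"
  shows "(\<forall>s::real. 1/2 < s \<and> s \<le> 2 \<longrightarrow>
            has_unique_bounded_extension G (C_graph G \<inter> C2_edges G) (end_trace G) (H_graph G s)) \<and>
         (\<forall>s::real. 1/2 < s \<and> s \<le> 2 \<longrightarrow>
            has_unique_bounded_extension G (C2_edges G) (end_trace G) (Ht_graph G s))"
proof (intro conjI allI impI)
  interpret metric_graph G by unfold_locales (rule assms)
  fix s :: real assume s: "1/2 < s \<and> s \<le> 2"
  have HtC_sub: "carrier (HtC_int G 2) \<subseteq> carrier (HtC_int G 1)"
    using Ht_int_mono(1)[of 1 2] unfolding subset_iff carrier_HtC_int by auto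
  show "has_unique_bounded_extension G (C_graph G \<inter> C2_edges G) (end_trace G) (H_graph G s)"
    unfolding H_graph_def
  proof (rule unique_extension_scale[where H = "HtC_int G"])
    show "carrier (HtC_int G r) \<subseteq> carrier (Ht_int G r)" for r by (auto simp: carrier_HtC_int)
  qed (use s HtC_sub C_C2_subset_HtC_int[of 2] in
      \<open>auto intro: quasi_normed_HtC_int seminorm_HtC_int C2_edges_continuous_on HtC_int_dense\<close>)
  show "has_unique_bounded_extension G (C2_edges G) (end_trace G) (Ht_graph G s)"
    unfolding Ht_graph_def
    by (rule unique_extension_scale[where H = "Ht_int G"])
      (use s Ht_int_mono(1)[of 1 2] C2_edges_subset_Ht_int[of 2] in
        \<open>auto intro: quasi_normed_Ht_int C2_edges_continuous_on Ht_int_dense\<close>)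
qed

end
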